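(* There exist constants $a,b>0$ such that the following hold as $n\to\infty$, for any function $d=d(n)$ with $0\le d(n)\le n-1$: (i) if $d(n)\le \sqrt{n}\,(\log n)^{-a}$ for all large $n$, then $P(n,d(n))/n\to 1$; (ii) if $d(n)\ge \sqrt{n}\,(\log n)^{b}$ for all large $n$, then $P(n,d(n))/(n\log n)\to 1$.
   Context: All graphs are finite and simple; $\log$ is the natural logarithm, and $[N]=\{1,2,\dots,N\}$. A product-injective labeling of a graph $G$ is an injective map $\chi:V(G)\to\mathbb{Z}$ such that $\chi(u)\chi(v)\neq\chi(x)\chi(y)$ for any two distinct edges $uv,xy\in E(G)$. $P(G)$ denotes the smallest positive integer $N$ for which there is a product-injective labeling $\chi:V(G)\to[N]$. $P(n,d)$ denotes the maximum of $P(G)$ over all graphs $G$ on $n$ vertices with maximum degree at most $d$. *)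

theory Defs
  imports "HOL-Analysis.Analysis"
begin

text \<open>A finite simple graph on the vertex set {0..<n} is represented by its edge set,
  a set of two-element subsets of {0..<n}.  Every n-vertex graph is isomorphic to one of these.\<close>

definition simple_graph :: "nat \<Rightarrow> nat set set \<Rightarrow> bool" where
  "simple_graph n E \<longleftrightarrow> E \<subseteq> {{u, v} | u v. u \<noteq> v \<and> u < n \<and> v < n}"

definition degree :: "nat set set \<Rightarrow> nat \<Rightarrow> nat" where
  "degree E v = card {e \<in> E. v \<in> e}"

definition max_degree_le :: "nat \<Rightarrow> nat set set \<Rightarrow> nat \<Rightarrow> bool" where
  "max_degree_le n E d \<longleftrightarrow> (\<forall>v < n. degree E v \<le> d)"

definition product_injective_labeling ::
    "nat \<Rightarrow> nat set set \<Rightarrow> (nat \<Rightarrow> int) \<Rightarrow> bool" where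
  "product_injective_labeling n E lab \<longleftrightarrow>
     inj_on lab {0..<n} \<and>
     (\<forall>u v x y. {u, v} \<in> E \<longrightarrow> {x, y} \<in> E \<longrightarrow> {u, v} \<noteq> {x, y}
        \<longrightarrow> lab u * lab v \<noteq> lab x * lab y)"

definition P_graph :: "nat \<Rightarrow> nat set set \<Rightarrow> nat" where
  "P_graph n E = (LEAST N. N > 0 \<and>
      (\<exists>lab. product_injective_labeling n E lab \<and> lab ` {0..<n} \<subseteq> {1..int N}))"

definition P_nd :: "nat \<Rightarrow> nat \<Rightarrow> nat" where
  "P_nd n d = Max {P_graph n E | E. simple_graph n E \<and> max_degree_le n E d}"

end

theory Submission
  imports Defs "HOL-Complex_Analysis.Complex_Analysis" "HOL-Number_Theory.Prime_Powers"
    "HOL-Real_Asymp.Real_Asymp"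
begin

text \<open>In the sparse range, valid labelings are counted by adding one vertex at a time: the
  equation \<open>a e = b c\<close> has at most \<open>N\<^sup>2 (1 + log N)\<^sup>2\<close> solutions in \<open>[N]\<close>, so for \<open>N = (1 + \<epsilon>) n\<close> each
  new vertex has at least \<open>\<epsilon> n / 2\<close> admissible labels on average.

  In the dense range, labeling with the first \<open>n\<close> primes gives the upper bound; since
  \<open>P(K\<^sub>n) \<sim> n log n\<close> is equivalent to the prime number theorem, the latter is proved on the way,
  by Newman's contour argument.  For the lower bound take a random graph of expected degree of order
  \<open>d\<close> and \<open>N = (1 - \<epsilon>) n log n\<close>, so that \<open>n\<close> labels exceed the number of primes up to \<open>N\<close> by a
  constant factor.  Up to few exceptions, an integer below \<open>N\<close> either is a prime times a
  polylogarithmic factor or has a divisor that is neither too small nor too large.  In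
  both cases the labels, viewed as edges \<open>(u, v)\<close> with \<open>a = u v\<close> of a bipartite graph, contain at
  least \<open>n\<^sup>2 / (log n)\<^sup>1\<^sup>1\<close> four-cycles by convexity.  The two diagonals of a four-cycle are vertex
  pairs with the same product, and these pairs of vertex pairs are disjoint, so the events that both
  diagonals are edges are independent.  A fixed labeling survives with
  probability too small to compensate for the \<open>N ^ n\<close> labelings.\<close>

subsection \<open>A Tauberian theorem of Newman\<close>

text \<open>Both thresholds sit near \<open>sqrt n\<close> for related reasons. In the sparse range
  at most \<open>n * d^2\<close> triples of old vertices can conflict with a new vertex, and each
  forbids on average about \<open>log^2 n / n\<close> labels; so about \<open>d^2 * log^2 n\<close>
  labels are lost, which has to be o(n). In the dense range about
  \<open>(n^2 / polylog) * (d / n)^2\<close> rectangles are expected to have both diagonals as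
  edges, and this has to exceed the entropy \<open>n log n\<close> of the labelings. Chebyshev
  bounds would not give the constant 1 in (ii): for every \<epsilon> > 0, the interval up to
  \<open>(1 + \<epsilon>) n log n\<close> must contain \<open>n\<close> primes, and \<open>n\<close>
  labels below \<open>(1 - \<epsilon>) n log n\<close> must outnumber the primes there by a positive
  proportion of \<open>n\<close>. Chebyshev's estimate serves only as the boundedness hypothesis of
  the Tauberian theorem. Independence of the conflicts rests on factoring each label in one chosen
  way: a vertex is then a single edge \<open>(u, v)\<close> of the bipartite graph, and a rectangle
  can be recovered from either of its diagonals.\<close>

lemma powr_diff_MVT:
  fixes a r :: real
  assumes "a > 0"
  obtains \<xi> where "a < \<xi>" "\<xi> < a + 1" "(a + 1) powr r - a powr r = r * \<xi> powr (r - 1)"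
proof -
  have "\<exists>\<xi>. a < \<xi> \<and> \<xi> < a + 1 \<and> (a + 1) powr r - a powr r = (a + 1 - a) * (r * \<xi> powr (r - 1))"
  proof (rule MVT2)
    fix y assume "a \<le> y" "y \<le> a + 1"
    then show "((\<lambda>y. y powr r) has_real_derivative r * y powr (r - 1)) (at y)"
      using assms by (auto intro!: derivative_eq_intros simp: powr_diff)
  qed simp
  then show ?thesis using that by auto
qed

text \<open>Comparison with the integral of \<open>t powr (x - 1)\<close>. For
  \<open>x \<le> 1\<close> the integrand decreases and each term fits into the interval before it;
  for \<open>x > 1\<close> it increases, terms fit into the interval after them, and the last one is
  left over. That leftover becomes the \<open>C / N\<close> in Newman's estimate. The factor
  \<open>1 / x\<close> is the one the kernel cancels.\<close>

lemma sum_powr_le: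
  fixes x :: real
  assumes x: "x > 0" and N: "N \<ge> 1"
  shows "(\<Sum>k<N. real (Suc k) powr (x - 1)) \<le> real N powr x / x + real N powr (x - 1)"
proof (cases "x \<le> 1")
  case True
  have "(\<Sum>k<N. real (Suc k) powr (x - 1)) \<le> real N powr x / x" using N
  proof (induction N rule: nat_induct_at_least)
    case base then show ?case using True x by (simp add: divide_simps)
  next
    case (Suc n)
    obtain \<xi> where \<xi>: "real n < \<xi>" "\<xi> < real n + 1"
      "(real n + 1) powr x - real n powr x = x * \<xi> powr (x - 1)"
      using powr_diff_MVT[of "real n" x] Suc by auto
    have "(real n + 1) powr (x - 1) \<le> \<xi> powr (x - 1)"
      using \<xi> True Suc by (intro powr_mono2') auto
    then have "x * (real n + 1) powr (x - 1) \<le> (real n + 1) powr x - real n powr x"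
      using \<xi>(3) x by simp
    then have "(real n + 1) powr (x - 1) \<le> (real n + 1) powr x / x - real n powr x / x"
      using x by (simp add: field_simps)
    then show ?case using Suc by (simp add: add.commute)
  qed
  then show ?thesis by (simp add: add_increasing2)
next
  case False
  show ?thesis using N
  proof (induction N rule: nat_induct_at_least)
    case base then show ?case using x by simp
  next
    case (Suc n)
    obtain \<xi> where \<xi>: "real n < \<xi>" "\<xi> < real n + 1"
      "(real n + 1) powr x - real n powr x = x * \<xi> powr (x - 1)"
      using powr_diff_MVT[of "real n" x] Suc by auto
    have "real n powr (x - 1) \<le> \<xi> powr (x - 1)"
      using \<xi> False Suc by (intro powr_mono2) auto
    then have "x * real n powr (x - 1) \<le> (real n + 1) powr x - real n powr x"
      using \<xi>(3) x by simp
    then have "real n powr (x - 1) \<le> (real n + 1) powr x / x - real n powr x / x"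
      using x by (simp add: field_simps)
    then show ?case using Suc by (simp add: add.commute)
  qed
qed

text \<open>The mean value theorem bounds each term by a telescoping difference of
  \<open>t powr (- x) / x\<close>.\<close>

lemma tail_powr_le:
  fixes x :: real
  assumes x: "x > 0" and N: "N \<ge> 1"
  shows "summable (\<lambda>k. real (Suc (k + N)) powr (- 1 - x))"
    and "(\<Sum>k. real (Suc (k + N)) powr (- 1 - x)) \<le> real N powr (- x) / x"
proof -
  have le: "real (Suc (k + N)) powr (- 1 - x)
      \<le> real (k + N) powr (- x) / x - real (Suc k + N) powr (- x) / x" for k
  proof -
    obtain \<xi> where \<xi>: "real (k + N) < \<xi>" "\<xi> < real (k + N) + 1"
      "(real (k + N) + 1) powr (-x) - real (k + N) powr (-x) = (-x) * \<xi> powr (-x - 1)"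
      using powr_diff_MVT[of "real (k + N)" "-x"] N by auto
    have eq: "- 1 - x = - x - 1" by simp
    have "(real (k + N) + 1) powr (- 1 - x) \<le> \<xi> powr (- x - 1)"
      unfolding eq using \<xi> x N by (intro powr_mono2') auto
    then have "x * (real (k + N) + 1) powr (- 1 - x) \<le> real (k + N) powr (- x) - (real (k + N) + 1) powr (- x)"
      using \<xi>(3) x by (smt (verit) mult_left_mono mult_minus_left)
    then show ?thesis using x by (simp add: field_simps)
  qed
  have "(\<lambda>k. real (k + N) powr (- x) / x) \<longlonglongrightarrow> 0" using x by real_asymp
  from telescope_sums'[OF this]
  have s: "(\<lambda>k. real (k + N) powr (- x) / x - real (Suc k + N) powr (- x) / x) sums (real N powr (- x) / x)"
    by simp
  show sm: "summable (\<lambda>k. real (Suc (k + N)) powr (- 1 - x))"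
    by (rule summable_comparison_test'[OF sums_summable[OF s], of 0]) (use le in auto)
  show "(\<Sum>k. real (Suc (k + N)) powr (- 1 - x)) \<le> real N powr (- x) / x"
    using suminf_le[OF le sm sums_summable[OF s]] sums_unique[OF s] by simp
qed

section \<open>Contours for Newman's argument\<close>

text \<open>\<open>circlepath\<close> starts at angle 0 while the right half starts at
  \<open>- pi/2\<close>, so the arc from \<open>3*pi/2\<close> to \<open>2*pi\<close> is moved back
  by one period.\<close>

lemma contour_integral_two_half_circles:
  assumes R: "R > 0" and f: "continuous_on (sphere 0 R) f"
  shows "contour_integral (circlepath 0 R) f =
    contour_integral (part_circlepath 0 R (- pi/2) (pi/2)) f +
    contour_integral (part_circlepath 0 R (pi/2) (3*pi/2)) f"
proof -
  define h where "h = (\<lambda>t. f (R * cis t) * R * \<i> * cis t)"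
  have cont: "continuous_on A h" for A
    unfolding h_def using R
    by (intro continuous_intros continuous_on_compose2[OF f]) (auto simp: norm_mult)
  have int: "h integrable_on {a..b}" for a b
    by (intro integrable_continuous_real cont)
  have eq: "contour_integral (part_circlepath 0 R a b) f = integral {a..b} h" if "a < b" for a b
    using contour_integral_part_circlepath_eq[OF that, of 0 R f] by (simp add: h_def)
  have "part_circlepath 0 R (3*pi/2) (2*pi) = part_circlepath 0 R (- pi/2) 0"
  proof
    fix t
    have "linepath (3*pi/2) (2*pi) t = linepath (-pi/2) 0 t + 2 * pi"
      by (simp add: linepath_def field_simps)
    moreover have "exp (\<i> * complex_of_real (2 * pi)) = 1"
      by (simp add: complex_eq_iff Re_exp Im_exp)
    ultimately show "part_circlepath 0 R (3*pi/2) (2*pi) t = part_circlepath 0 R (- pi/2) 0 t"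
      unfolding part_circlepath_def by (simp only: of_real_add distrib_left exp_add mult_1_right)
  qed
  then have "integral {3*pi/2..2*pi} h = integral {-pi/2..0} h"
    using eq[of "3*pi/2" "2*pi"] eq[of "-pi/2" 0] pi_gt_zero by simp
  moreover have "integral {0..2*pi} h = integral {0..3*pi/2} h + integral {3*pi/2..2*pi} h"
    by (rule Henstock_Kurzweil_Integration.integral_combine[symmetric]) (use int in auto)
  moreover have "integral {0..3*pi/2} h = integral {0..pi/2} h + integral {pi/2..3*pi/2} h"
    by (rule Henstock_Kurzweil_Integration.integral_combine[symmetric]) (use int in auto)
  moreover have "integral {-pi/2..pi/2} h = integral {-pi/2..0} h + integral {0..pi/2} h"
    by (rule Henstock_Kurzweil_Integration.integral_combine[symmetric]) (use int in auto)
  ultimately show ?thesis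
    using eq[of 0 "2*pi"] eq[of "-pi/2" "pi/2"] eq[of "pi/2" "3*pi/2"] pi_gt_zero by (simp add: circlepath_def)
qed

text \<open>The segment leaves the imaginary axis at constant speed to the left, so the integrand is
  at most \<open>M * exp (- c * t)\<close>, whose integral is below \<open>M / c\<close>. With
  \<open>L = ln N\<close> this yields an explicit \<open>1 / ln N\<close> in place of a dominated
  convergence argument.\<close>

lemma norm_contour_integral_linepath_exp_le:
  fixes b :: complex
  assumes a: "Re a = 0" and b: "Re b < 0" and L: "L > 0" and M: "M \<ge> 0"
    and f: "continuous_on (closed_segment a b) f"
    and le: "\<And>z. z \<in> closed_segment a b \<Longrightarrow> norm (f z) \<le> M * exp (L * Re z)"
  shows "norm (contour_integral (linepath a b) f) \<le> M * norm (b - a) / (- Re b * L)"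
proof -
  define c where "c = - Re b * L"
  have c: "c > 0" using b L by (simp add: c_def mult_neg_pos)
  have "f contour_integrable_on linepath a b"
    using f by (rule contour_integrable_continuous_linepath)
  then have I: "((\<lambda>x. f (linepath a b x) * (b - a)) has_integral contour_integral (linepath a b) f) {0..1}"
    using has_contour_integral_integral has_contour_integral_linepath by blast
  have J: "((\<lambda>t. M * norm (b - a) * exp (- c * t)) has_integral
     (- M * norm (b - a) / c * exp (- c * 1) - (- M * norm (b - a) / c * exp (- c * 0)))) {0..1}"
    by (rule fundamental_theorem_of_calculus)
       (use c in \<open>auto intro!: derivative_eq_intros simp flip: has_real_derivative_iff_has_vector_derivative\<close>)
  have "norm (contour_integral (linepath a b) f) = norm (integral {0..1} (\<lambda>x. f (linepath a b x) * (b - a)))"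
    by (simp only: integral_unique[OF I])
  also have "\<dots> \<le> integral {0..1} (\<lambda>t. M * norm (b - a) * exp (- c * t))"
  proof (rule integral_norm_bound_integral)
    fix t :: real assume t: "t \<in> {0..1}"
    then have "linepath a b t \<in> closed_segment a b"
      by (simp add: linepath_in_path)
    from le[OF this] have "norm (f (linepath a b t)) \<le> M * exp (- c * t)"
      using a by (simp add: linepath_def c_def algebra_simps)
    then show "norm (f (linepath a b t) * (b - a)) \<le> M * norm (b - a) * exp (- c * t)"
      using mult_right_mono[of "norm (f (linepath a b t))" "M * exp (- c * t)" "norm (b - a)"]
      by (simp add: norm_mult mult.assoc mult.commute[of "exp _"])
  qed (use I J in auto)
  also have "\<dots> = M * norm (b - a) / c * (1 - exp (- c))"
    unfolding integral_unique[OF J] by (simp add: right_diff_distrib)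
  also have "\<dots> \<le> M * norm (b - a) / c * 1"
    using c M by (intro mult_left_mono) auto
  finally show ?thesis by (simp add: c_def)
qed


lemma path_image_half_circles:
  fixes R :: real
  assumes R: "R > 0"
  shows "z \<in> path_image (part_circlepath 0 R (- pi/2) (pi/2)) \<Longrightarrow> Re z \<ge> 0 \<and> norm z = R"
    and "z \<in> path_image (part_circlepath 0 R (pi/2) (3*pi/2)) \<Longrightarrow> Re z \<le> 0 \<and> norm z = R"
proof -
  show "z \<in> path_image (part_circlepath 0 R (- pi/2) (pi/2)) \<Longrightarrow> Re z \<ge> 0 \<and> norm z = R"
    using R by (auto simp: path_image_part_circlepath norm_mult Re_exp cos_ge_zero simp flip: cis_conv_exp)
  assume "z \<in> path_image (part_circlepath 0 R (pi/2) (3*pi/2))"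
  then obtain t where t: "z = R * cis t" "pi/2 \<le> t" "t \<le> 3*pi/2"
    using R by (auto simp: path_image_part_circlepath cis_conv_exp)
  have "cos (t - pi) \<ge> 0" using t by (intro cos_ge_zero) auto
  then show "Re z \<le> 0 \<and> norm z = R" using R t by (auto simp: norm_mult mult_nonneg_nonpos)
qed

text \<open>\<open>Ln (- z)\<close> is a primitive of \<open>1 / z\<close> off the nonnegative real
  axis. The two segments and the left half circle avoid that axis and share their endpoints, so they
  have the same integral; the winding number is therefore that of the full circle.\<close>

lemma newman_contour_winding:
  fixes R \<delta> :: real
  assumes R: "R > 0" and d: "\<delta> > 0"
  defines "\<Gamma> \<equiv> part_circlepath 0 R (- pi/2) (pi/2) +++
     (linepath (\<i> * R) (- complex_of_real \<delta>) +++ linepath (- complex_of_real \<delta>) (- (\<i> * R)))"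
  shows "valid_path \<Gamma>" "pathfinish \<Gamma> = pathstart \<Gamma>"
    "path_image \<Gamma> \<subseteq> {z. Re z \<ge> - \<delta> \<and> \<bar>Im z\<bar> \<le> R} - {0}"
    "winding_number \<Gamma> 0 = 1"
proof -
  let ?A = "part_circlepath 0 R (- pi/2) (pi/2)"
  let ?L = "part_circlepath 0 R (pi/2) (3*pi/2)"
  let ?V = "linepath (\<i> * R) (- complex_of_real \<delta>) +++ linepath (- complex_of_real \<delta>) (- (\<i> * R))"
  have trig: "cos (3 * pi / 2) = 0" "sin (3 * pi / 2) = -1"
    using cos_3over2_pi sin_3over2_pi by (metis times_divide_eq_left)+
  have ends: "pathstart ?A = - (\<i> * R)" "pathfinish ?A = \<i> * R"
      "pathstart ?L = \<i> * R" "pathfinish ?L = - (\<i> * R)"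
    by (auto simp: complex_eq_iff Re_exp Im_exp trig simp flip: cis_conv_exp)
  show valid: "valid_path \<Gamma>" and closed: "pathfinish \<Gamma> = pathstart \<Gamma>"
    unfolding \<Gamma>_def using ends by (auto intro!: valid_path_join)
  note imA = path_image_half_circles(1)[OF R] and imL = path_image_half_circles(2)[OF R]
  have imV: "z \<in> path_image ?V \<Longrightarrow> - \<delta> \<le> Re z \<and> \<bar>Im z\<bar> \<le> R \<and> (Re z < 0 \<or> Im z \<noteq> 0)" for z
  proof -
    have *: "- \<delta> \<le> - t * \<delta> \<and> (1 - t) * R \<le> R \<and> (1 - t) * R \<ge> 0 \<and> (- t * \<delta> < 0 \<or> (1 - t) * R \<noteq> 0)"
      if "0 \<le> t" "t \<le> 1" for t
    proof -
      have "t * \<delta> \<le> 1 * \<delta>" using that d by (intro mult_right_mono) auto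
      moreover have "(1 - t) * R \<le> 1 * R" using that R by (intro mult_right_mono) auto
      ultimately show ?thesis using that R d by (cases "t = 0") auto
    qed
    assume "z \<in> path_image ?V"
    then have "z \<in> closed_segment (\<i> * R) (- complex_of_real \<delta>) \<or> z \<in> closed_segment (- (\<i> * R)) (- complex_of_real \<delta>)"
      by (auto simp: path_image_join closed_segment_commute)
    then obtain t where t: "0 \<le> t" "t \<le> 1" "Re z = - t * \<delta>" "\<bar>Im z\<bar> = (1 - t) * R"
      using R by (auto simp: in_segment)
    show ?thesis using *[OF t(1,2)] t(3,4) by auto
  qed
  show im: "path_image \<Gamma> \<subseteq> {z. Re z \<ge> - \<delta> \<and> \<bar>Im z\<bar> \<le> R} - {0}"
  proof
    fix z assume "z \<in> path_image \<Gamma>"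
    then have "z \<in> path_image ?A \<or> z \<in> path_image ?V"
      unfolding \<Gamma>_def using path_image_join_subset by blast
    then show "z \<in> {z. Re z \<ge> - \<delta> \<and> \<bar>Im z\<bar> \<le> R} - {0}"
      using imA[of z] imV[of z] abs_Im_le_cmod[of z] R d by auto
  qed
  have prim: "((\<lambda>z. 1 / z) has_contour_integral (Ln (- pathfinish g) - Ln (- pathstart g))) g"
    if "valid_path g" "path_image g \<subseteq> {z. Re z < 0 \<or> Im z \<noteq> 0}" for g
  proof (rule contour_integral_primitive[OF _ that])
    fix z assume z: "z \<in> {z. Re z < 0 \<or> Im z \<noteq> 0}"
    then have "- z \<notin> \<real>\<^sub>\<le>\<^sub>0" "z \<noteq> 0" by (auto simp: complex_nonpos_Reals_iff)
    then show "((\<lambda>z. Ln (- z)) has_field_derivative 1 / z) (at z within {z. Re z < 0 \<or> Im z \<noteq> 0})"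
      by (auto intro!: derivative_eq_intros simp: field_simps)
  qed
  have cV: "((\<lambda>z. 1 / z) has_contour_integral (Ln (\<i> * R) - Ln (- (\<i> * R)))) ?V"
    using prim[of ?V] imV by force
  have cL: "((\<lambda>z. 1 / z) has_contour_integral (Ln (\<i> * R) - Ln (- (\<i> * R)))) ?L"
  proof -
    have "path_image ?L \<subseteq> {z. Re z < 0 \<or> Im z \<noteq> 0}"
      using imL R by (force simp: cmod_def)
    from prim[OF valid_path_part_circlepath this] show ?thesis unfolding ends by simp
  qed
  have cA: "(\<lambda>z. 1 / z) contour_integrable_on ?A"
    using imA R by (intro contour_integrable_continuous_part_circlepath continuous_intros) force
  have circ: "contour_integral (circlepath 0 R) (\<lambda>z. 1 / z) = 2 * pi * \<i>"
    using Cauchy_integral_circlepath_simple[of "\<lambda>_. 1" 0 R 0] R by (simp add: contour_integral_unique)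
  have "contour_integral \<Gamma> (\<lambda>z. 1 / z) = contour_integral ?A (\<lambda>z. 1 / z) + contour_integral ?V (\<lambda>z. 1 / z)"
    unfolding \<Gamma>_def using cA cV by (intro contour_integral_join) (auto simp: contour_integrable_on_def)
  also have "\<dots> = 2 * pi * \<i>"
  proof -
    have "continuous_on (sphere 0 R) (\<lambda>z::complex. 1 / z)"
      using R by (intro continuous_intros) auto
    from contour_integral_two_half_circles[OF R this] circ cV cL show ?thesis
      by (simp add: contour_integral_unique)
  qed
  finally show "winding_number \<Gamma> 0 = 1"
    using winding_number_valid_path[OF valid, of 0] im by auto
qed


text \<open>The kernel \<open>N ^ z * (1 / z + z / R\<^sup>2)\<close> has absolute value \<open>N ^ Re z * 2 * \<bar>Re z\<bar> / R\<^sup>2\<close> on the circle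
  of radius \<open>R\<close>, which cancels the factor \<open>1 / \<bar>Re z\<bar>\<close> in the bounds for the tail (right half)
  and for the partial sum (left half).  The function \<open>G\<close> itself is integrated over two segments
  in the left half-plane, where \<open>N ^ z\<close> decays.\<close>

lemma newman_estimate:
  fixes b :: "nat \<Rightarrow> complex" and G :: "complex \<Rightarrow> complex" and C R :: real
  assumes b: "\<And>n. norm (b n) \<le> C"
    and S: "open S" "{z. Re z \<ge> 0} \<subseteq> S" and G: "G holomorphic_on S"
    and sums: "\<And>z. Re z > 0 \<Longrightarrow> (\<lambda>n. b n * of_nat (Suc n) powr (- 1 - z)) sums G z"
    and R: "R > 0"
  obtains K where "\<And>N. N \<ge> 2 \<Longrightarrow>
    norm (G 0 - (\<Sum>n<N. b n * of_nat (Suc n) powr (- 1 - 0))) \<le> 2 * C / R + C / N + K / ln N"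
proof -
  have C: "C \<ge> 0" using b[of 0] norm_ge_zero order_trans by blast
  \<comment> \<open>\<open>S\<close> may narrow towards the imaginary axis at large height.
    Compactness of a segment slightly longer than \<open>2 * R\<close> gives a strip of uniform
    width \<open>e\<close> inside \<open>S\<close>, hence the convex \<open>U\<close> that Cauchy's
    formula requires.\<close>
  have "compact (closed_segment (- \<i> * (R + 1)) (\<i> * (R + 1)))" "closed_segment (- \<i> * (R + 1)) (\<i> * (R + 1)) \<subseteq> S"
    by (auto simp: in_segment intro!: subsetD[OF S(2)])
  then obtain e where e: "e > 0" "(\<Union>x\<in>closed_segment (- \<i> * (R + 1)) (\<i> * (R + 1)). ball x e) \<subseteq> S"
    using compact_subset_open_imp_ball_epsilon_subset[of _ S] S(1) by metis
  define \<delta> where "\<delta> = e / 2"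
  have d: "\<delta> > 0" and de: "\<delta> < e" using e by (simp_all add: \<delta>_def)
  define U where "U = {z. Re z > - e} \<inter> {z. Im z < R + 1} \<inter> {z. Im z > - (R + 1)}"
  have U: "convex U" "open U"
    unfolding U_def by (intro convex_Int convex_halfspace_Re_gt convex_halfspace_Im_lt convex_halfspace_Im_gt
       open_Int open_halfspace_Re_gt open_halfspace_Im_lt open_halfspace_Im_gt)+
  have US: "U \<subseteq> S"
  proof
    fix z assume z: "z \<in> U"
    show "z \<in> S"
    proof (cases "Re z \<ge> 0")
      case True then show ?thesis using S(2) by auto
    next
      case False
      define t where "t = (Im z + R + 1) / (2 * (R + 1))"
      have "0 \<le> t" "t \<le> 1" using z R by (auto simp: U_def t_def)
      moreover have "\<i> * Im z = (1 - t) *\<^sub>R (- \<i> * (R + 1)) + t *\<^sub>R (\<i> * (R + 1))"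
      proof -
        have "t * (2 * (R + 1)) = Im z + R + 1" using R by (simp add: t_def)
        then show ?thesis by (simp add: complex_eq_iff algebra_simps)
      qed
      ultimately have "\<i> * Im z \<in> closed_segment (- \<i> * (R + 1)) (\<i> * (R + 1))"
        by (auto simp: in_segment)
      moreover have "z \<in> ball (\<i> * Im z) e"
        using z False by (auto simp: U_def dist_norm cmod_def)
      ultimately show ?thesis using e(2) by blast
    qed
  qed
  have GU: "G holomorphic_on U" using G US by (rule holomorphic_on_subset)
  let ?A = "part_circlepath 0 R (- pi/2) (pi/2)"
  let ?L = "part_circlepath 0 R (pi/2) (3*pi/2)"
  let ?\<delta> = "- complex_of_real \<delta>"
  let ?w1 = "norm (?\<delta> - \<i> * R)" and ?w2 = "norm (?\<delta> - - (\<i> * R))"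
  let ?V1 = "linepath (\<i> * R) ?\<delta>"
  let ?V2 = "linepath ?\<delta> (- (\<i> * R))"
  define \<Gamma> where "\<Gamma> = ?A +++ (?V1 +++ ?V2)"
  have ends: "pathfinish ?A = \<i> * R"
    by (auto simp: complex_eq_iff Re_exp Im_exp simp flip: cis_conv_exp)
  note wind = newman_contour_winding[OF R d, folded \<Gamma>_def]
  have \<Gamma>U: "path_image \<Gamma> \<subseteq> U - {0}"
    using wind(3) de by (auto simp: U_def)
  note imA = path_image_half_circles(1)[OF R] and imL = path_image_half_circles(2)[OF R]
  have im\<Gamma>: "path_image \<Gamma> = path_image ?A \<union> (path_image ?V1 \<union> path_image ?V2)"
    unfolding \<Gamma>_def using ends by (simp add: path_image_join)
  define k where "k = (\<lambda>z::complex. (1 + z\<^sup>2 / of_real R ^ 2) / z)"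
  have k_norm: "norm (k z) = 2 * \<bar>Re z\<bar> / R\<^sup>2" if "norm z = R" for z
  proof -
    have "z \<noteq> 0" using that R by auto
    have "R\<^sup>2 = (Re z)\<^sup>2 + (Im z)\<^sup>2" using that by (auto simp: cmod_def)
    then have "of_real R ^ 2 + z\<^sup>2 = 2 * Re z * z"
      by (simp add: complex_eq_iff power2_eq_square algebra_simps flip: of_real_power)
    then have "k z = 2 * Re z / of_real R ^ 2"
      using \<open>z \<noteq> 0\<close> R by (simp add: k_def field_simps)
    then show ?thesis by (simp add: norm_divide norm_mult norm_power)
  qed
  have k_cont: "continuous_on T k" if "0 \<notin> T" for T
    unfolding k_def using that R by (intro continuous_intros) auto
  have "compact (path_image ?V1 \<union> path_image ?V2)" by (intro compact_Un compact_path_image) auto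
  moreover have cGV: "continuous_on (path_image ?V1 \<union> path_image ?V2) (\<lambda>z. G z * k z)"
    using \<Gamma>U im\<Gamma> by (intro continuous_intros k_cont continuous_on_subset[OF holomorphic_on_imp_continuous_on[OF GU]]) auto
  ultimately have "bounded ((\<lambda>z. G z * k z) ` (path_image ?V1 \<union> path_image ?V2))"
    by (intro compact_imp_bounded compact_continuous_image)
  then obtain M where M: "M > 0" "\<And>z. z \<in> path_image ?V1 \<union> path_image ?V2 \<Longrightarrow> norm (G z * k z) \<le> M"
    by (auto simp: bounded_pos)
  \<comment> \<open>\<open>M\<close> bounds only \<open>G z * k z\<close>, without the factor
    \<open>E\<close>, so \<open>K\<close> depends on \<open>R\<close> and \<open>\<delta>\<close>
    but not on \<open>N\<close>.\<close>
  define K where "K = (M * ?w1 / \<delta> + M * ?w2 / \<delta>) / (2 * pi)"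
  show ?thesis
  proof (rule that[of K])
    fix N :: nat assume N: "N \<ge> 2"
    define E where "E = (\<lambda>z::complex. exp (of_real (ln N) * z))"
    define P where "P = (\<lambda>z::complex. \<Sum>n<N. b n * of_nat (Suc n) powr (- 1 - z))"
    have normE: "norm (E z) = real N powr Re z" for z
      using N by (simp add: E_def powr_def mult.commute)
    have normt: "norm (b n * of_nat (Suc n) powr (- 1 - z)) \<le> C * real (Suc n) powr (- 1 - Re z)" for n z
      using b[of n] by (simp add: norm_mult norm_powr_real_powr mult_right_mono del: of_nat_Suc)
    have PE: "P holomorphic_on T" "E holomorphic_on T" for T
      unfolding P_def E_def by (auto intro!: holomorphic_intros simp del: of_nat_Suc)
    have I1: "((\<lambda>z. G z * E z * k z) has_contour_integral (2 * pi * \<i> * G 0)) \<Gamma>"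
    proof -
      have "((\<lambda>z. (G z * E z * (1 + z\<^sup>2 / of_real R ^ 2)) / (z - 0)) has_contour_integral
        (2 * pi * \<i> * winding_number \<Gamma> 0 * (G 0 * E 0 * (1 + 0\<^sup>2 / of_real R ^ 2)))) \<Gamma>"
        using \<Gamma>U wind(1,2) R e(1) U
        by (intro Cauchy_integral_formula_convex_simple[where S=U])
           (auto intro!: holomorphic_intros GU PE simp: interior_open, auto simp: U_def)
      then show ?thesis using wind(4) by (simp add: k_def E_def)
    qed
    \<comment> \<open>The partial sum \<open>P\<close> is entire, unlike \<open>G\<close>, and can
      be integrated over the whole circle. On the right half it is subtracted from \<open>G\<close>,
      leaving the tail; its left half is estimated alone.\<close>
    have I2: "((\<lambda>z. P z * E z * k z) has_contour_integral (2 * pi * \<i> * P 0)) (circlepath 0 R)"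
    proof -
      have "((\<lambda>z. (P z * E z * (1 + z\<^sup>2 / of_real R ^ 2)) / (z - 0)) has_contour_integral
        (2 * of_real pi * \<i> * (P 0 * E 0 * (1 + 0\<^sup>2 / of_real R ^ 2)))) (circlepath 0 R)"
        using R by (intro Cauchy_integral_circlepath_simple) (auto intro!: holomorphic_intros PE)
      then show ?thesis by (simp add: k_def E_def)
    qed
    let ?g = "\<lambda>z. G z * E z * k z" and ?p = "\<lambda>z. P z * E z * k z"
    have contg: "continuous_on T ?g" if "T \<subseteq> path_image \<Gamma>" for T
      using \<Gamma>U that by (intro continuous_intros k_cont holomorphic_on_imp_continuous_on PE
         continuous_on_subset[OF holomorphic_on_imp_continuous_on[OF GU]]) auto
    have contp: "continuous_on T ?p" if "0 \<notin> T" for T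
      using that by (intro continuous_intros k_cont holomorphic_on_imp_continuous_on PE) auto
    have gA: "?g contour_integrable_on ?A"
      using contg im\<Gamma> by (intro contour_integrable_continuous_part_circlepath) auto
    have gV1: "?g contour_integrable_on ?V1" and gV2: "?g contour_integrable_on ?V2"
      by (rule contour_integrable_continuous_linepath, subst path_image_linepath[symmetric], rule contg, simp only: im\<Gamma>, blast)+
    have pA: "?p contour_integrable_on ?A" and pL: "?p contour_integrable_on ?L"
      using imA imL R by (intro contour_integrable_continuous_part_circlepath contp; force)+
    have "2 * pi * \<i> * G 0 = contour_integral ?A ?g + (contour_integral ?V1 ?g + contour_integral ?V2 ?g)"
    proof -
      have "?g contour_integrable_on (?V1 +++ ?V2)"
        by (rule contour_integrable_joinI) (use gV1 gV2 in auto)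
      then have "contour_integral \<Gamma> ?g = contour_integral ?A ?g + contour_integral (?V1 +++ ?V2) ?g"
        unfolding \<Gamma>_def by (intro contour_integral_join gA) (auto intro: valid_path_join)
      also have "contour_integral (?V1 +++ ?V2) ?g = contour_integral ?V1 ?g + contour_integral ?V2 ?g"
        by (intro contour_integral_join gV1 gV2) auto
      finally show ?thesis using contour_integral_unique[OF I1] by simp
    qed
    moreover have "2 * pi * \<i> * P 0 = contour_integral ?A ?p + contour_integral ?L ?p"
      using contour_integral_two_half_circles[OF R contp] contour_integral_unique[OF I2] R by auto
    moreover have "contour_integral ?A ?g - contour_integral ?A ?p = contour_integral ?A (\<lambda>z. ?g z - ?p z)"
      using contour_integral_diff[OF gA pA] by simp
    ultimately have eq: "2 * pi * \<i> * (G 0 - P 0) = contour_integral ?A (\<lambda>z. ?g z - ?p z)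
        - contour_integral ?L ?p + (contour_integral ?V1 ?g + contour_integral ?V2 ?g)"
      by (simp add: algebra_simps)
    have bA: "norm (contour_integral ?A (\<lambda>z. ?g z - ?p z)) \<le> (2 * C / R\<^sup>2) * R * (pi/2 - (- pi/2))"
    proof (rule has_contour_integral_bound_part_circlepath)
      show "((\<lambda>z. ?g z - ?p z) has_contour_integral contour_integral ?A (\<lambda>z. ?g z - ?p z)) ?A"
        using gA pA by (intro has_contour_integral_integral contour_integrable_diff)
      fix z assume "z \<in> path_image ?A"
      then have z: "Re z \<ge> 0" "norm z = R" using imA by auto
      show "norm (?g z - ?p z) \<le> 2 * C / R\<^sup>2"
      proof (cases "Re z = 0")
        case True
        then have "k z = 0" using k_norm[OF z(2)] by simp
        then show ?thesis using C by simp
      next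
        case False
        then have x: "Re z > 0" using z by simp
        have N1: "N \<ge> 1" using N by simp
        have sm: "summable (\<lambda>k. C * real (Suc (k + N)) powr (- 1 - Re z))"
          by (intro summable_mult tail_powr_le(1) x N1)
        have "(\<lambda>n. b (n + N) * of_nat (Suc (n + N)) powr (- 1 - z)) sums (G z - P z)"
          using sums_iff_shift[of "\<lambda>n. b n * of_nat (Suc n) powr (- 1 - z)" N "G z - P z"] sums[OF x]
          by (simp add: P_def)
        then have "G z - P z = (\<Sum>n. b (n + N) * of_nat (Suc (n + N)) powr (- 1 - z))"
          by (rule sums_unique)
        also have "norm \<dots> \<le> (\<Sum>k. C * real (Suc (k + N)) powr (- 1 - Re z))"
          by (rule norm_suminf_le[OF normt sm])
        finally have "norm (G z - P z) \<le> (\<Sum>k. C * real (Suc (k + N)) powr (- 1 - Re z))" .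
        also have "\<dots> = C * (\<Sum>k. real (Suc (k + N)) powr (- 1 - Re z))"
          by (intro suminf_mult tail_powr_le(1) x N1)
        also have "\<dots> \<le> C * (real N powr (- Re z) / Re z)"
          by (intro mult_left_mono tail_powr_le(2) x N1 C)
        finally have "norm (G z - P z) \<le> C * (real N powr (- Re z) / Re z)" .
        then have "norm ((G z - P z) * E z * k z) \<le> C * (real N powr (- Re z) / Re z) * real N powr Re z * (2 * \<bar>Re z\<bar> / R\<^sup>2)"
          unfolding norm_mult normE k_norm[OF z(2)] by (intro mult_right_mono) auto
        also have "\<dots> = 2 * C / R\<^sup>2" using x N by (simp add: powr_minus field_simps)
        finally show ?thesis by (simp add: algebra_simps)
      qed
    qed (use R C in auto)
    have bL: "norm (contour_integral ?L ?p) \<le> (2 * C / R\<^sup>2 + 2 * C / (N * R)) * R * (3*pi/2 - pi/2)"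
    proof (rule has_contour_integral_bound_part_circlepath)
      show "(?p has_contour_integral contour_integral ?L ?p) ?L"
        using pL by (intro has_contour_integral_integral)
      fix z assume "z \<in> path_image ?L"
      then have z: "Re z \<le> 0" "norm z = R" using imL by auto
      show "norm (?p z) \<le> 2 * C / R\<^sup>2 + 2 * C / (N * R)"
      proof (cases "Re z = 0")
        case True
        then have "k z = 0" using k_norm[OF z(2)] by simp
        then show ?thesis using C R by simp
      next
        case False
        define x where "x = - Re z"
        have x: "x > 0" using z False by (simp add: x_def)
        have eq: "- 1 - Re z = x - 1" by (simp add: x_def)
        have N1: "N \<ge> 1" using N by simp
        have "norm (P z) \<le> (\<Sum>n<N. C * real (Suc n) powr (- 1 - Re z))"
          unfolding P_def by (intro sum_norm_le normt)
        also have "\<dots> = C * (\<Sum>n<N. real (Suc n) powr (x - 1))"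
          unfolding eq by (simp only: sum_distrib_left)
        also have "\<dots> \<le> C * (real N powr x / x + real N powr (x - 1))"
          by (intro mult_left_mono sum_powr_le x N1 C)
        finally have "norm (P z) \<le> C * (real N powr x / x + real N powr (x - 1))" .
        then have "norm (P z) * real N powr (- x) * (2 * x / R\<^sup>2) \<le>
            C * (real N powr x / x + real N powr (x - 1)) * real N powr (- x) * (2 * x / R\<^sup>2)"
          using x by (intro mult_right_mono) auto
        moreover have "Re z = - x" "\<bar>x\<bar> = x" using x by (auto simp: x_def)
        ultimately have "norm (?p z) \<le> C * (real N powr x / x + real N powr (x - 1)) * real N powr (- x) * (2 * x / R\<^sup>2)"
          by (simp only: norm_mult normE k_norm[OF z(2)] abs_minus_cancel)
        also have "\<dots> = 2 * C / R\<^sup>2 + 2 * C / N * (x / R\<^sup>2)"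
          using x N R by (simp add: powr_minus powr_diff field_simps)
        also have "\<dots> \<le> 2 * C / R\<^sup>2 + 2 * C / N * (R / R\<^sup>2)"
          using C z abs_Re_le_cmod[of z] by (intro add_left_mono mult_left_mono divide_right_mono) (auto simp: x_def)
        finally show ?thesis using R by (simp add: power2_eq_square)
      qed
    qed (use R C in auto)
    have lnN: "ln N > 0" using N by simp
    have bound: "norm (?g z) \<le> M * exp (ln N * Re z)" if "z \<in> path_image ?V1 \<union> path_image ?V2" for z
    proof -
      have "norm (?g z) = norm (G z * k z) * exp (ln N * Re z)" by (simp add: E_def norm_mult)
      then show ?thesis using M(2)[OF that] by (simp add: mult_right_mono)
    qed
    have bV1: "norm (contour_integral ?V1 ?g) \<le> M * ?w1 / (- Re ?\<delta> * ln N)"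
      using d lnN M bound by (intro norm_contour_integral_linepath_exp_le contg) (auto simp: im\<Gamma>)
    have "norm (contour_integral (linepath (- (\<i> * R)) ?\<delta>) ?g) \<le> M * ?w2 / (- Re ?\<delta> * ln N)"
      using d lnN M bound by (intro norm_contour_integral_linepath_exp_le contg) (auto simp: im\<Gamma> closed_segment_commute)
    then have bV2: "norm (contour_integral ?V2 ?g) \<le> M * ?w2 / (- Re ?\<delta> * ln N)"
      by (metis contour_integral_reversepath norm_minus_cancel reversepath_linepath valid_path_linepath)
    have "2 * pi * norm (G 0 - P 0) = norm (2 * pi * \<i> * (G 0 - P 0))" by (simp add: norm_mult)
    also have "\<dots> \<le> norm (contour_integral ?A (\<lambda>z. ?g z - ?p z)) + norm (contour_integral ?L ?p)
        + (norm (contour_integral ?V1 ?g) + norm (contour_integral ?V2 ?g))"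
      unfolding eq by (intro norm_triangle_mono norm_triangle_ineq4 norm_triangle_ineq)
    also have "\<dots> \<le> (2 * C / R\<^sup>2) * R * (pi/2 - (- pi/2)) + (2 * C / R\<^sup>2 + 2 * C / (N * R)) * R * (3*pi/2 - pi/2)
       + (M * ?w1 / (- Re ?\<delta> * ln N) +
          M * ?w2 / (- Re ?\<delta> * ln N))"
      by (intro add_mono bA bL bV1 bV2)
    also have "\<dots> = 2 * pi * (2 * C / R + C / N + K / ln N)"
      using R d lnN N by (simp add: K_def field_simps power2_eq_square)
    finally have "norm (G 0 - P 0) \<le> 2 * C / R + C / N + K / ln N"
      using pi_gt_zero by (subst (asm) mult_le_cancel_left_pos) auto
    then show "norm (G 0 - (\<Sum>n<N. b n * of_nat (Suc n) powr (- 1 - 0))) \<le> 2 * C / R + C / N + K / ln N"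
      by (simp add: P_def)
  qed
qed

text \<open>In \<open>newman_estimate\<close> only \<open>2 * C / R\<close> survives as
  \<open>N\<close> grows, and \<open>R\<close> is arbitrary: it is fixed first, large in terms of
  the required accuracy.\<close>

theorem newman_tauberian:
  fixes b :: "nat \<Rightarrow> complex" and G :: "complex \<Rightarrow> complex" and C :: real
  assumes b: "\<And>n. norm (b n) \<le> C"
    and S: "open S" "{z. Re z \<ge> 0} \<subseteq> S" and G: "G holomorphic_on S"
    and sums: "\<And>z. Re z > 0 \<Longrightarrow> (\<lambda>n. b n * of_nat (Suc n) powr (- 1 - z)) sums G z"
  shows "(\<lambda>n. b n / of_nat (Suc n)) sums G 0"
proof -
  have C: "C \<ge> 0" using b[of 0] norm_ge_zero order_trans by blast
  have "(\<lambda>N. \<Sum>n<N. b n * of_nat (Suc n) powr (- 1 - 0)) \<longlonglongrightarrow> G 0"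
  proof (rule LIMSEQ_I)
    fix r :: real assume r: "r > 0"
    define R where "R = 4 * (C + 1) / r"
    have R: "R > 0" using C r by (simp add: R_def)
    obtain K where K: "\<And>N. N \<ge> 2 \<Longrightarrow>
      norm (G 0 - (\<Sum>n<N. b n * of_nat (Suc n) powr (- 1 - 0))) \<le> 2 * C / R + C / N + K / ln N"
      using newman_estimate[OF b S G sums R] by blast
    have "2 * C / R < r" using C r by (simp add: R_def field_simps add_pos_nonneg)
    moreover have "(\<lambda>N. 2 * C / R + C / real N + K / ln (real N)) \<longlonglongrightarrow> 2 * C / R" by real_asymp
    ultimately have "eventually (\<lambda>N. 2 * C / R + C / real N + K / ln (real N) < r) sequentially"
      by (rule order_tendstoD(2)[rotated])
    then obtain N0 where N0: "\<And>N. N \<ge> N0 \<Longrightarrow> 2 * C / R + C / real N + K / ln (real N) < r"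
      by (auto simp: eventually_sequentially)
    show "\<exists>no. \<forall>n\<ge>no. norm ((\<Sum>n<n. b n * of_nat (Suc n) powr (- 1 - 0)) - G 0) < r"
    proof (intro exI[of _ "max 2 N0"] allI impI)
      fix n assume "max 2 N0 \<le> n"
      then show "norm ((\<Sum>n<n. b n * of_nat (Suc n) powr (- 1 - 0)) - G 0) < r"
        using K[of n] N0[of n] by (simp add: norm_minus_commute)
    qed
  qed
  moreover have "b n * of_nat (Suc n) powr (- 1 - 0) = b n / of_nat (Suc n)" for n
    by (simp add: powr_minus field_simps del: of_nat_Suc)
  ultimately show ?thesis by (simp add: sums_def)
qed

subsection \<open>The zeta function on the line \<open>Re s = 1\<close>\<close>

definition dirichlet_series :: "(nat \<Rightarrow> complex) \<Rightarrow> complex \<Rightarrow> complex" where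
  "dirichlet_series a s = (\<Sum>n. a n * of_nat (Suc n) powr (- s))"

lemma norm_nat_powr: "norm (of_nat (Suc n) powr s :: complex) = real (Suc n) powr Re s"
  by (simp add: norm_powr_real_powr del: of_nat_Suc)

lemma summable_ln_powr:
  assumes "x > 1"
  shows "summable (\<lambda>n. (1 + ln (real (Suc n))) ^ 2 * real (Suc n) powr (- x))"
proof (rule summable_comparison_test_bigo)
  show "summable (\<lambda>n. norm (real n powr (- (1 + x) / 2)))"
    using assms by (simp add: summable_real_powr_iff)
  define y where "y = (x - 1) / 2"
  have y: "y > 0" and x: "x = 2 * y + 1" using assms by (simp_all add: y_def field_simps)
  show "(\<lambda>n. (1 + ln (real (Suc n))) ^ 2 * real (Suc n) powr (- x)) \<in> O(\<lambda>n. real n powr (- (1 + x) / 2))"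
    unfolding x using y by real_asymp
qed

lemma
  fixes a :: "nat \<Rightarrow> complex"
  assumes a: "\<And>n. norm (a n) \<le> 1 + ln (Suc n)" and s: "Re s > 1"
  shows dirichlet_series_abs: "summable (\<lambda>n. norm (a n * of_nat (Suc n) powr (- s)))"
    and dirichlet_series_sums: "(\<lambda>n. a n * of_nat (Suc n) powr (- s)) sums dirichlet_series a s"
    and dirichlet_series_deriv: "(dirichlet_series a has_field_derivative
       dirichlet_series (\<lambda>n. - of_real (ln (Suc n)) * a n) s) (at s)"
proof -
  let ?S = "{s. Re s > 1}"
  have ln0: "ln (real (Suc n)) \<ge> 0" for n by simp
  have bnd: "norm (a n * of_nat (Suc n) powr (- y)) \<le> (1 + ln (Suc n)) ^ 2 * real (Suc n) powr (- x)"
    if "Re y \<ge> x" for n y x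
  proof -
    have "norm (a n) \<le> (1 + ln (Suc n)) ^ 2"
      using a[of n] ln0[of n] by (smt (verit) power2_eq_square mult_le_cancel_left1)
    moreover have "real (Suc n) powr (- Re y) \<le> real (Suc n) powr (- x)"
      using that by (intro powr_mono) auto
    ultimately show ?thesis unfolding norm_mult norm_nat_powr by (intro mult_mono) auto
  qed
  show ab: "summable (\<lambda>n. norm (a n * of_nat (Suc n) powr (- s)))"
    by (rule summable_comparison_test'[OF summable_ln_powr[OF s], of 0]) (use bnd[of "Re s" s] in simp)
  then have "summable (\<lambda>n. a n * of_nat (Suc n) powr (- s))" by (rule summable_norm_cancel)
  then show "(\<lambda>n. a n * of_nat (Suc n) powr (- s)) sums dirichlet_series a s"
    unfolding dirichlet_series_def by (rule summable_sums)
  have "\<exists>g g'. \<forall>x\<in>?S. ((\<lambda>n. a n * of_nat (Suc n) powr (- x)) sums g x) \<and>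
     ((\<lambda>n. - of_real (ln (Suc n)) * a n * of_nat (Suc n) powr (- x)) sums g' x) \<and> (g has_field_derivative g' x) (at x)"
  proof (rule series_and_derivative_comparison_local)
    show "open ?S" by (rule open_halfspace_Re_gt)
    fix n x
    show "((\<lambda>x. a n * of_nat (Suc n) powr (- x)) has_field_derivative
       - of_real (ln (Suc n)) * a n * of_nat (Suc n) powr (- x)) (at x)"
    proof -
      have eq: "of_nat (Suc n) powr (- x) = exp (- x * of_real (ln (Suc n)))" for x :: complex
        by (simp add: powr_def del: of_nat_Suc)
      show ?thesis unfolding eq by (auto intro!: derivative_eq_intros)
    qed
  next
    fix x assume "x \<in> ?S"
    then have x: "Re x > 1" by simp
    define d where "d = (Re x - 1) / 2"
    have d: "d > 0" using x by (simp add: d_def)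
    have "1 + d \<le> Re y" if "y \<in> ball x d" for y
      using that abs_Re_le_cmod[of "x - y"] by (auto simp: dist_norm d_def field_simps)
    then have "\<forall>n. \<forall>y\<in>ball x d \<inter> ?S. norm (a n * of_nat (Suc n) powr (- y)) \<le> (1 + ln (Suc n)) ^ 2 * real (Suc n) powr (- (1 + d))"
      using bnd by blast
    then show "\<exists>d h. 0 < d \<and> summable h \<and> (\<forall>\<^sub>F n in sequentially. \<forall>y\<in>ball x d \<inter> ?S. norm (a n * of_nat (Suc n) powr (- y)) \<le> h n)"
      using d summable_ln_powr[of "1 + d"] by (intro exI conjI always_eventually) auto
  qed
  then obtain g g' where g: "\<And>x. Re x > 1 \<Longrightarrow> (\<lambda>n. a n * of_nat (Suc n) powr (- x)) sums g x"
     "\<And>x. Re x > 1 \<Longrightarrow> (\<lambda>n. - of_real (ln (Suc n)) * a n * of_nat (Suc n) powr (- x)) sums g' x"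
     "\<And>x. Re x > 1 \<Longrightarrow> (g has_field_derivative g' x) (at x)"
    by blast
  have "g x = dirichlet_series a x" if "Re x > 1" for x
    unfolding dirichlet_series_def using g(1)[OF that] by (rule sums_unique)
  then have "(dirichlet_series a has_field_derivative g' s) (at s)"
    using g(3)[OF s] s by (subst has_field_derivative_cong_ev[where g=g])
      (auto intro!: eventually_mono[OF eventually_nhds_in_open[OF open_halfspace_Re_gt[of 1]]])
  moreover have "g' s = dirichlet_series (\<lambda>n. - of_real (ln (Suc n)) * a n) s"
    unfolding dirichlet_series_def using g(2)[OF s] by (rule sums_unique)
  ultimately show "(dirichlet_series a has_field_derivative
       dirichlet_series (\<lambda>n. - of_real (ln (Suc n)) * a n) s) (at s)" by simp
qed

abbreviation zeta_series :: "complex \<Rightarrow> complex" where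
  "zeta_series \<equiv> dirichlet_series (\<lambda>_. 1)"

abbreviation mangoldt_series :: "complex \<Rightarrow> complex" where
  "mangoldt_series \<equiv> dirichlet_series (\<lambda>n. mangoldt (Suc n))"

lemma norm_mangoldt_le: "norm (mangoldt (Suc n) :: complex) \<le> 1 + ln (Suc n)"
  using mangoldt_le[of "Suc n"] by simp

text \<open>The convolution identity \<open>\<Lambda> * 1 = ln\<close>: the double series converges
  absolutely, so the pairs \<open>(d, m)\<close> may be regrouped by their product
  \<open>n = d * m\<close>. Unordered sums over the positive integers make the regrouping a
  bijection of index sets.\<close>

lemma zeta_mangoldt_eq:
  assumes s: "Re s > 1"
  shows "mangoldt_series s * zeta_series s = dirichlet_series (\<lambda>n. of_real (ln (Suc n))) s"
proof -
  let ?A = "{0<..} :: nat set"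
  define f where "f = (\<lambda>d. mangoldt d * of_nat d powr (- s) :: complex)"
  define g where "g = (\<lambda>m. of_nat m powr (- s) :: complex)"
  have bij: "bij_betw Suc UNIV ?A" by (rule bij_betwI[of _ _ _ "\<lambda>x. x - 1"]) auto
  have toA: "(\<lambda>n. norm (a (Suc n))) summable_on UNIV \<Longrightarrow> (\<lambda>n. norm (a n)) summable_on ?A" for a :: "nat \<Rightarrow> complex"
    using summable_on_reindex_bij_betw[OF bij, of "\<lambda>n. norm (a n)"] by simp
  have toS: "((\<lambda>n. a (Suc n)) has_sum L) UNIV \<longleftrightarrow> (a has_sum L) ?A" for a :: "nat \<Rightarrow> complex" and L
    using has_sum_reindex_bij_betw[OF bij] by blast
  have f: "(\<lambda>n. norm (f n)) summable_on ?A" and fs: "(f has_sum mangoldt_series s) ?A"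
    using dirichlet_series_abs[OF norm_mangoldt_le s] dirichlet_series_sums[OF norm_mangoldt_le s]
    unfolding f_def
    by (intro toA norm_summable_imp_summable_on toS[THEN iffD1] norm_summable_imp_has_sum; simp del: of_nat_Suc)+
  have g: "(\<lambda>n. norm (g n)) summable_on ?A" and gs: "(g has_sum zeta_series s) ?A"
    using dirichlet_series_abs[of "\<lambda>_. 1", OF _ s] dirichlet_series_sums[of "\<lambda>_. 1", OF _ s]
    unfolding g_def
    by (intro toA norm_summable_imp_summable_on toS[THEN iffD1] norm_summable_imp_has_sum; simp del: of_nat_Suc)+
  have abs: "(\<lambda>x. norm ((\<lambda>(d,m). f d * g m) x)) summable_on ?A \<times> ?A"
    using f g by (subst Infinite_Sum.abs_summable_on_Sigma_iff) (auto intro!: summable_on_cmult_right summable_on_cmult_left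
       simp: norm_mult infsum_cmult_right' abs_mult)
  have prod: "((\<lambda>(d,m). f d * g m) has_sum (mangoldt_series s * zeta_series s)) (?A \<times> ?A)"
  proof (rule has_sum_SigmaI)
    show "((\<lambda>y. case (x, y) of (d, m) \<Rightarrow> f d * g m) has_sum (f x * zeta_series s)) ?A" for x
      using has_sum_cmult_right[OF gs, of "f x"] by simp
    show "((\<lambda>x. f x * zeta_series s) has_sum (mangoldt_series s * zeta_series s)) ?A"
      using has_sum_cmult_left[OF fs] by simp
    show "(\<lambda>(d, m). f d * g m) summable_on ?A \<times> ?A"
      using abs by (rule Infinite_Sum.abs_summable_summable)
  qed
  have "((\<lambda>(n,d). f d * g (n div d)) has_sum (mangoldt_series s * zeta_series s)) (Sigma ?A (\<lambda>n. {d. d dvd n}))"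
    using prod
    by (subst has_sum_reindex_bij_witness[where i = "\<lambda>(d,m). (d * m, d)" and j = "\<lambda>(n,d). (d, n div d)" and T = "?A \<times> ?A"
        and h = "\<lambda>(d,m). f d * g m" and s' = "mangoldt_series s * zeta_series s"])
       (auto simp: dvd_div_eq_0_iff intro!: Nat.gr0I dest: dvd_imp_le)
  then have "((\<lambda>n. \<Sum>d | d dvd n. f d * g (n div d)) has_sum (mangoldt_series s * zeta_series s)) ?A"
    by (rule has_sum_SigmaD) (auto intro!: has_sum_finiteI)
  also have "?this \<longleftrightarrow> ((\<lambda>n. of_real (ln n) * of_nat n powr (- s)) has_sum (mangoldt_series s * zeta_series s)) ?A"
  proof (rule has_sum_cong)
    fix n assume n: "n \<in> ?A"
    have "f d * g (n div d) = mangoldt d * of_nat n powr (- s)" if "d dvd n" for d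
    proof -
      have "of_nat n = (of_nat d * of_nat (n div d) :: complex)" using that by (metis dvd_mult_div_cancel of_nat_mult)
      then show ?thesis by (simp add: f_def g_def powr_times_real)
    qed
    then have "(\<Sum>d | d dvd n. f d * g (n div d)) = (\<Sum>d | d dvd n. mangoldt d) * of_nat n powr (- s)"
      by (simp add: sum_distrib_right)
    then show "(\<Sum>d | d dvd n. f d * g (n div d)) = of_real (ln n) * of_nat n powr (- s)"
      using mangoldt_sum[of n, where ?'a = complex] n by simp
  qed
  finally have "(\<lambda>n. of_real (ln (Suc n)) * of_nat (Suc n) powr (- s)) sums (mangoldt_series s * zeta_series s)"
    using toS[of "\<lambda>n. of_real (ln n) * of_nat n powr (- s)"] by (intro has_sum_imp_sums) blast
  then show ?thesis unfolding dirichlet_series_def[of "\<lambda>n. of_real (ln (Suc n))"] by (rule sums_unique)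
qed

text \<open>A linear differential equation for zeta. It replaces the Euler product in the proof that
  zeta has no zeros for Re s > 1.\<close>

lemma zeta_series_deriv:
  assumes s: "Re s > 1"
  shows "(zeta_series has_field_derivative - (mangoldt_series s * zeta_series s)) (at s)"
proof -
  have "dirichlet_series (\<lambda>n. - of_real (ln (Suc n)) * 1) s = - dirichlet_series (\<lambda>n. of_real (ln (Suc n))) s"
  proof -
    have "(\<lambda>n. of_real (ln (Suc n)) * of_nat (Suc n) powr (- s)) sums dirichlet_series (\<lambda>n. of_real (ln (Suc n))) s"
      by (rule dirichlet_series_sums[OF _ s]) simp
    from sums_minus[OF this] show ?thesis by (simp add: dirichlet_series_def sums_iff)
  qed
  then show ?thesis using dirichlet_series_deriv[of "\<lambda>_. 1", OF _ s] zeta_mangoldt_eq[OF s] by simp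
qed


section \<open>Continuation to the half-plane Re s > 0\<close>

text \<open>Taylor's formula on the real segment from \<open>n + 1\<close> to \<open>n + 2\<close>,
  with \<open>norm (w * (w - 1)) \<le> (1 + norm w)^2\<close>. The condition on \<open>Re w\<close>
  makes the second derivative largest at the left end. It is used with \<open>w = 1 - s\<close> to
  continue zeta and with \<open>w = - s\<close> to linearize the series of
  \<open>psi\<close>.\<close>

lemma powr_taylor:
  fixes w :: complex
  assumes w: "Re w \<le> 2"
  shows "norm (of_nat (Suc (Suc n)) powr w - of_nat (Suc n) powr w - w * of_nat (Suc n) powr (w - 1))
     \<le> (1 + norm w) ^ 2 * real (Suc n) powr (Re w - 2)"
proof -
  define x where "x = real (Suc n)"
  have x: "x > 0" by (simp add: x_def)
  define S :: "complex set" where "S = of_real ` {x..x+1}"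
  define f where "f = (\<lambda>i::nat. if i = 0 then (\<lambda>z. z powr w) else if i = 1 then (\<lambda>z. w * z powr (w - 1))
      else (\<lambda>z. w * (w - 1) * z powr (w - 2)))"
  have "norm (f 0 (of_real (x + 1)) - (\<Sum>i\<le>1. f i (of_real x) * (of_real (x + 1) - of_real x) ^ i / fact i))
     \<le> (norm (w * (w - 1)) * x powr (Re w - 2)) * norm (of_real (x + 1) - of_real x :: complex) ^ Suc 1 / fact 1"
  proof (rule complex_Taylor)
    show "convex S" unfolding S_def by (intro convex_linear_image linear_of_real convex_real_interval)
    show "of_real x \<in> S" "of_real (x + 1) \<in> S" by (auto simp: S_def simp del: of_real_add)
    fix i z assume z: "z \<in> S" and i: "i \<le> (1 :: nat)"
    have "z \<notin> \<real>\<^sub>\<le>\<^sub>0" using z x by (auto simp: S_def)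
    then show "(f i has_field_derivative f (Suc i) z) (at z within S)"
      using i by (cases "i = 0") (auto simp: f_def intro!: derivative_eq_intros has_field_derivative_powr)
  next
    fix z assume "z \<in> S"
    then obtain t where t: "z = of_real t" "x \<le> t" by (auto simp: S_def)
    have "norm (z powr (w - 2)) = t powr (Re w - 2)"
      using t x by (simp add: norm_powr_real_powr)
    also have "\<dots> \<le> x powr (Re w - 2)" using t x w by (intro powr_mono2') auto
    finally show "norm (f (Suc 1) z) \<le> norm (w * (w - 1)) * x powr (Re w - 2)"
      by (simp add: f_def norm_mult mult_left_mono)
  qed
  also have "\<dots> \<le> ((1 + norm w) ^ 2 * x powr (Re w - 2)) * norm (of_real (x + 1) - of_real x :: complex) ^ Suc 1 / fact 1"
    unfolding power2_eq_square norm_mult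
    by (intro divide_right_mono mult_right_mono mult_mono) (use norm_triangle_ineq4[of w 1] in auto)
  finally show ?thesis by (simp add: f_def x_def algebra_simps)
qed

text \<open>On the disc of radius \<open>Re x / 2\<close> around \<open>x\<close> the hypothesis
  gives one summable majorant. Its shape is what \<open>powr_taylor\<close> provides in both
  applications.\<close>

lemma holomorphic_series_Re_pos:
  fixes f :: "nat \<Rightarrow> complex \<Rightarrow> complex"
  assumes hol: "\<And>n. f n holomorphic_on {s. Re s > 0}"
    and le: "\<And>n s. Re s > 0 \<Longrightarrow> norm (f n s) \<le> K * (1 + norm s) ^ 2 * real (Suc n) powr (- Re s - 1)"
  shows "(\<lambda>s. \<Sum>n. f n s) holomorphic_on {s. Re s > 0}"
    and "Re s > 0 \<Longrightarrow> (\<lambda>n. f n s) sums (\<Sum>n. f n s)"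
proof -
  let ?S = "{s. Re s > 0}"
  have K: "K \<ge> 0" using order_trans[OF norm_ge_zero le[of 1 0]] by simp
  have "\<exists>g g'. \<forall>x\<in>?S. ((\<lambda>n. f n x) sums g x) \<and> ((\<lambda>n. deriv (f n) x) sums g' x) \<and> (g has_field_derivative g' x) (at x)"
  proof (rule series_and_derivative_comparison_local)
    show S: "open ?S" by (rule open_halfspace_Re_gt)
    show "(f n has_field_derivative deriv (f n) x) (at x)" if "x \<in> ?S" for n x
      using hol S that by (rule holomorphic_derivI)
  next
    fix x assume "x \<in> ?S"
    define d where "d = Re x / 2"
    have d: "d > 0" using \<open>x \<in> ?S\<close> by (simp add: d_def)
    define h where "h = (\<lambda>n. K * (1 + norm x + d) ^ 2 * real (Suc n) powr (- d - 1))"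
    have "norm (f n y) \<le> h n" if "y \<in> ball x d \<inter> ?S" for n y
    proof -
      have "norm y \<le> norm x + d" using that norm_triangle_ineq2[of y x] by (auto simp: dist_norm norm_minus_commute)
      moreover have "d \<le> Re y" using that abs_Re_le_cmod[of "x - y"] by (auto simp: dist_norm d_def)
      ultimately have "K * (1 + norm y) ^ 2 * real (Suc n) powr (- Re y - 1) \<le> h n"
        unfolding h_def using K d by (intro mult_mono power_mono powr_mono) auto
      then show ?thesis using le[of y n] that by simp
    qed
    moreover have "summable h" unfolding h_def
    proof (intro summable_mult)
      have "summable (\<lambda>n. real n powr (- d - 1))" using d by (simp add: summable_real_powr_iff)
      then show "summable (\<lambda>n. real (Suc n) powr (- d - 1))" by (subst summable_Suc_iff)
    qed
    ultimately show "\<exists>d h. 0 < d \<and> summable h \<and> (\<forall>\<^sub>F n in sequentially. \<forall>y\<in>ball x d \<inter> ?S. norm (f n y) \<le> h n)"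
      using d by (intro exI[of _ d] exI[of _ h]) auto
  qed
  then obtain g g' where g: "\<And>x. Re x > 0 \<Longrightarrow> (\<lambda>n. f n x) sums g x"
    "\<And>x. Re x > 0 \<Longrightarrow> (g has_field_derivative g' x) (at x)" by blast
  have eq: "g x = (\<Sum>n. f n x)" if "Re x > 0" for x using g(1)[OF that] by (rule sums_unique)
  have "g holomorphic_on ?S"
  proof (rule holomorphic_onI)
    fix x assume "x \<in> ?S"
    then show "g field_differentiable at x within ?S"
      using g(2)[of x] unfolding field_differentiable_def by (auto intro: has_field_derivative_at_within)
  qed
  then show "(\<lambda>s. \<Sum>n. f n s) holomorphic_on {s. Re s > 0}"
    by (rule holomorphic_transform) (use eq in auto)
  show "Re s > 0 \<Longrightarrow> (\<lambda>n. f n s) sums (\<Sum>n. f n s)" using g(1) eq by metis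
qed

text \<open>This is \<open>(s - 1) \<zeta>(s)\<close>, continued to the half-plane \<open>Re s > 0\<close> by comparing
  each term \<open>n powr (- s)\<close> with \<open>\<integral> x powr (- s) dx\<close> over \<open>[n, n + 1]\<close>.\<close>

definition zeta_regular :: "complex \<Rightarrow> complex" where
  "zeta_regular s = 1 + (\<Sum>n. (s - 1) * of_nat (Suc n) powr (- s)
      - of_nat (Suc n) powr (1 - s) + of_nat (Suc (Suc n)) powr (1 - s))"

text \<open>For Re s > 1 the differences telescope to -1, which the leading 1 compensates. At
  \<open>s = 1\<close> every summand vanishes, so the value there is 1, the residue of zeta.\<close>

lemma
  shows zeta_regular_holomorphic: "zeta_regular holomorphic_on {s. Re s > 0}"
    and zeta_regular_eq: "Re s > 1 \<Longrightarrow> zeta_regular s = (s - 1) * zeta_series s"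
    and zeta_regular_1: "zeta_regular 1 = 1"
proof -
  let ?f = "\<lambda>n s. (s - 1) * of_nat (Suc n) powr (- s)
      - of_nat (Suc n) powr (1 - s) + of_nat (Suc (Suc n)) powr (1 - s) :: complex"
  have hol: "?f n holomorphic_on {s. Re s > 0}" for n
    by (auto intro!: holomorphic_intros simp del: of_nat_Suc)
  have le: "norm (?f n s) \<le> 4 * (1 + norm s) ^ 2 * real (Suc n) powr (- Re s - 1)" if "Re s > 0" for n s
  proof -
    have "norm (1 - s) \<le> 1 + norm s" using norm_triangle_ineq4[of 1 s] by simp
    then have "(1 + norm (1 - s)) ^ 2 \<le> (2 * (1 + norm s)) ^ 2"
      using norm_ge_zero[of s] norm_ge_zero[of "1 - s"] by (intro power_mono) (simp_all del: norm_ge_zero)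
    then have a: "(1 + norm (1 - s)) ^ 2 \<le> 4 * (1 + norm s) ^ 2" unfolding power_mult_distrib by simp
    have eq: "?f n s = of_nat (Suc (Suc n)) powr (1 - s) - of_nat (Suc n) powr (1 - s) - (1 - s) * of_nat (Suc n) powr (1 - s - 1)"
      by (simp add: algebra_simps del: of_nat_Suc)
    have re: "- Re s - 1 = Re (1 - s) - 2" by simp
    show ?thesis unfolding eq re
      by (rule order_trans[OF powr_taylor mult_right_mono[OF a]]) (use that in auto)
  qed
  show "zeta_regular holomorphic_on {s. Re s > 0}"
    unfolding zeta_regular_def[abs_def] by (intro holomorphic_intros holomorphic_series_Re_pos(1)[OF hol le])
  show "zeta_regular 1 = 1" by (simp add: zeta_regular_def del: of_nat_Suc)
  assume s: "Re s > 1"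
  have "(\<lambda>n. (s - 1) * of_nat (Suc n) powr (- s)) sums ((s - 1) * zeta_series s)"
    using sums_mult[OF dirichlet_series_sums[of "\<lambda>_. 1", OF _ s], of "s - 1"] by simp
  moreover have "(\<lambda>n. of_nat (Suc (Suc n)) powr (1 - s) - of_nat (Suc n) powr (1 - s)) sums (0 - of_nat (Suc 0) powr (1 - s))"
  proof (rule telescope_sums)
    have "(\<lambda>n. norm (of_nat (Suc n) powr (1 - s) :: complex)) \<longlonglongrightarrow> 0"
      unfolding norm_nat_powr using s by (simp, real_asymp)
    then show "(\<lambda>n. of_nat (Suc n) powr (1 - s) :: complex) \<longlonglongrightarrow> 0" by (rule tendsto_norm_zero_cancel)
  qed
  ultimately have "(\<lambda>n. (s - 1) * of_nat (Suc n) powr (- s) + (of_nat (Suc (Suc n)) powr (1 - s) - of_nat (Suc n) powr (1 - s)))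
     sums ((s - 1) * zeta_series s + (0 - of_nat (Suc 0) powr (1 - s)))"
    by (rule sums_add)
  moreover have "of_nat (Suc 0) powr (1 - s) = (1 :: complex)" by simp
  ultimately have "(\<lambda>n. ?f n s) sums ((s - 1) * zeta_series s - 1)"
    by (simp add: algebra_simps del: of_nat_Suc)
  then show "zeta_regular s = (s - 1) * zeta_series s"
    unfolding zeta_regular_def by (simp only: sums_unique[symmetric]) simp
qed


section \<open>Absence of zeros for Re s at least 1\<close>

lemma mangoldt_series_holomorphic: "mangoldt_series holomorphic_on {s. Re s > 1}"
proof (rule holomorphic_onI)
  fix x assume "x \<in> {s. Re s > 1}"
  then show "mangoldt_series field_differentiable at x within {s. Re s > 1}"
    using dirichlet_series_deriv[OF norm_mangoldt_le, of x] unfolding field_differentiable_def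
    by (auto intro: has_field_derivative_at_within)
qed

lemma zeta_regular_tendsto_1: "(zeta_regular \<longlongrightarrow> 1) (at 1)"
proof -
  have "isCont zeta_regular 1"
    using zeta_regular_holomorphic by (intro continuous_on_interior[OF holomorphic_on_imp_continuous_on])
       (auto simp: interior_open open_halfspace_Re_gt)
  then show ?thesis by (simp add: isCont_def zeta_regular_1)
qed

text \<open>A solution of \<open>f' = - F f\<close> on a convex domain vanishes everywhere or nowhere.\<close>

lemma zeta_regular_nonzero_Re_gt_1:
  assumes s: "Re s > 1"
  shows "zeta_regular s \<noteq> 0"
proof
  assume 0: "zeta_regular s = 0"
  let ?S = "{s. Re s > 1}"
  have S: "convex ?S" "open ?S" by (rule convex_halfspace_Re_gt open_halfspace_Re_gt)+
  obtain H where H: "\<And>x. x \<in> ?S \<Longrightarrow> (H has_field_derivative mangoldt_series x) (at x within ?S)"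
    using holomorphic_convex_primitive'[OF S mangoldt_series_holomorphic] by blast
  have "\<exists>c. \<forall>x\<in>?S. zeta_series x * exp (H x) = c"
  proof (rule has_field_derivative_zero_constant[OF S(1)])
    fix x assume x: "x \<in> ?S"
    note [derivative_intros] = H[OF x] has_field_derivative_at_within[OF zeta_series_deriv]
    show "((\<lambda>x. zeta_series x * exp (H x)) has_field_derivative 0) (at x within ?S)"
      using x by (auto intro!: derivative_eq_intros)
  qed
  then obtain c where c: "\<And>x. Re x > 1 \<Longrightarrow> zeta_series x * exp (H x) = c" by blast
  have "zeta_series s = 0" using 0 zeta_regular_eq[OF s] s by auto
  then have "c = 0" using c[OF s] by simp
  then have Z: "zeta_regular x = 0" if "Re x > 1" for x using c[OF that] zeta_regular_eq[OF that] by simp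
  \<comment> \<open>A single zero has forced zeta to vanish on the whole half-plane; approaching 1
    from the right contradicts \<open>zeta_regular_tendsto_1\<close>.\<close>
  have "((\<lambda>x::real. zeta_regular (1 + of_real x)) \<longlongrightarrow> 1) (at_right 0)"
  proof (rule filterlim_compose[OF zeta_regular_tendsto_1])
    show "filterlim (\<lambda>x. 1 + complex_of_real x) (at 1) (at_right 0)"
      unfolding filterlim_at by (auto intro!: tendsto_eq_intros simp: eventually_at_filter)
  qed
  moreover have "eventually (\<lambda>x::real. zeta_regular (1 + of_real x) = 0) (at_right 0)"
    by (rule eventually_mono[OF eventually_at_right_less[of 0]]) (auto intro!: Z)
  ultimately have "((\<lambda>x::real. 0 :: complex) \<longlongrightarrow> 1) (at_right 0)"
    by (rule Lim_transform_eventually)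
  then show False by (simp add: tendsto_const_iff)
qed

lemma mangoldt_series_eq:
  assumes s: "Re s > 1"
  shows "mangoldt_series s = 1 / (s - 1) - deriv zeta_regular s / zeta_regular s"
proof -
  have "((\<lambda>z. (z - 1) * zeta_series z) has_field_derivative
      (zeta_series s + (s - 1) * (- (mangoldt_series s * zeta_series s)))) (at s)"
    by (auto intro!: derivative_eq_intros zeta_series_deriv s)
  then have "(zeta_regular has_field_derivative
      (zeta_series s + (s - 1) * (- (mangoldt_series s * zeta_series s)))) (at s)"
    using s by (subst has_field_derivative_cong_ev[where g="\<lambda>z. (z - 1) * zeta_series z"])
      (auto intro!: eventually_mono[OF eventually_nhds_in_open[OF open_halfspace_Re_gt[of 1]]] simp: zeta_regular_eq)
  then have "deriv zeta_regular s = zeta_series s + (s - 1) * (- (mangoldt_series s * zeta_series s))"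
    by (rule DERIV_imp_deriv)
  moreover have "s - 1 \<noteq> 0" "zeta_series s \<noteq> 0"
    using s zeta_regular_nonzero_Re_gt_1[OF s] zeta_regular_eq[OF s] by auto
  moreover have "1 / a - (z + a * (- (m * z))) / (a * z) = m" if "a \<noteq> 0" "z \<noteq> 0" for a z m :: complex
    using that by (simp add: field_simps)
  ultimately show ?thesis
    by (simp only: zeta_regular_eq[OF s] not_False_eq_True)
qed

text \<open>\<open>k\<close> is the order of the zero at \<open>\<xi>\<close>, read off from
  \<open>f = (z - \<xi>)^k * g\<close> with \<open>g\<close> nonvanishing; it is 0 if
  \<open>f \<xi> \<noteq> 0\<close>. The point \<open>w\<close> excludes that \<open>f\<close>
  vanishes identically.\<close>

lemma log_deriv_residue:
  fixes f :: "complex \<Rightarrow> complex"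
  assumes f: "f holomorphic_on S" "open S" "connected S" "\<xi> \<in> S" and w: "w \<in> S" "f w \<noteq> 0"
  obtains k :: nat where "((\<lambda>z. (z - \<xi>) * (deriv f z / f z)) \<longlongrightarrow> of_nat k) (at \<xi>)" "f \<xi> = 0 \<Longrightarrow> k > 0"
proof (cases "f \<xi> = 0")
  case False
  have "isCont (deriv f) \<xi>" "isCont f \<xi>"
    using f holomorphic_deriv[OF f(1,2)]
    by (auto intro!: continuous_on_interior[OF holomorphic_on_imp_continuous_on] simp: interior_open)
  then have "((\<lambda>z. (z - \<xi>) * (deriv f z / f z)) \<longlongrightarrow> (\<xi> - \<xi>) * (deriv f \<xi> / f \<xi>)) (at \<xi>)"
    unfolding isCont_def using False by (intro tendsto_intros)
  with False that[of 0] show ?thesis by simp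
next
  case True
  then have nc: "\<not> f constant_on S" using f(4) w by (metis constant_on_def)
  obtain g r n where g: "0 < n" "0 < r" "ball \<xi> r \<subseteq> S" "g holomorphic_on ball \<xi> r"
    "\<And>w. w \<in> ball \<xi> r \<Longrightarrow> f w = (w - \<xi>) ^ n * g w" "\<And>w. w \<in> ball \<xi> r \<Longrightarrow> g w \<noteq> 0"
    by (rule holomorphic_factor_zero_nonconstant[OF f True nc]) (rule that; assumption)
  have eq: "(z - \<xi>) * (deriv f z / f z) = of_nat n + (z - \<xi>) * (deriv g z / g z)"
    if z: "z \<in> ball \<xi> r" "z \<noteq> \<xi>" for z
  proof -
    have "(g has_field_derivative deriv g z) (at z)" using g(4) z by (intro holomorphic_derivI) auto
    then have "((\<lambda>z. (z - \<xi>) ^ n * g z) has_field_derivative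
        (of_nat n * (z - \<xi>) ^ (n - 1) * g z + (z - \<xi>) ^ n * deriv g z)) (at z)"
      by (auto intro!: derivative_eq_intros)
    then have "(f has_field_derivative (of_nat n * (z - \<xi>) ^ (n - 1) * g z + (z - \<xi>) ^ n * deriv g z)) (at z)"
      using z g(5) by (subst has_field_derivative_cong_ev[where g="\<lambda>z. (z - \<xi>) ^ n * g z"])
        (auto intro!: eventually_mono[OF eventually_nhds_in_open[of "ball \<xi> r"]])
    then have "deriv f z = of_nat n * (z - \<xi>) ^ (n - 1) * g z + (z - \<xi>) ^ n * deriv g z"
      by (rule DERIV_imp_deriv)
    moreover have "(z - \<xi>) ^ n = (z - \<xi>) * (z - \<xi>) ^ (n - 1)" using g(1) by (simp flip: power_Suc)
    moreover have "y * ((N * p * h + y * p * h') / (y * p * h)) = N + y * (h' / h)"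
      if "y \<noteq> 0" "p \<noteq> 0" "h \<noteq> 0" for y p h h' N :: complex
      using that by (simp add: field_simps)
    moreover have "z - \<xi> \<noteq> 0" "(z - \<xi>) ^ (n - 1) \<noteq> 0" using z by auto
    ultimately show ?thesis using g(5,6)[OF z(1)] by (simp only: not_False_eq_True)
  qed
  have "isCont (deriv g) \<xi>" "isCont g \<xi>"
    using g(2,4) holomorphic_deriv[OF g(4)]
    by (auto intro!: continuous_on_interior[OF holomorphic_on_imp_continuous_on] simp: interior_open)
  then have "((\<lambda>z. of_nat n + (z - \<xi>) * (deriv g z / g z)) \<longlongrightarrow> of_nat n + (\<xi> - \<xi>) * (deriv g \<xi> / g \<xi>)) (at \<xi>)"
    unfolding isCont_def using g(2,6) by (intro tendsto_intros) auto
  moreover have "eventually (\<lambda>z. of_nat n + (z - \<xi>) * (deriv g z / g z) = (z - \<xi>) * (deriv f z / f z)) (at \<xi>)"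
    by (rule eventually_mono[OF eventually_at_in_open[of "ball \<xi> r" \<xi>]])
       (use g(2) in \<open>auto intro!: eq[symmetric] simp del: times_divide_eq_right\<close>)
  ultimately have "((\<lambda>z. (z - \<xi>) * (deriv f z / f z)) \<longlongrightarrow> of_nat n) (at \<xi>)"
    using Lim_transform_eventually by force
  then show ?thesis using that g(1) by blast
qed

lemma Re_mangoldt_term:
  "Re (mangoldt (Suc n) * of_nat (Suc n) powr (- Complex x t)) =
     mangoldt (Suc n) * real (Suc n) powr (- x) * cos (t * ln (Suc n))"
  by (simp add: powr_def Re_exp del: of_nat_Suc)

text \<open>Termwise this is \<open>3 + 4 * cos \<theta> + cos (2 * \<theta>) = 2 * (1 + cos
  \<theta>)^2\<close> with \<open>\<theta> = t * ln (Suc n)\<close>.\<close>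

lemma Re_mangoldt_series_341:
  assumes x: "x > 1"
  shows "3 * Re (mangoldt_series (Complex x 0)) + 4 * Re (mangoldt_series (Complex x t)) + Re (mangoldt_series (Complex x (2 * t))) \<ge> 0"
proof -
  let ?f = "\<lambda>t n. mangoldt (Suc n) * real (Suc n) powr (- x) * cos (t * ln (Suc n))"
  have S: "?f t sums Re (mangoldt_series (Complex x t))" for t
    using sums_Re[OF dirichlet_series_sums[OF norm_mangoldt_le, of "Complex x t"]] x
    by (simp only: Re_mangoldt_term) simp
  have sum: "(\<lambda>n. 3 * ?f 0 n + 4 * ?f t n + ?f (2 * t) n) sums
     (3 * Re (mangoldt_series (Complex x 0)) + 4 * Re (mangoldt_series (Complex x t)) + Re (mangoldt_series (Complex x (2 * t))))"
    by (intro sums_add sums_mult S)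
  have nonneg: "3 * ?f 0 n + 4 * ?f t n + ?f (2 * t) n \<ge> 0" for n
  proof -
    define c where "c = cos (t * ln (Suc n))"
    have e: "cos ((2 * t) * ln (Suc n)) = 2 * c\<^sup>2 - 1"
      unfolding c_def mult.assoc by (rule cos_double_cos)
    have "3 * ?f 0 n + 4 * ?f t n + ?f (2 * t) n =
      mangoldt (Suc n) * real (Suc n) powr (- x) * (2 * (1 + c)\<^sup>2)"
      unfolding e c_def[symmetric] by (simp add: power2_eq_square algebra_simps del: of_nat_Suc)
    then show ?thesis by (simp add: mangoldt_nonneg)
  qed
  show ?thesis by (rule sums_le[OF nonneg sums_zero sum])
qed

text \<open>As \<open>x\<close> tends to 0 from the right,
  \<open>x * Re (mangoldt_series (1 + x + i u))\<close> tends to \<open>1 - k\<close> for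
  \<open>u = 0\<close> and to \<open>- k\<close> otherwise, where \<open>k\<close> is the order of
  the zero of \<open>zeta_regular\<close> at \<open>1 + i u\<close> and the 1 stems from the pole of
  zeta. A zero at height \<open>t\<close> would turn the 3-4-1 inequality into
  \<open>0 \<le> 3 * (1 - k0) - 4 * k1 - k2\<close> with \<open>k1 \<ge> 1\<close>.\<close>

lemma zeta_regular_nonzero:
  assumes s: "Re s \<ge> 1"
  shows "zeta_regular s \<noteq> 0"
proof (cases "Re s > 1")
  case True then show ?thesis by (rule zeta_regular_nonzero_Re_gt_1)
next
  case False
  define t where "t = Im s"
  let ?D = "\<lambda>x u. deriv zeta_regular (Complex (1 + x) u) / zeta_regular (Complex (1 + x) u)"
  let ?M = "\<lambda>x u. x * Re (mangoldt_series (Complex (1 + x) u))"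
  have st: "s = Complex 1 t" using s False by (simp add: t_def complex_eq_iff)
  show ?thesis
  proof
    assume 0: "zeta_regular s = 0"
    have t: "t \<noteq> 0"
    proof
      assume "t = 0"
      then have "s = 1" using st by (simp add: complex_eq_iff)
      then show False using 0 zeta_regular_1 by simp
    qed
    have lim: "\<exists>k::nat. ((\<lambda>x. of_real x * ?D x u) \<longlongrightarrow> of_nat k) (at_right 0)
       \<and> (zeta_regular (Complex 1 u) = 0 \<longrightarrow> k > 0)" for u :: real
    proof -
      obtain k where k: "((\<lambda>z. (z - Complex 1 u) * (deriv zeta_regular z / zeta_regular z)) \<longlongrightarrow> of_nat k) (at (Complex 1 u))"
        "zeta_regular (Complex 1 u) = 0 \<Longrightarrow> k > 0"
        using log_deriv_residue[OF zeta_regular_holomorphic open_halfspace_Re_gt, of "Complex 1 u" 1] zeta_regular_1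
          convex_connected[OF convex_halfspace_Re_gt] by auto
      have "filterlim (\<lambda>x. Complex (1 + x) u) (at (Complex 1 u)) (at_right 0)"
        unfolding filterlim_at by (auto simp: eventually_at_filter Complex_eq intro!: tendsto_eq_intros)
      from filterlim_compose[OF k(1) this] have
        "((\<lambda>x. (Complex (1 + x) u - Complex 1 u) * ?D x u) \<longlongrightarrow> of_nat k) (at_right 0)" .
      moreover have "Complex (1 + x) u - Complex 1 u = of_real x" for x by (simp add: complex_eq_iff)
      ultimately show ?thesis using k(2) by auto
    qed
    have lim2: "\<exists>k::nat. ((\<lambda>x. ?M x u) \<longlongrightarrow> (if u = 0 then 1 else 0) - real k) (at_right 0)
       \<and> (zeta_regular (Complex 1 u) = 0 \<longrightarrow> k > 0)" for u :: real
    proof -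
      obtain k where k: "((\<lambda>x. of_real x * ?D x u) \<longlongrightarrow> of_nat k) (at_right 0)"
        "zeta_regular (Complex 1 u) = 0 \<longrightarrow> k > 0" using lim by blast
      have l: "((\<lambda>x. of_real x / Complex x u) \<longlongrightarrow> (if u = 0 then 1 else 0)) (at_right 0)"
      proof (cases "u = 0")
        case True
        have "eventually (\<lambda>x. 1 = of_real x / Complex x u) (at_right 0)"
          by (rule eventually_mono[OF eventually_at_right_less[of 0]]) (simp add: True Complex_eq)
        with True show ?thesis by (auto intro: Lim_transform_eventually[OF tendsto_const])
      next
        case False
        have "((\<lambda>x. of_real x / Complex x u) \<longlongrightarrow> of_real 0 / Complex 0 u) (at_right 0)"
          using False unfolding Complex_eq by (intro tendsto_intros) auto
        with False show ?thesis by simp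
      qed
      have "((\<lambda>x. Re (of_real x / Complex x u - of_real x * ?D x u))
          \<longlongrightarrow> Re ((if u = 0 then 1 else 0) - of_nat k)) (at_right 0)"
        by (intro tendsto_Re tendsto_diff k l)
      moreover have "eventually (\<lambda>x. Re (of_real x / Complex x u - of_real x * ?D x u)
         = ?M x u) (at_right 0)"
      proof -
        have "Re (of_real x / Complex x u - of_real x * ?D x u)
         = ?M x u" if "x > 0" for x
        proof -
          have "Complex (1 + x) u - 1 = Complex x u" by (simp add: complex_eq_iff)
          then have "of_real x * mangoldt_series (Complex (1 + x) u) = of_real x / Complex x u - of_real x * ?D x u"
            using mangoldt_series_eq[of "Complex (1 + x) u"] that by (simp add: right_diff_distrib)
          then have "Re (of_real x * mangoldt_series (Complex (1 + x) u)) = Re (of_real x / Complex x u - of_real x * ?D x u)"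
            by simp
          then show ?thesis by simp
        qed
        then show ?thesis by (rule eventually_mono[OF eventually_at_right_less[of 0]])
      qed
      ultimately have "((\<lambda>x. ?M x u) \<longlongrightarrow> Re ((if u = 0 then 1 else 0) - of_nat k)) (at_right 0)"
        by (rule Lim_transform_eventually)
      then show ?thesis using k(2) by (intro exI[of _ k]) (simp split: if_splits)
    qed
    obtain k0 where k0: "((\<lambda>x. ?M x 0) \<longlongrightarrow> 1 - real k0) (at_right 0)"
      using lim2[of 0] by auto
    obtain k1 where k1: "((\<lambda>x. ?M x t) \<longlongrightarrow> 0 - real k1) (at_right 0)" "k1 > 0"
      using lim2[of t] t 0 st by auto
    obtain k2 where k2: "((\<lambda>x. ?M x (2 * t)) \<longlongrightarrow> 0 - real k2) (at_right 0)"
      using lim2[of "2 * t"] t by auto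
    have "((\<lambda>x. 3 * ?M x 0 + 4 * ?M x t +
       ?M x (2 * t)) \<longlongrightarrow> 3 * (1 - real k0) + 4 * (0 - real k1) + (0 - real k2)) (at_right 0)"
      by (intro tendsto_intros k0 k1 k2)
    moreover have "eventually (\<lambda>x. 0 \<le> 3 * ?M x 0 + 4 * ?M x t +
       ?M x (2 * t)) (at_right 0)"
    proof -
      have "0 \<le> 3 * ?M x 0 + 4 * ?M x t +
       ?M x (2 * t)" if "x > 0" for x
        using mult_nonneg_nonneg[OF less_imp_le[OF that] Re_mangoldt_series_341[of "1 + x" t]] that
        by (simp add: algebra_simps)
      then show ?thesis by (rule eventually_mono[OF eventually_at_right_less[of 0]])
    qed
    ultimately have "0 \<le> 3 * (1 - real k0) + 4 * (0 - real k1) + (0 - real k2)"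
      by (rule tendsto_lowerbound) simp
    then show False using k1(2) by simp
  qed
qed

subsection \<open>Chebyshev bounds\<close>

definition psi :: "nat \<Rightarrow> real" where
  "psi n = (\<Sum>k=1..n. mangoldt k)"

lemma psi_0 [simp]: "psi 0 = 0" by (simp add: psi_def)

lemma psi_Suc: "psi (Suc n) = psi n + mangoldt (Suc n)"
  by (simp add: psi_def)

lemma psi_mono: "m \<le> n \<Longrightarrow> psi m \<le> psi n"
  unfolding psi_def by (intro sum_mono2) (auto simp: mangoldt_nonneg)

lemma psi_nonneg: "psi n \<ge> 0"
  using psi_mono[of 0 n] by simp

lemma card_multiples_le:
  assumes "d > 0"
  shows "card {k \<in> {1..n}. d dvd k} = n div d"
proof -
  have "{k \<in> {1..n}. d dvd k} = (\<lambda>j. d * j) ` {1..n div d}"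
  proof (intro equalityI subsetI)
    fix k assume "k \<in> {k \<in> {1..n}. d dvd k}"
    then obtain j where "k = d * j" "1 \<le> d * j" "d * j \<le> n" by auto
    then show "k \<in> (\<lambda>j. d * j) ` {1..n div d}"
      using assms by (auto simp: less_eq_div_iff_mult_less_eq mult.commute intro!: image_eqI Suc_leI Nat.gr0I)
  next
    fix k assume "k \<in> (\<lambda>j. d * j) ` {1..n div d}"
    then show "k \<in> {k \<in> {1..n}. d dvd k}"
      using assms by (auto simp: less_eq_div_iff_mult_less_eq mult.commute)
  qed
  then show ?thesis using assms by (simp add: card_image inj_on_def)
qed

text \<open>The upper limit \<open>N\<close> may exceed \<open>n\<close>, so that the logarithms of
  \<open>(2 n)!\<close> and \<open>n!\<close> can be expanded over the same range.\<close>

lemma ln_fact_eq_sum_mangoldt: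
  assumes "n \<le> N"
  shows "ln (fact n) = (\<Sum>d=1..N. mangoldt d * real (n div d))"
proof -
  have "ln (fact n :: real) = (\<Sum>k=1..n. ln (real k))"
    unfolding fact_prod of_nat_prod by (subst ln_prod) auto
  also have "\<dots> = (\<Sum>k=1..n. \<Sum>d\<in>{d\<in>{1..N}. d dvd k}. mangoldt d)"
  proof (rule sum.cong[OF refl])
    fix k assume k: "k \<in> {1..n}"
    then have "{d\<in>{1..N}. d dvd k} = {d. d dvd k}"
      using assms by (auto dest: dvd_imp_le intro!: Suc_leI Nat.gr0I)
    then show "ln (real k) = (\<Sum>d\<in>{d\<in>{1..N}. d dvd k}. mangoldt d)"
      using mangoldt_sum[of k, where ?'a = real] k by simp
  qed
  also have "\<dots> = (\<Sum>d=1..N. \<Sum>k\<in>{k\<in>{1..n}. d dvd k}. mangoldt d)"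
    by (rule sum.swap_restrict) auto
  also have "\<dots> = (\<Sum>d=1..N. mangoldt d * real (n div d))"
    by (rule sum.cong) (use card_multiples_le in auto)
  finally show ?thesis .
qed

text \<open>In the expansion of \<open>ln (2 n choose n)\<close> the prime power \<open>d\<close>
  has weight \<open>2 n div d - 2 (n div d)\<close>, which is never negative and equals 1 for
  \<open>n < d \<le> 2 n\<close>.\<close>

lemma psi_double_le: "psi (2 * n) - psi n \<le> 2 * real n * ln 2"
proof -
  have "psi (2 * n) - psi n = (\<Sum>d\<in>{1..2*n} - {1..n}. mangoldt d)"
    unfolding psi_def by (subst sum_diff) auto
  also have "\<dots> \<le> (\<Sum>d\<in>{1..2*n} - {1..n}. mangoldt d * (real (2 * n div d) - 2 * real (n div d)))"
  proof (rule sum_mono)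
    fix d assume d: "d \<in> {1..2*n} - {1..n}"
    then have "2 * n div d = 1" by (intro div_nat_eqI) auto
    moreover have "n div d = 0" using d by auto
    ultimately show "mangoldt d \<le> mangoldt d * (real (2 * n div d) - 2 * real (n div d))" by simp
  qed
  also have "\<dots> \<le> (\<Sum>d=1..2*n. mangoldt d * (real (2 * n div d) - 2 * real (n div d)))"
  proof (rule sum_mono2)
    fix d
    have "2 * (n div d) \<le> 2 * n div d" by (cases "d = 0") (auto simp: less_eq_div_iff_mult_less_eq mult.assoc intro: div_times_less_eq_dividend)
    then have "real (2 * n div d) - 2 * real (n div d) \<ge> 0" by linarith
    then show "0 \<le> mangoldt d * (real (2 * n div d) - 2 * real (n div d))"
      by (simp add: mangoldt_nonneg)
  qed auto
  also have "\<dots> = ln (fact (2 * n)) - 2 * ln (fact n)"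
    using ln_fact_eq_sum_mangoldt[of "2*n" "2*n"] ln_fact_eq_sum_mangoldt[of n "2*n"]
    by (simp add: algebra_simps sum_subtractf sum_distrib_left)
  also have "\<dots> = ln (real (2 * n choose n))"
    using binomial_fact[of n "2 * n", where ?'a = real] by (simp add: ln_div ln_mult)
  also have "\<dots> \<le> ln (2 ^ (2 * n))"
  proof -
    have "2 * n choose n \<le> 2 ^ (2 * n)"
      using member_le_sum[of n "{..2*n}" "\<lambda>k. 2 * n choose k"] choose_row_sum[of "2 * n"] by simp
    then have "real (2 * n choose n) \<le> 2 ^ (2 * n)"
      by (metis of_nat_le_iff of_nat_numeral of_nat_power)
    then show ?thesis by (subst ln_le_cancel_iff) auto
  qed
  also have "\<dots> = 2 * real n * ln 2" by (simp add: ln_realpow)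
  finally show ?thesis .
qed

text \<open>Halving with \<open>m = (n + 1) div 2\<close> gives
  \<open>psi n \<le> 6 m + 2 m \<le> 4 (n + 1)\<close>, which is at most \<open>6 n\<close> for
  \<open>n \<ge> 2\<close>. Any linear bound would serve.\<close>

lemma psi_le: "psi n \<le> 6 * real n"
proof (induction n rule: less_induct)
  case (less n)
  show ?case
  proof (cases "n \<le> 1")
    case True
    then show ?thesis by (cases n) (auto simp: psi_def)
  next
    case False
    define m where "m = (n + 1) div 2"
    have m: "m < n" "n \<le> 2 * m" "2 * m \<le> n + 1" using False by (auto simp: m_def)
    have "psi n \<le> psi m + 2 * real m * ln 2"
      using psi_mono[OF m(2)] psi_double_le[of m] by linarith
    also have "\<dots> \<le> 6 * real m + 2 * real m * 1"
      using less.IH[OF m(1)] ln_2_less_1 by (intro add_mono mult_left_mono) auto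
    also have "\<dots> \<le> 6 * real n" using m False by linarith
    finally show ?thesis .
  qed
qed

section \<open>From a convergent series to an asymptotic formula\<close>

text \<open>If \<open>f n \<ge> (1 + e) n\<close>, monotonicity keeps
  \<open>f j - j \<ge> e n / 2\<close> for the next \<open>e n / 2\<close> integers
  \<open>j\<close>, and this block contributes at least \<open>e^2 / 16\<close> to the series,
  against the Cauchy criterion. If \<open>f n \<le> (1 - e) n\<close>, the block that ends at
  \<open>n\<close> plays the same role.\<close>

lemma mono_asymp_of_summable:
  fixes f :: "nat \<Rightarrow> real"
  assumes mono: "mono f" and sm: "summable (\<lambda>n. (f (Suc n) / real (Suc n) - 1) / real (Suc n))"
  shows "(\<lambda>n. f n / real n) \<longlonglongrightarrow> 1"
proof (rule LIMSEQ_I)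
  fix r :: real assume r: "r > 0"
  define e where "e = min r 1"
  have e: "e > 0" "e \<le> 1" "e \<le> r" using r by (auto simp: e_def)
  define t where "t = (\<lambda>j. (f j - real j) / (real j)\<^sup>2)"
  have t: "(f (Suc n) / real (Suc n) - 1) / real (Suc n) = t (Suc n)" for n
    by (simp add: t_def field_simps power2_eq_square del: of_nat_Suc)
  have "summable t" using sm unfolding t by (subst (asm) summable_Suc_iff)
  then obtain N0 where N0: "\<And>m n. m \<ge> N0 \<Longrightarrow> norm (sum t {m..<n}) < e\<^sup>2 / 16"
    using e unfolding summable_Cauchy by (metis divide_pos_pos zero_less_numeral zero_less_power)
  show "\<exists>no. \<forall>n\<ge>no. norm (f n / real n - 1) < r"
  proof (intro exI[of _ "4 * N0 + 8"] allI impI)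
    fix n assume n: "4 * N0 + 8 \<le> n"
    \<comment> \<open>The common length of both blocks. As \<open>e \<le> 1\<close>, the block
      ending at \<open>n\<close> starts above \<open>n / 2\<close>, hence beyond
      \<open>N0\<close>.\<close>
    define h where "h = nat \<lceil>e * real n / 2\<rceil>"
    have en: "e * real n > 0" "e * real n \<le> real n" using e n by auto
    have h: "real h \<ge> e * real n / 2" "real h < e * real n / 2 + 1"
      unfolding h_def using en by linarith+
    have up: "f n < (1 + e) * real n"
    proof (rule ccontr)
      assume "\<not> f n < (1 + e) * real n"
      then have fn: "f n \<ge> (1 + e) * real n" by simp
      have "e / (8 * real n) \<le> t j" if "j \<in> {n..<n+h}" for j
      proof -
        have j: "real j \<le> real n + e * real n / 2" "j \<ge> n" using that h by auto
        have "f j \<ge> (1 + e) * real n" using monoD[OF mono j(2)] fn by linarith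
        then have "f j - real j \<ge> e * real n / 2" using j by (simp add: algebra_simps)
        moreover have "(real j)\<^sup>2 \<le> (2 * real n)\<^sup>2" using j en by (intro power_mono) auto
        ultimately have "(e * real n / 2) / (2 * real n)\<^sup>2 \<le> t j"
          unfolding t_def using j n en by (intro frac_le) auto
        then show ?thesis using n by (simp add: power2_eq_square field_simps)
      qed
      then have "real (card {n..<n+h}) * (e / (8 * real n)) \<le> sum t {n..<n+h}"
        by (intro sum_bounded_below) auto
      moreover have "real (card {n..<n+h}) * (e / (8 * real n)) \<ge> (e * real n / 2) * (e / (8 * real n))"
        using h e by (intro mult_right_mono) auto
      moreover have "(e * real n / 2) * (e / (8 * real n)) = e\<^sup>2 / 16"
        using n by (simp add: power2_eq_square)
      moreover have "sum t {n..<n+h} < e\<^sup>2 / 16" using N0[of n "n + h"] n by auto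
      ultimately show False by linarith
    qed
    have low: "f n > (1 - e) * real n"
    proof (rule ccontr)
      assume "\<not> f n > (1 - e) * real n"
      then have fn: "f n \<le> (1 - e) * real n" by simp
      have hn: "h \<le> n" "n + 1 - h \<ge> N0"
        using h en n by linarith+
      have "t j \<le> - (e / (2 * real n))" if "j \<in> {n + 1 - h..<n+1}" for j
      proof -
        have j: "real j \<ge> real n - e * real n / 2" "j \<le> n" "j > 0"
          using that h hn(1) by auto
        have "f j \<le> (1 - e) * real n" using monoD[OF mono j(2)] fn by linarith
        then have "real j - f j \<ge> e * real n / 2" using j by (simp add: algebra_simps)
        moreover have "(real j)\<^sup>2 \<le> (real n)\<^sup>2" using j by (intro power_mono) auto
        moreover have "0 \<le> real j - f j" using calculation(1) en by linarith
        moreover have "0 < (real j)\<^sup>2" using j(3) by simp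
        ultimately have "(e * real n / 2) / (real n)\<^sup>2 \<le> (real j - f j) / (real j)\<^sup>2"
          by (intro frac_le)
        then have "e / (2 * real n) \<le> (real j - f j) / (real j)\<^sup>2" using n by (simp add: power2_eq_square)
        moreover have "t j = - ((real j - f j) / (real j)\<^sup>2)"
          unfolding t_def by (subst minus_divide_left) simp
        ultimately show ?thesis by linarith
      qed
      then have "sum t {n + 1 - h..<n+1} \<le> real (card {n + 1 - h..<n+1}) * (- (e / (2 * real n)))"
        by (intro sum_bounded_above) auto
      also have "\<dots> = - (real h * (e / (2 * real n)))" using hn by simp
      also have "\<dots> \<le> - ((e * real n / 2) * (e / (2 * real n)))"
        using h e by (intro le_imp_neg_le mult_right_mono) auto
      also have "\<dots> = - (e\<^sup>2 / 4)" using n by (simp add: power2_eq_square)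
      finally have "sum t {n + 1 - h..<n+1} \<le> - (e\<^sup>2 / 4)" .
      moreover have "\<bar>sum t {n + 1 - h..<n+1}\<bar> < e\<^sup>2 / 16" using N0[OF hn(2), of "n + 1"] by simp
      moreover have "e\<^sup>2 > 0" using e by simp
      ultimately show False by linarith
    qed
    have "real n > 0" using n by simp
    then have "\<bar>f n / real n - 1\<bar> < e" using up low by (simp add: abs_less_iff field_simps)
    then show "norm (f n / real n - 1) < r" using e by simp
  qed
qed

section \<open>From \<open>psi\<close> to the prime counting function\<close>

definition prime_count :: "nat \<Rightarrow> nat" where
  "prime_count n = card {p. prime p \<and> p \<le> n}"

lemma finite_primes_le [simp]: "finite {p::nat. prime p \<and> p \<le> n}"
  by (rule finite_subset[of _ "{..n}"]) auto

text \<open>A prime \<open>p\<close> has at most \<open>ln n / ln p\<close> powers up to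
  \<open>n\<close>, each of weight \<open>ln p\<close>, so it contributes at most
  \<open>ln n\<close>.\<close>

lemma psi_le_prime_count:
  assumes "n \<ge> 1"
  shows "psi n \<le> real (prime_count n) * ln n"
proof -
  let ?P = "{p. prime p \<and> p \<le> n}" and ?Q = "{k\<in>{1..n}. primepow k}"
  have "psi n = (\<Sum>k\<in>?Q. ln (real (aprimedivisor k)))"
    unfolding psi_def by (rule sum.mono_neutral_cong_right) (auto simp: mangoldt_def)
  also have "\<dots> = (\<Sum>p\<in>?P. \<Sum>k\<in>{k\<in>?Q. aprimedivisor k = p}. ln (real (aprimedivisor k)))"
  proof (rule sum.group[symmetric])
    show "aprimedivisor ` ?Q \<subseteq> ?P"
    proof safe
      fix k :: nat assume k: "k \<in> {1..n}" "primepow k"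
      have k1: "k > 1" using k(2) primepow_gt_Suc_0 by auto
      show "prime (aprimedivisor k)" using k1 by (intro prime_aprimedivisor') auto
      have "aprimedivisor k dvd k" by (rule aprimedivisor_dvd') (use k1 in auto)
      then show "aprimedivisor k \<le> n" using k by (auto dest: dvd_imp_le)
    qed
  qed auto
  also have "\<dots> \<le> (\<Sum>p\<in>?P. ln n)"
  proof (rule sum_mono)
    fix p assume p: "p \<in> ?P"
    then have p1: "p > 1" by (auto dest: prime_gt_1_nat)
    define J where "J = nat \<lfloor>ln n / ln p\<rfloor>"
    have lnp: "ln (real p) > 0" using p1 by simp
    have "{k\<in>?Q. aprimedivisor k = p} \<subseteq> (\<lambda>j. p ^ j) ` {1..J}"
    proof
      fix k assume k: "k \<in> {k\<in>?Q. aprimedivisor k = p}"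
      then obtain q j where j: "prime q" "j > 0" "k = q ^ j" by (auto simp: primepow_def)
      then have "q = p" using k by (simp add: aprimedivisor_prime_power)
      then have kp: "k = p ^ j" using j by simp
      then have "ln (real p ^ j) \<le> ln (real n)" using k p1 assms
        by (subst ln_le_cancel_iff) (auto simp flip: of_nat_power)
      then have "real j \<le> ln n / ln p" using lnp p1 by (simp add: ln_realpow field_simps)
      then have "j \<le> J" unfolding J_def by linarith
      then show "k \<in> (\<lambda>j. p ^ j) ` {1..J}" using kp j by auto
    qed
    then have "card {k\<in>?Q. aprimedivisor k = p} \<le> card ((\<lambda>j. p ^ j) ` {1..J})"
      by (intro card_mono) auto
    also have "\<dots> \<le> J" using card_image_le[of "{1..J}" "\<lambda>j. p ^ j"] by simp
    finally have c: "card {k\<in>?Q. aprimedivisor k = p} \<le> J" .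
    have "(\<Sum>k\<in>{k\<in>?Q. aprimedivisor k = p}. ln (real (aprimedivisor k))) = real (card {k\<in>?Q. aprimedivisor k = p}) * ln p"
      by simp
    also have "\<dots> \<le> real J * ln p" using c lnp by (intro mult_right_mono) auto
    also have "\<dots> \<le> (ln n / ln p) * ln p" using lnp assms unfolding J_def
      by (intro mult_right_mono) auto
    also have "\<dots> = ln n" using lnp by simp
    finally show "(\<Sum>k\<in>{k\<in>?Q. aprimedivisor k = p}. ln (real (aprimedivisor k))) \<le> ln n" .
  qed
  finally show ?thesis by (simp add: prime_count_def)
qed

text \<open>Every prime beyond \<open>n powr (1 - e)\<close> has weight at least
  \<open>(1 - e) * ln n\<close>; the others are few enough to be discarded.\<close>

lemma prime_count_le_psi:
  assumes "n \<ge> 1" and e: "0 < e" "e < (1::real)"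
  shows "(1 - e) * ln n * (real (prime_count n) - real n powr (1 - e)) \<le> psi n"
proof -
  let ?P = "{p. prime p \<and> p \<le> n}" and ?R = "{p. prime p \<and> p \<le> n \<and> real p > real n powr (1 - e)}"
  let ?S = "{1..nat \<lfloor>real n powr (1 - e)\<rfloor>}"
  have "?P \<subseteq> ?R \<union> ?S"
  proof
    fix p assume p: "p \<in> ?P"
    then have "p \<ge> 1" by (auto dest: prime_gt_0_nat)
    then show "p \<in> ?R \<union> ?S" using p le_nat_floor[of p "real n powr (1 - e)"]
      by (cases "real p \<le> real n powr (1 - e)") auto
  qed
  then have "card ?P \<le> card (?R \<union> ?S)" by (intro card_mono) auto
  also have "\<dots> \<le> card ?R + card ?S" by (rule card_Un_le)
  finally have "real (card ?P) \<le> real (card ?R) + real (card ?S)" by linarith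
  moreover have "real (card ?S) \<le> real n powr (1 - e)" by simp
  ultimately have "real (prime_count n) - real n powr (1 - e) \<le> real (card ?R)"
    unfolding prime_count_def by linarith
  then have "(1 - e) * ln n * (real (prime_count n) - real n powr (1 - e)) \<le> (1 - e) * ln n * real (card ?R)"
    using e assms by (intro mult_left_mono) auto
  also have "\<dots> = (\<Sum>p\<in>?R. (1 - e) * ln n)" by simp
  also have "\<dots> \<le> (\<Sum>p\<in>?R. mangoldt p)"
  proof (rule sum_mono)
    fix p assume p: "p \<in> ?R"
    have "(1 - e) * ln n = ln (real n powr (1 - e))" using assms by (simp add: ln_powr)
    also have "\<dots> \<le> ln (real p)" using p assms by (subst ln_le_cancel_iff) (auto dest: prime_gt_0_nat)
    also have "\<dots> = mangoldt p" using p by simp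
    finally show "(1 - e) * ln n \<le> mangoldt p" .
  qed
  also have "\<dots> \<le> psi n" unfolding psi_def
    by (rule sum_mono2) (auto simp: mangoldt_nonneg dest: prime_ge_1_nat)
  finally show ?thesis .
qed

lemma prime_count_asymp_of_psi:
  assumes psi: "(\<lambda>n. psi n / real n) \<longlonglongrightarrow> 1"
  shows "(\<lambda>n. real (prime_count n) * ln (real n) / real n) \<longlonglongrightarrow> 1"
proof (rule LIMSEQ_I)
  fix r :: real assume r: "r > 0"
  \<comment> \<open>\<open>e \<le> 1/2\<close> is what makes
    \<open>1 + e \<le> (1 - e) * (1 + 4 * e)\<close>. Adding the discarded small primes gives a
    total error of \<open>5 * e < r\<close>.\<close>
  define e where "e = min (r / 8) (1 / 2)"
  have e: "0 < e" "e \<le> 1/2" "e \<le> r / 8" using r by (auto simp: e_def)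
  have "(\<lambda>n. real n powr (1 - e) * ln (real n) / real n) \<longlonglongrightarrow> 0" using e by real_asymp
  then have ev1: "eventually (\<lambda>n. real n powr (1 - e) * ln (real n) / real n < e) sequentially"
    using e by (intro order_tendstoD) auto
  have ev2: "eventually (\<lambda>n. \<bar>psi n / real n - 1\<bar> < e) sequentially"
    using tendstoD[OF psi e(1)] by (simp add: dist_real_def)
  have "eventually (\<lambda>n. norm (real (prime_count n) * ln (real n) / real n - 1) < r) sequentially"
    using ev1 ev2 eventually_gt_at_top[of 1]
  proof eventually_elim
    case (elim n)
    define x where "x = real (prime_count n) * ln (real n) / real n"
    have n: "real n > 0" using elim by simp
    have "psi n / real n \<le> x" unfolding x_def using psi_le_prime_count[of n] elim by (intro divide_right_mono) auto
    then have low: "x > 1 - e" using elim by linarith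
    define y where "y = real n powr (1 - e) * ln (real n) / real n"
    have "(1 - e) * (x - y) = ((1 - e) * ln n * (real (prime_count n) - real n powr (1 - e))) / real n"
      using n by (simp add: x_def y_def field_simps)
    also have "\<dots> \<le> psi n / real n" using prime_count_le_psi[of n e] elim e by (intro divide_right_mono) auto
    also have "\<dots> < 1 + e" using elim by linarith
    finally have "(1 - e) * (x - y) < 1 + e" .
    also have "1 + e \<le> (1 - e) * (1 + 4 * e)" using e mult_left_mono[of e "1/2" "4 * e"] by (simp add: algebra_simps)
    finally have "x - y < 1 + 4 * e" using e by (simp add: mult_less_cancel_left)
    then have "x < 1 + 5 * e" using elim by (simp add: y_def)
    then show ?case using low e r unfolding x_def by (simp add: abs_less_iff)
  qed
  then show "\<exists>no. \<forall>n\<ge>no. norm (real (prime_count n) * ln (real n) / real n - 1) < r"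
    by (simp add: eventually_sequentially)
qed

subsection \<open>The prime number theorem\<close>

lemma mangoldt_sum_by_parts:
  "(\<Sum>n<N. mangoldt (Suc n) * of_nat (Suc n) powr (- s)) =
   (\<Sum>n<N. of_real (psi (Suc n)) * (of_nat (Suc n) powr (- s) - of_nat (Suc (Suc n)) powr (- s)))
   + of_real (psi N) * (of_nat (Suc N) powr (- s) :: complex)"
proof (induction N)
  case (Suc N)
  have "of_real (psi (Suc N)) = of_real (psi N) + (mangoldt (Suc N) :: complex)"
    by (simp add: psi_Suc)
  then show ?case using Suc by (simp add: algebra_simps del: of_nat_Suc)
qed simp

text \<open>Summation by parts; the boundary term tends to 0 because \<open>psi N\<close> is
  linearly bounded and Re s > 1.\<close>

lemma psi_differences_sums:
  assumes s: "Re s > 1"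
  shows "(\<lambda>n. of_real (psi (Suc n)) * (of_nat (Suc n) powr (- s) - of_nat (Suc (Suc n)) powr (- s))) sums mangoldt_series s"
proof -
  have "(\<lambda>N. norm (of_real (psi N) * (of_nat (Suc N) powr (- s) :: complex))) \<longlonglongrightarrow> 0"
  proof (rule tendsto_sandwich[of "\<lambda>_. 0"])
    show "\<forall>\<^sub>F N in sequentially. norm (of_real (psi N) * (of_nat (Suc N) powr (- s) :: complex)) \<le> 6 * real N * real (Suc N) powr (- Re s)"
      using psi_le psi_nonneg by (auto simp: norm_mult norm_nat_powr simp del: of_nat_Suc intro!: always_eventually mult_right_mono)
    show "(\<lambda>N. 6 * real N * real (Suc N) powr (- Re s)) \<longlonglongrightarrow> 0"
      using s by (simp, real_asymp)
  qed auto
  then have 0: "(\<lambda>N. of_real (psi N) * (of_nat (Suc N) powr (- s) :: complex)) \<longlonglongrightarrow> 0"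
    by (rule tendsto_norm_zero_cancel)
  have "(\<lambda>N. \<Sum>n<N. mangoldt (Suc n) * of_nat (Suc n) powr (- s)) \<longlonglongrightarrow> mangoldt_series s"
    using dirichlet_series_sums[OF norm_mangoldt_le s] by (simp only: sums_def)
  from tendsto_diff[OF this 0] show ?thesis
    by (simp only: mangoldt_sum_by_parts add_diff_cancel_right' sums_def diff_zero)
qed

text \<open>Replacing \<open>n powr (- s) - (n + 1) powr (- s)\<close> by its linear part costs
  \<open>O(n powr (- Re s - 2))\<close>; multiplied by \<open>psi n = O(n)\<close> this still
  converges for Re s > 0. So this error has no singularity on the line Re s = 1, and the sum plays
  the part of the Mellin transform of \<open>psi\<close>.\<close>

lemma psi_linear_error_series:
  fixes e :: "nat \<Rightarrow> complex \<Rightarrow> complex"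
  defines "e \<equiv> \<lambda>n s. of_real (psi (Suc n)) * (of_nat (Suc n) powr (- s) - of_nat (Suc (Suc n)) powr (- s)
    - s * of_nat (Suc n) powr (- s - 1))"
  shows "(\<lambda>s. \<Sum>n. e n s) holomorphic_on {s. Re s > 0}"
    and "Re s > 0 \<Longrightarrow> (\<lambda>n. e n s) sums (\<Sum>n. e n s)"
proof -
  have hol: "e n holomorphic_on {s. Re s > 0}" for n
    unfolding e_def by (auto intro!: holomorphic_intros simp del: of_nat_Suc)
  have le: "norm (e n s) \<le> 6 * (1 + norm s) ^ 2 * real (Suc n) powr (- Re s - 1)" if "Re s > 0" for n s
  proof -
    have eq: "e n s = - (of_real (psi (Suc n)) * (of_nat (Suc (Suc n)) powr (- s) - of_nat (Suc n) powr (- s) - (- s) * of_nat (Suc n) powr (- s - 1)))"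
      unfolding e_def by (simp add: algebra_simps del: of_nat_Suc)
    have "norm (e n s) \<le> (6 * real (Suc n)) * ((1 + norm s) ^ 2 * real (Suc n) powr (Re (- s) - 2))"
      unfolding eq norm_minus_cancel norm_mult norm_of_real
      using psi_le[of "Suc n"] psi_nonneg[of "Suc n"] powr_taylor[of "- s" n] that
      by (intro mult_mono) auto
    also have "\<dots> = 6 * (1 + norm s) ^ 2 * (real (Suc n) * real (Suc n) powr (Re (- s) - 2))"
      by simp
    also have "real (Suc n) * real (Suc n) powr (Re (- s) - 2) = real (Suc n) powr (1 + (Re (- s) - 2))"
      by (subst powr_add) (simp del: of_nat_Suc)
    also have "1 + (Re (- s) - 2) = - Re s - 1" by simp
    finally show ?thesis .
  qed
  show "(\<lambda>s. \<Sum>n. e n s) holomorphic_on {s. Re s > 0}"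
    and "Re s > 0 \<Longrightarrow> (\<lambda>n. e n s) sums (\<Sum>n. e n s)"
    using holomorphic_series_Re_pos[OF hol le] by auto
qed

text \<open>Newman's theorem is applied to \<open>b n = psi (n + 1) / (n + 1) - 1\<close>, bounded
  by Chebyshev's estimate. With \<open>s = 1 + z\<close>, its Dirichlet series is
  \<open>(mangoldt_series s - E s) / s - zeta_series s\<close>, in which the poles at
  \<open>s = 1\<close> cancel. The resulting convergence of the series of
  \<open>(psi n / n - 1) / n\<close> gives the claim because \<open>psi\<close> is monotone.\<close>

lemma psi_asymp: "(\<lambda>n. psi n / real n) \<longlonglongrightarrow> 1"
proof -
  define b where "b = (\<lambda>n. complex_of_real (psi (Suc n) / real (Suc n) - 1))"
  have b: "norm (b n) \<le> 7" for n
  proof -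
    have "psi (Suc n) / real (Suc n) \<le> 6" using psi_le[of "Suc n"] by (simp add: divide_le_eq del: of_nat_Suc)
    moreover have "psi (Suc n) / real (Suc n) \<ge> 0" using psi_nonneg by simp
    ultimately show ?thesis unfolding b_def norm_of_real by linarith
  qed
  define E where "E = (\<lambda>s. \<Sum>n. of_real (psi (Suc n)) * (of_nat (Suc n) powr (- s) - of_nat (Suc (Suc n)) powr (- s)
    - s * of_nat (Suc n) powr (- s - 1)) :: complex)"
  have E: "E holomorphic_on {s. Re s > 0}" unfolding E_def by (rule psi_linear_error_series(1))
  \<comment> \<open>The open domain where the logarithmic derivative is holomorphic; it contains the
    closed half-plane Re s \<ge> 1 by \<open>zeta_regular_nonzero\<close>.\<close>
  define T where "T = {s. Re s > 0} \<inter> zeta_regular -` (- {0})"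
  have cz: "continuous_on {s. Re s > 0} zeta_regular"
    by (rule holomorphic_on_imp_continuous_on[OF zeta_regular_holomorphic])
  have T: "open T" "{s. Re s \<ge> 1} \<subseteq> T"
    unfolding T_def using zeta_regular_nonzero
    by (auto intro!: continuous_open_preimage cz open_halfspace_Re_gt)
  have T0: "zeta_regular s \<noteq> 0" "Re s > 0" "s \<noteq> 0" if "s \<in> T" for s using that by (auto simp: T_def)
  have TP: "T \<subseteq> {s. Re s > 0}" by (auto simp: T_def)
  \<comment> \<open>The two polar parts combine to
    \<open>(1 / s - zeta_regular s) / (s - 1)\<close>. The numerator vanishes at 1, so
    \<open>q\<close> is the holomorphic extension of this quotient.\<close>
  define h where "h = (\<lambda>s. 1 / s - zeta_regular s)"
  have h1: "h 1 = 0" by (simp add: h_def zeta_regular_1)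
  have h: "h holomorphic_on T" unfolding h_def
    using T0 by (intro holomorphic_intros holomorphic_on_subset[OF zeta_regular_holomorphic TP]) auto
  define q where "q = (\<lambda>s. if s = 1 then deriv h 1 else (h s - h 1) / (s - 1))"
  have q: "q holomorphic_on T" unfolding q_def by (rule pole_lemma_open[OF h T(1)])
  define G0 where "G0 = (\<lambda>s. (- (deriv zeta_regular s / zeta_regular s) - E s) / s + q s)"
  have G0: "G0 holomorphic_on T" unfolding G0_def
    using T0 by (intro holomorphic_intros q holomorphic_on_subset[OF E TP] holomorphic_on_subset[OF zeta_regular_holomorphic TP]
      holomorphic_on_subset[OF holomorphic_deriv[OF zeta_regular_holomorphic open_halfspace_Re_gt] TP]) auto
  define S where "S = (\<lambda>z. 1 + z) -` T"
  have sums: "(\<lambda>n. b n * of_nat (Suc n) powr (- 1 - z)) sums G0 (1 + z)" if z: "Re z > 0" for z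
  proof -
    define s where "s = 1 + z"
    have s: "Re s > 1" using z by (simp add: s_def)
    have s0: "s \<noteq> 0" "s \<noteq> 1" using s by auto
    have "(\<lambda>n. of_real (psi (Suc n)) * (of_nat (Suc n) powr (- s) - of_nat (Suc (Suc n)) powr (- s)) -
       of_real (psi (Suc n)) * (of_nat (Suc n) powr (- s) - of_nat (Suc (Suc n)) powr (- s)
    - s * of_nat (Suc n) powr (- s - 1))) sums (mangoldt_series s - E s)"
      unfolding E_def using s by (intro sums_diff psi_differences_sums psi_linear_error_series(2)) auto
    then have "(\<lambda>n. s * (of_real (psi (Suc n)) * of_nat (Suc n) powr (- s - 1))) sums (mangoldt_series s - E s)"
      by (simp add: algebra_simps del: of_nat_Suc)
    from sums_divide[OF this, of s] s0
    have "(\<lambda>n. of_real (psi (Suc n)) * of_nat (Suc n) powr (- s - 1)) sums ((mangoldt_series s - E s) / s)"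
      by (simp del: of_nat_Suc)
    from sums_diff[OF this dirichlet_series_sums[of "\<lambda>_. 1", OF _ s]]
    have "(\<lambda>n. of_real (psi (Suc n)) * of_nat (Suc n) powr (- s - 1) - 1 * of_nat (Suc n) powr (- s)) sums
        ((mangoldt_series s - E s) / s - zeta_series s)" by simp
    moreover have "of_real (psi (Suc n)) * of_nat (Suc n) powr (- s - 1) - 1 * of_nat (Suc n) powr (- s) = b n * of_nat (Suc n) powr (- 1 - z)" for n
    proof -
      have ms: "- s = - 1 - z" by (simp add: s_def)
      have e: "of_nat (Suc n) powr (- 1 - z - 1) = (of_nat (Suc n) powr (- 1 - z) / of_nat (Suc n) :: complex)"
        by (subst powr_diff) (simp del: of_nat_Suc)
      show ?thesis unfolding ms e b_def by (simp add: algebra_simps del: of_nat_Suc)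
    qed
    moreover have "(mangoldt_series s - E s) / s - zeta_series s = G0 s"
    proof -
      have "zeta_series s = zeta_regular s / (s - 1)" using zeta_regular_eq[OF s] s0 by simp
      then have "(mangoldt_series s - E s) / s - zeta_series s =
         (1 / (s - 1) - deriv zeta_regular s / zeta_regular s - E s) / s - zeta_regular s / (s - 1)"
        by (simp only: mangoldt_series_eq[OF s])
      also have "\<dots> = (- (deriv zeta_regular s / zeta_regular s) - E s) / s + (1 / s - zeta_regular s) / (s - 1)"
        using s0 by (simp add: add_divide_distrib diff_divide_distrib mult.commute)
      also have "\<dots> = G0 s" using s0 h1 by (simp add: G0_def q_def h_def)
      finally show ?thesis .
    qed
    ultimately show ?thesis by (simp add: s_def)
  qed
  have "(\<lambda>n. b n / of_nat (Suc n)) sums G0 (1 + 0)"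
  proof (rule newman_tauberian[where G = "\<lambda>z. G0 (1 + z)" and S = S])
    show "norm (b n) \<le> 7" for n by (rule b)
    show "open S" unfolding S_def by (intro open_vimage T continuous_intros)
    show "{z. 0 \<le> Re z} \<subseteq> S" unfolding S_def by (auto intro!: subsetD[OF T(2)])
    have "G0 \<circ> (\<lambda>z. 1 + z) holomorphic_on S"
      by (rule holomorphic_on_compose_gen[OF _ G0]) (auto intro!: holomorphic_intros simp: S_def)
    then show "(\<lambda>z. G0 (1 + z)) holomorphic_on S" by (simp add: o_def)
  qed (use sums in auto)
  moreover have "b n / of_nat (Suc n) = of_real ((psi (Suc n) / real (Suc n) - 1) / real (Suc n))" for n
    by (simp add: b_def del: of_nat_Suc)
  ultimately have "(\<lambda>n. of_real ((psi (Suc n) / real (Suc n) - 1) / real (Suc n))) sums G0 (1 + 0)"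
    by (simp only:)
  from sums_Re[OF this] have "(\<lambda>n. (psi (Suc n) / real (Suc n) - 1) / real (Suc n)) sums Re (G0 (1 + 0))"
    by (simp only: Re_complex_of_real)
  then show ?thesis using psi_mono
    by (intro mono_asymp_of_summable) (auto simp: monoI summable_def)
qed

theorem prime_number_theorem: "(\<lambda>n. real (prime_count n) * ln (real n) / real n) \<longlonglongrightarrow> 1"
  by (rule prime_count_asymp_of_psi[OF psi_asymp])

subsection \<open>Labelings of sparse graphs\<close>

definition neighbours :: "nat set set \<Rightarrow> nat \<Rightarrow> nat set" where
  "neighbours E v = {u. {v, u} \<in> E}"

lemma simple_graph_edgeD:
  assumes "simple_graph n E" "{u, v} \<in> E"
  shows "u \<noteq> v" "u < n" "v < n"
  using assms unfolding simple_graph_def by (auto simp: doubleton_eq_iff dest!: subsetD)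

lemma simple_graph_finite:
  assumes "simple_graph n E" shows "finite E"
proof (rule finite_subset)
  show "E \<subseteq> Pow {..<n}" using assms by (auto simp: simple_graph_def dest!: subsetD)
qed simp

lemma card_neighbours_le:
  assumes G: "simple_graph n E" and d: "max_degree_le n E d" and v: "v < n"
  shows "finite (neighbours E v)" "card (neighbours E v) \<le> d"
proof -
  show fin: "finite (neighbours E v)"
    by (rule finite_subset[of _ "{..<n}"]) (use simple_graph_edgeD[OF G] in \<open>auto simp: neighbours_def\<close>)
  have "card (neighbours E v) \<le> card {e \<in> E. v \<in> e}"
  proof (rule card_inj_on_le)
    show "inj_on (\<lambda>u. {v, u}) (neighbours E v)" by (auto simp: inj_on_def doubleton_eq_iff)
    show "(\<lambda>u. {v, u}) ` neighbours E v \<subseteq> {e \<in> E. v \<in> e}" by (auto simp: neighbours_def)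
    show "finite {e \<in> E. v \<in> e}" using simple_graph_finite[OF G] by simp
  qed
  then show "card (neighbours E v) \<le> d"
    using d v unfolding max_degree_le_def Defs.degree_def by fastforce
qed

definition product_injective_on :: "nat set set \<Rightarrow> nat set \<Rightarrow> (nat \<Rightarrow> nat) \<Rightarrow> bool" where
  "product_injective_on E S lab \<longleftrightarrow> inj_on lab S \<and>
     (\<forall>u\<in>S. \<forall>v\<in>S. \<forall>x\<in>S. \<forall>y\<in>S. {u, v} \<in> E \<longrightarrow> {x, y} \<in> E \<longrightarrow> {u, v} \<noteq> {x, y}
        \<longrightarrow> lab u * lab v \<noteq> lab x * lab y)"

definition partial_labelings :: "nat \<Rightarrow> nat set set \<Rightarrow> nat set \<Rightarrow> (nat \<Rightarrow> nat) set" where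
  "partial_labelings N E S = {lab \<in> S \<rightarrow>\<^sub>E {1..N}. product_injective_on E S lab}"

text \<open>Its cardinality is the multiplicative energy of [N]. In a conflict \<open>e\<close> is
  the label of the new vertex, and \<open>a\<close>, \<open>b\<close>, \<open>c\<close> are labels
  of three old ones.\<close>

definition product_quadruples :: "nat \<Rightarrow> (nat \<times> nat \<times> nat \<times> nat) set" where
  "product_quadruples N = {(a, b, c, e). a \<in> {1..N} \<and> b \<in> {1..N} \<and> c \<in> {1..N} \<and> e \<in> {1..N} \<and> e * a = b * c}"

abbreviation "product_energy N \<equiv> real (card (product_quadruples N))"

lemma finite_partial_labelings: "finite S \<Longrightarrow> finite (partial_labelings N E S)"
  unfolding partial_labelings_def by (rule finite_subset[of _ "S \<rightarrow>\<^sub>E {1..N}"]) (auto intro: finite_PiE)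

lemma finite_product_quadruples: "finite (product_quadruples N)"
  by (rule finite_subset[of _ "{1..N} \<times> {1..N} \<times> {1..N} \<times> {1..N}"]) (auto simp: product_quadruples_def)

text \<open>A conflict must use the new vertex \<open>v\<close>. Two edges at \<open>v\<close>
  cannot conflict, since \<open>c\<close> cancels and \<open>lab\<close> is injective; nor can
  \<open>u\<close> lie on the other edge, since cancelling \<open>lab u\<close> would make
  \<open>c\<close> an old label. Thus three distinct old vertices are involved, which can be removed
  together in the count.\<close>

lemma extension_conflict:
  assumes G: "simple_graph n E" and v: "v \<notin> S"
    and lab: "lab \<in> partial_labelings N E S" and c: "c \<in> {1..N}" "c \<notin> lab ` S"
    and bad: "lab(v := c) \<notin> partial_labelings N E (insert v S)"
  shows "\<exists>u\<in>S. \<exists>x\<in>S. \<exists>y\<in>S. u \<noteq> x \<and> u \<noteq> y \<and> x \<noteq> y \<and> {v, u} \<in> E \<and> {x, y} \<in> E \<and> c * lab u = lab x * lab y"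
proof -
  let ?l = "lab(v := c)"
  have L: "lab \<in> S \<rightarrow>\<^sub>E {1..N}" "inj_on lab S"
    "\<And>u w x y. \<lbrakk>u\<in>S; w\<in>S; x\<in>S; y\<in>S; {u, w} \<in> E; {x, y} \<in> E; {u, w} \<noteq> {x, y}\<rbrakk> \<Longrightarrow> lab u * lab w \<noteq> lab x * lab y"
    using lab by (auto simp: partial_labelings_def product_injective_on_def)
  have pos: "lab u > 0" if "u \<in> S" for u using L(1) that by (force simp: PiE_iff)
  have "?l \<in> insert v S \<rightarrow>\<^sub>E {1..N}" using L(1) c by (auto simp: PiE_iff extensional_def)
  moreover have inj: "inj_on ?l (insert v S)" using L(2) c v by (auto simp: inj_on_def)
  ultimately have "\<exists>a\<in>insert v S. \<exists>b\<in>insert v S. \<exists>x\<in>insert v S. \<exists>y\<in>insert v S.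
     {a, b} \<in> E \<and> {x, y} \<in> E \<and> {a, b} \<noteq> {x, y} \<and> ?l a * ?l b = ?l x * ?l y"
    using bad unfolding partial_labelings_def product_injective_on_def by blast
  then obtain a b x y where ab: "a \<in> insert v S" "b \<in> insert v S" "x \<in> insert v S" "y \<in> insert v S"
    "{a, b} \<in> E" "{x, y} \<in> E" "{a, b} \<noteq> {x, y}" "?l a * ?l b = ?l x * ?l y" by blast
  have key: ?thesis
    if h: "u \<in> insert v S" "x \<in> insert v S" "y \<in> insert v S" "{v, u} \<in> E" "{x, y} \<in> E" "{v, u} \<noteq> {x, y}"
     "c * ?l u = ?l x * ?l y" for u x y
  proof -
    have u: "u \<in> S" "u \<noteq> v" using h simple_graph_edgeD[OF G h(4)] by auto
    have vx: False if "z \<in> insert v S" "{v, z} \<in> E" "{v, u} \<noteq> {v, z}" "c * ?l u = c * ?l z" for z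
    proof -
      have "?l u = ?l z" using that(4) c(1) by simp
      then have "u = z" using inj_onD[OF inj _ h(1) that(1)] by blast
      then show False using that(3) by simp
    qed
    have "x \<noteq> v" using vx[OF h(3)] h(5-7) by (metis fun_upd_same)
    moreover have "y \<noteq> v" using vx[OF h(2)] h(5-7) by (metis fun_upd_same insert_commute mult.commute)
    ultimately have x: "x \<in> S" "x \<noteq> v" and y: "y \<in> S" "y \<noteq> v" using h by auto
    have eq: "c * lab u = lab x * lab y" using h(7) u x y by simp
    have "u \<noteq> x" using eq pos[OF x(1)] c(2) y(1) by (auto simp: mult.commute)
    moreover have "u \<noteq> y" using eq pos[OF y(1)] c(2) x(1) by (auto simp: mult.commute)
    ultimately show ?thesis using u x y eq h simple_graph_edgeD[OF G h(5)] by blast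
  qed
  consider "v \<notin> {a, b, x, y}" | "v = a" | "v = b" | "v = x" | "v = y" by auto
  then show ?thesis
  proof cases
    case 1 then show ?thesis using L(3)[of a b x y] ab by auto
  next
    case 2 then show ?thesis using key[of b x y] ab by auto
  next
    case 3 then show ?thesis using key[of a x y] ab by (auto simp: insert_commute mult.commute)
  next
    case 4 then show ?thesis using key[of y a b] ab by auto
  next
    case 5
    then have "{v, x} \<in> E" "{v, x} \<noteq> {a, b}" "c * ?l x = ?l a * ?l b"
      using ab by (auto simp: insert_commute mult.commute)
    then show ?thesis using key[of x a b] ab by auto
  qed
qed

lemma card_extensions_ge:
  assumes G: "simple_graph n E" and d: "max_degree_le n E d" and S: "S \<subseteq> {..<n}" and v: "v < n" "v \<notin> S"
    and B: "\<And>u x y. \<lbrakk>u \<in> S; x \<in> S; y \<in> S; u \<noteq> x; u \<noteq> y; x \<noteq> y\<rbrakk>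
        \<Longrightarrow> real (card (partial_labelings N E (S - {u, x, y}))) \<le> B" and B0: "B \<ge> 0"
  shows "(real N - real (card S)) * real (card (partial_labelings N E S))
    \<le> real (card (partial_labelings N E (insert v S))) + real n * real d ^ 2 * (product_energy N * B)"
proof -
  let ?P = "partial_labelings N E"
  have fS: "finite S" using S finite_subset by blast
  define X where "X = Sigma (?P S) (\<lambda>lab. {1..N} - lab ` S)"
  define A where "A = {(lab, c) \<in> X. lab(v := c) \<in> ?P (insert v S)}"
  \<comment> \<open>At most \<open>d\<close> choices of \<open>u\<close> and \<open>n * d\<close>
    ordered edges \<open>(x, y)\<close>, hence the factor \<open>n * d^2\<close>.\<close>
  define W where "W = {(u, x, y). u \<in> S \<and> x \<in> S \<and> y \<in> S \<and> u \<noteq> x \<and> u \<noteq> y \<and> x \<noteq> y \<and> {v, u} \<in> E \<and> {x, y} \<in> E}"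
  define C where "C = (\<lambda>(u, x, y). {(lab, c) \<in> X. c * lab u = lab x * lab y})"
  have fX: "finite X" unfolding X_def using finite_partial_labelings[OF fS] by auto
  have "card X = (\<Sum>lab\<in>?P S. card ({1..N} - lab ` S))"
    unfolding X_def by (rule card_SigmaI) (auto simp: finite_partial_labelings fS)
  also have "\<dots> = (\<Sum>lab\<in>?P S. N - card S)"
  proof (rule sum.cong[OF refl])
    fix lab assume "lab \<in> ?P S"
    then have "lab ` S \<subseteq> {1..N}" "inj_on lab S"
      by (auto simp: partial_labelings_def product_injective_on_def PiE_iff)
    then show "card ({1..N} - lab ` S) = N - card S"
      using fS by (subst card_Diff_subset) (auto simp: card_image)
  qed
  finally have cX: "card X = card (?P S) * (N - card S)" by simp
  have XA: "X \<subseteq> A \<union> (\<Union>w\<in>W. C w)"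
  proof
    fix z assume z: "z \<in> X"
    then obtain lab c where lc: "z = (lab, c)" "lab \<in> ?P S" "c \<in> {1..N}" "c \<notin> lab ` S" by (auto simp: X_def)
    show "z \<in> A \<union> (\<Union>w\<in>W. C w)"
    proof (cases "lab(v := c) \<in> ?P (insert v S)")
      case True then show ?thesis using z lc by (auto simp: A_def)
    next
      case False
      from extension_conflict[OF G v(2) lc(2-4) False] show ?thesis
        using z lc unfolding W_def C_def by blast
    qed
  qed
  have cA: "card A \<le> card (?P (insert v S))"
  proof (rule card_inj_on_le[where f = "\<lambda>(lab, c). lab(v := c)"])
    show "inj_on (\<lambda>(lab, c). lab(v := c)) A"
    proof (rule inj_onI, clarify)
      fix l c l' c' assume a: "(l, c) \<in> A" "(l', c') \<in> A" "l(v := c) = l'(v := c')"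
      have "l v = undefined" "l' v = undefined"
        using a v by (auto simp: A_def X_def partial_labelings_def PiE_iff extensional_def)
      then show "l = l' \<and> c = c'" using a(3) by (metis fun_upd_eqD fun_upd_triv fun_upd_upd)
    qed
    show "finite (?P (insert v S))" using fS by (simp add: finite_partial_labelings)
  qed (auto simp: A_def)
  have cC: "real (card (C w)) \<le> product_energy N * B" if wW: "w \<in> W" for w
  proof -
    obtain u x y where w: "w = (u, x, y)" "u \<in> S" "x \<in> S" "y \<in> S" "u \<noteq> x" "u \<noteq> y" "x \<noteq> y"
      using wW by (auto simp: W_def)
    let ?T = "S - {u, x, y}"
    have "card (C w) \<le> card (?P ?T \<times> product_quadruples N)"
    proof (rule card_inj_on_le[where f = "\<lambda>(lab, c). (restrict lab ?T, (lab u, lab x, lab y, c))"])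
      show "inj_on (\<lambda>(lab, c). (restrict lab ?T, (lab u, lab x, lab y, c))) (C w)"
      proof (rule inj_onI)
        fix p p' assume p: "p \<in> C w" "p' \<in> C w" "(case p of (lab, c) \<Rightarrow> (restrict lab ?T, (lab u, lab x, lab y, c))) =
          (case p' of (lab, c) \<Rightarrow> (restrict lab ?T, (lab u, lab x, lab y, c)))"
        obtain l c l' c' where pp: "p = (l, c)" "p' = (l', c')" by (metis prod.exhaust)
        have a: "restrict l ?T = restrict l' ?T" "l u = l' u" "l x = l' x" "l y = l' y" "c = c'"
          using p(3) unfolding pp by simp_all
        have ext: "l \<in> extensional S" "l' \<in> extensional S"
          using p(1,2) by (auto simp: pp C_def w X_def partial_labelings_def PiE_iff)
        have "l z = l' z" for z
        proof -
          have "restrict l ?T z = restrict l' ?T z" using a(1) by simp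
          then show "l z = l' z"
            using a(2-4) ext by (cases "z \<in> {u, x, y}"; cases "z \<in> S") (auto simp: extensional_def)
        qed
        then show "p = p'" using a(5) pp by auto
      qed
      show "(\<lambda>(lab, c). (restrict lab ?T, (lab u, lab x, lab y, c))) ` C w \<subseteq> ?P ?T \<times> product_quadruples N"
      proof safe
        fix l c assume a: "(l, c) \<in> C w"
        then have l: "l \<in> ?P S" "c \<in> {1..N}" "c * l u = l x * l y" by (auto simp: C_def w X_def)
        have "l z \<in> {1..N}" if "z \<in> S" for z using l(1) that by (auto simp: partial_labelings_def PiE_iff)
        then show "(l u, l x, l y, c) \<in> product_quadruples N"
          using l w by (auto simp: product_quadruples_def)
        show "restrict l ?T \<in> ?P ?T"
          using l(1) by (auto simp: partial_labelings_def product_injective_on_def PiE_iff inj_on_def)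
      qed
      show "finite (?P ?T \<times> product_quadruples N)"
        using fS by (simp add: finite_partial_labelings finite_product_quadruples)
    qed
    then have "real (card (C w)) \<le> product_energy N * real (card (?P ?T))"
      by (metis card_cartesian_product mult.commute of_nat_le_iff of_nat_mult)
    also have "\<dots> \<le> product_energy N * B"
      using B[OF w(2-7)] by (intro mult_left_mono) auto
    finally show ?thesis .
  qed
  let ?NN = "Sigma {..<n} (neighbours E)"
  have fNN: "finite ?NN" using card_neighbours_le(1)[OF G d] by auto
  have WN: "W \<subseteq> neighbours E v \<times> ?NN"
    using S by (auto simp: W_def neighbours_def)
  have fW: "finite W" using WN card_neighbours_le(1)[OF G d v(1)] fNN finite_subset by blast
  have "card ?NN = (\<Sum>x<n. card (neighbours E x))"
    using card_neighbours_le(1)[OF G d] by (intro card_SigmaI) auto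
  also have "\<dots> \<le> (\<Sum>x<n. d)" using card_neighbours_le(2)[OF G d] by (intro sum_mono) auto
  finally have "card ?NN \<le> n * d" by simp
  then have "card W \<le> d * (n * d)"
    using card_mono[OF _ WN] card_neighbours_le[OF G d v(1)] fNN
    by (simp add: card_cartesian_product) (meson le_trans mult_le_mono)
  then have "real (card W) \<le> real (d * (n * d))" by (simp only: of_nat_le_iff)
  then have cW: "real (card W) \<le> real n * real d ^ 2" by (simp add: power2_eq_square mult_ac)
  have fC: "finite (C w)" for w using fX by (cases w) (auto simp: C_def intro: finite_subset[of _ X])
  have "card X \<le> card (A \<union> (\<Union>w\<in>W. C w))"
    using XA fX fC fW by (intro card_mono) (auto simp: A_def intro: finite_subset[of _ X])
  also have "\<dots> \<le> card A + (\<Sum>w\<in>W. card (C w))"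
    using card_Un_le[of A "\<Union>w\<in>W. C w"] card_UN_le[OF fW, of C] by linarith
  finally have "real (card X) \<le> real (card A) + (\<Sum>w\<in>W. real (card (C w)))"
    by (metis of_nat_add of_nat_le_iff of_nat_sum)
  also have "\<dots> \<le> real (card (?P (insert v S))) + (\<Sum>w\<in>W. product_energy N * B)"
    using cA cC by (intro add_mono sum_mono) auto
  also have "(\<Sum>w\<in>W. product_energy N * B) = real (card W) * (product_energy N * B)"
    by simp
  also have "\<dots> \<le> real n * real d ^ 2 * (product_energy N * B)"
    using cW B0 by (intro mult_right_mono) auto
  finally have "real (card X) \<le> real (card (?P (insert v S))) + real n * real d ^ 2 * (product_energy N * B)"
    by simp
  moreover have "(real N - real (card S)) * real (card (?P S)) \<le> real (card X)"
    unfolding cX of_nat_mult by (subst mult.commute, intro mult_left_mono) linarith+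
  ultimately show ?thesis by linarith
qed

text \<open>Rosenfeld's counting argument: by induction each further vertex multiplies the number of
  valid partial labelings by at least \<open>\<kappa>\<close>, because removing the three other vertices of a
  conflict costs at most a factor \<open>\<kappa> ^ 3\<close>.\<close>

lemma card_partial_labelings_growth:
  fixes \<kappa> :: real
  assumes G: "simple_graph n E" and d: "max_degree_le n E d" and \<kappa>: "\<kappa> > 0"
    and N: "real N - real n - real n * real d ^ 2 * product_energy N / \<kappa> ^ 3 \<ge> \<kappa>"
    and S: "S \<subseteq> {..<n}" and v: "v < n" "v \<notin> S"
  shows "\<kappa> * real (card (partial_labelings N E S)) \<le> real (card (partial_labelings N E (insert v S)))"
  using S v
proof (induction "card S" arbitrary: S v rule: less_induct)
  case less
  let ?P = "partial_labelings N E"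
  let ?g = "\<lambda>S. real (card (?P S))"
  have fS: "finite S" using less.prems(1) finite_subset by blast
  have "?g (S - {u, x, y}) \<le> ?g S / \<kappa> ^ 3"
    if h: "u \<in> S" "x \<in> S" "y \<in> S" "u \<noteq> x" "u \<noteq> y" "x \<noteq> y" for u x y
  proof -
    have step: "\<kappa> * ?g T \<le> ?g (insert w T)" if "insert w T \<subseteq> S" "w \<notin> T" for w T
    proof (rule less.hyps)
      show "card T < card S" using that fS by (intro psubset_card_mono) auto
    qed (use that less.prems in auto)
    have e: "insert u (S - {u, x, y}) = S - {x, y}" "insert x (S - {x, y}) = S - {y}" "insert y (S - {y}) = S"
      using h by auto
    have "\<kappa> * ?g (S - {u, x, y}) \<le> ?g (S - {x, y})"
      using step[of u "S - {u, x, y}"] h by (simp add: e)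
    then have "\<kappa> * (\<kappa> * ?g (S - {u, x, y})) \<le> \<kappa> * ?g (S - {x, y})" using \<kappa> by simp
    also have "\<dots> \<le> ?g (S - {y})"
      using step[of x "S - {x, y}"] h by (simp add: e)
    finally have "\<kappa> * (\<kappa> * (\<kappa> * ?g (S - {u, x, y}))) \<le> \<kappa> * ?g (S - {y})" using \<kappa> by simp
    also have "\<dots> \<le> ?g S"
      using step[of y "S - {y}"] h by (simp add: e insert_absorb)
    finally show ?thesis using \<kappa> by (simp add: field_simps power3_eq_cube)
  qed
  from card_extensions_ge[OF G d less.prems this]
  have "(real N - real (card S)) * ?g S \<le> ?g (insert v S) + real n * real d ^ 2 * (product_energy N * (?g S / \<kappa> ^ 3))"
    using \<kappa> by simp
  moreover have "card S \<le> n" using card_mono[OF _ less.prems(1)] by simp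
  then have "(real N - real n) * ?g S \<le> (real N - real (card S)) * ?g S" by (intro mult_right_mono) auto
  moreover have "\<kappa> * ?g S \<le> (real N - real n - real n * real d ^ 2 * product_energy N / \<kappa> ^ 3) * ?g S"
    using N by (intro mult_right_mono) auto
  ultimately show ?case by (simp add: algebra_simps)
qed

lemma partial_labelings_nonempty:
  fixes \<kappa> :: real
  assumes G: "simple_graph n E" and d: "max_degree_le n E d" and \<kappa>: "\<kappa> > 0"
    and N: "real N - real n - real n * real d ^ 2 * product_energy N / \<kappa> ^ 3 \<ge> \<kappa>"
  shows "partial_labelings N E {..<n} \<noteq> {}"
proof -
  have "m \<le> n \<Longrightarrow> real (card (partial_labelings N E {..<m})) \<ge> \<kappa> ^ m" for m
  proof (induction m)
    case 0
    have "partial_labelings N E {..<0} = {\<lambda>_. undefined}"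
      by (auto simp: partial_labelings_def product_injective_on_def)
    then show ?case by simp
  next
    case (Suc m)
    have "\<kappa> ^ Suc m \<le> \<kappa> * real (card (partial_labelings N E {..<m}))" using Suc \<kappa> by simp
    also have "\<dots> \<le> real (card (partial_labelings N E (insert m {..<m})))"
      using Suc.prems by (intro card_partial_labelings_growth[OF G d \<kappa> N]) auto
    finally show ?case by (simp add: lessThan_Suc)
  qed
  from this[of n] \<kappa> have "card (partial_labelings N E {..<n}) \<noteq> 0"
    by (metis le_refl not_le of_nat_0 zero_less_power)
  then show ?thesis by auto
qed

definition valid_labeling :: "nat \<Rightarrow> nat \<Rightarrow> nat set set \<Rightarrow> (nat \<Rightarrow> nat) \<Rightarrow> bool" where
  "valid_labeling n N E lab \<longleftrightarrow> inj_on lab {..<n} \<and> lab ` {..<n} \<subseteq> {1..N} \<and>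
     (\<forall>u v x y. {u, v} \<in> E \<longrightarrow> {x, y} \<in> E \<longrightarrow> {u, v} \<noteq> {x, y} \<longrightarrow> lab u * lab v \<noteq> lab x * lab y)"

lemma valid_labeling_int:
  assumes "valid_labeling n N E lab"
  shows "product_injective_labeling n E (\<lambda>v. int (lab v))" "(\<lambda>v. int (lab v)) ` {0..<n} \<subseteq> {1..int N}"
proof -
  show "product_injective_labeling n E (\<lambda>v. int (lab v))"
    using assms unfolding valid_labeling_def product_injective_labeling_def of_nat_mult[symmetric] of_nat_eq_iff
    by (auto simp: inj_on_def)
  show "(\<lambda>v. int (lab v)) ` {0..<n} \<subseteq> {1..int N}"
    using assms unfolding valid_labeling_def by force
qed

lemma P_graph_le:
  assumes "valid_labeling n N E lab" "N > 0"
  shows "P_graph n E \<le> N"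
  unfolding P_graph_def using assms(2) valid_labeling_int[OF assms(1)] by (intro Least_le) blast

lemma P_graph_le_of_quadruples:
  fixes \<kappa> :: real
  assumes G: "simple_graph n E" and d: "max_degree_le n E d" and \<kappa>: "\<kappa> > 0"
    and N: "real N - real n - real n * real d ^ 2 * product_energy N / \<kappa> ^ 3 \<ge> \<kappa>"
  shows "P_graph n E \<le> N"
proof -
  obtain lab where lab: "lab \<in> partial_labelings N E {..<n}"
    using partial_labelings_nonempty[OF assms] by blast
  have "N > 0"
  proof (rule ccontr)
    assume "\<not> N > 0"
    moreover have "0 \<le> real n * real d ^ 2 * product_energy N / \<kappa> ^ 3"
      using \<kappa> by simp
    ultimately show False using N \<kappa> by linarith
  qed
  moreover have "valid_labeling n N E lab"
    using lab simple_graph_edgeD[OF G]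
    by (auto simp: valid_labeling_def partial_labelings_def product_injective_on_def PiE_iff)
  ultimately show ?thesis by (rule P_graph_le[rotated])
qed

section \<open>The multiplicative energy of an initial segment\<close>

lemma harm_le_ln: "n \<ge> 1 \<Longrightarrow> (\<Sum>k=1..n. 1 / real k) \<le> 1 + ln (real n)"
proof (induction n rule: nat_induct_at_least)
  case (Suc n)
  have "ln (real n) - ln (real (Suc n)) \<le> (real n - real (Suc n)) / real (Suc n)"
    using Suc by (intro ln_diff_le) auto
  then have "1 / real (Suc n) \<le> ln (real (Suc n)) - ln (real n)" by (simp add: field_simps)
  then show ?case using Suc by simp
qed simp

lemma card_hyperbola_le:
  assumes "N \<ge> 1"
  shows "finite {(a, b). 1 \<le> a \<and> 1 \<le> b \<and> a * b \<le> (N::nat)}"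
    and "real (card {(a, b). 1 \<le> a \<and> 1 \<le> b \<and> a * b \<le> N}) \<le> real N * (1 + ln N)"
proof -
  have eq: "{(a, b). 1 \<le> a \<and> 1 \<le> b \<and> a * b \<le> N} = Sigma {1..N} (\<lambda>a. {1..N div a})"
  proof safe
    fix a b assume "1 \<le> a" "1 \<le> b" "a * b \<le> N"
    moreover have "a * 1 \<le> a * b" using \<open>1 \<le> b\<close> by (rule mult_le_mono2)
    moreover from calculation have "a \<le> N" by linarith
    ultimately show "a \<in> {1..N}" "b \<in> {1..N div a}" by (auto simp: less_eq_div_iff_mult_less_eq mult.commute)
  qed (auto simp: less_eq_div_iff_mult_less_eq mult.commute)
  show "finite {(a, b). 1 \<le> a \<and> 1 \<le> b \<and> a * b \<le> (N::nat)}" unfolding eq by auto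
  have "card {(a, b). 1 \<le> a \<and> 1 \<le> b \<and> a * b \<le> N} = (\<Sum>a=1..N. N div a)"
    unfolding eq by (subst card_SigmaI) auto
  then have "real (card {(a, b). 1 \<le> a \<and> 1 \<le> b \<and> a * b \<le> N}) = (\<Sum>a=1..N. real (N div a))" by simp
  also have "\<dots> \<le> (\<Sum>a=1..N. real N * (1 / real a))"
  proof (rule sum_mono)
    fix a
    show "real (N div a) \<le> real N * (1 / real a)"
      using of_int_floor_le[of "real N / real a"] by (simp add: floor_divide_of_nat_eq)
  qed
  also have "\<dots> = real N * (\<Sum>a=1..N. 1 / real a)" by (simp add: sum_distrib_left)
  also have "\<dots> \<le> real N * (1 + ln N)" using harm_le_ln[OF assms] by (intro mult_left_mono) auto
  finally show "real (card {(a, b). 1 \<le> a \<and> 1 \<le> b \<and> a * b \<le> N}) \<le> real N * (1 + ln N)" .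
qed

text \<open>With \<open>g = gcd a b\<close> and \<open>h = a div g\<close>, coprimality of
  \<open>h\<close> and \<open>b div g\<close> gives \<open>h dvd c\<close>. So
  \<open>a = g * h\<close>, \<open>b = g * b'\<close>, \<open>c = h * c'\<close>, and
  \<open>e\<close> is determined. Both \<open>(g, b')\<close> and \<open>(h, c')\<close> lie under
  the hyperbola of area about \<open>N * ln N\<close>.\<close>

lemma card_product_quadruples_le:
  assumes N: "N \<ge> 1"
  shows "product_energy N \<le> (real N * (1 + ln N)) ^ 2"
proof -
  let ?H = "{(a, b). 1 \<le> a \<and> 1 \<le> b \<and> a * b \<le> N}"
  define f where "f = (\<lambda>(a, b, c, e :: nat). ((gcd a b, b div gcd a b), (a div gcd a b, c div (a div gcd a (b::nat)))))"
  have key: "\<exists>g b' h c'. g \<ge> 1 \<and> h \<ge> 1 \<and> f (a, b, c, e) = ((g, b'), (h, c')) \<and> b = g * b' \<and> c = h * c' \<and> a = g * h"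
    if "(a, b, c, e) \<in> product_quadruples N" for a b c e
  proof -
    have p: "a \<ge> 1" "b \<ge> 1" "e * a = b * c" using that by (auto simp: product_quadruples_def)
    define g where "g = gcd a b"
    have g: "g \<ge> 1" using p by (simp add: g_def Suc_leI)
    have ab: "a = g * (a div g)" "b = g * (b div g)" by (auto simp: g_def)
    have h: "a div g \<ge> 1" using p ab by (metis One_nat_def Suc_leI gr0I mult_0_right not_one_le_zero)
    have "g * (e * (a div g)) = g * ((b div g) * c)" using p(3) ab by (metis mult.assoc mult.left_commute)
    then have "e * (a div g) = (b div g) * c" using g by simp
    then have "(a div g) dvd (b div g) * c" by (metis dvd_triv_right)
    moreover have "coprime (a div g) (b div g)" unfolding g_def using p by (intro div_gcd_coprime) auto
    ultimately have "(a div g) dvd c" by (simp add: coprime_dvd_mult_right_iff)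
    then have "c = (a div g) * (c div (a div g))" by simp
    then show ?thesis using g h ab unfolding f_def g_def[symmetric] by (intro exI conjI) (auto simp: g_def)
  qed
  have "card (product_quadruples N) \<le> card (?H \<times> ?H)"
  proof (rule card_inj_on_le[where f = f])
    show "inj_on f (product_quadruples N)"
    proof (rule inj_onI)
      fix z z' assume z: "z \<in> product_quadruples N" "z' \<in> product_quadruples N" "f z = f z'"
      obtain a b c e a' b' c' e' where zz: "z = (a, b, c, e)" "z' = (a', b', c', e')" by (metis prod_cases4)
      have eq: "a = a'" "b = b'" "c = c'" using key[of a b c e] key[of a' b' c' e'] z unfolding zz by auto
      have "e * a = b * c" "e' * a' = b' * c'" and a: "a \<ge> 1" using z by (auto simp: zz product_quadruples_def)
      then have "e * a = e' * a" using eq by simp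
      then show "z = z'" unfolding zz using eq a by simp
    qed
    show "f ` product_quadruples N \<subseteq> ?H \<times> ?H"
    proof
      fix w assume "w \<in> f ` product_quadruples N"
      then obtain a b c e where z: "(a, b, c, e) \<in> product_quadruples N" "w = f (a, b, c, e)" by auto
      then obtain g b' h c' where k: "g \<ge> 1" "h \<ge> 1" "w = ((g, b'), (h, c'))" "b = g * b'" "c = h * c'"
        using key by metis
      moreover have "b \<in> {1..N}" "c \<in> {1..N}" using z by (auto simp: product_quadruples_def)
      ultimately show "w \<in> ?H \<times> ?H" by (auto intro!: Suc_leI Nat.gr0I)
    qed
    show "finite (?H \<times> ?H)" using card_hyperbola_le(1)[OF N] by auto
  qed
  then have "card (product_quadruples N) \<le> card ?H ^ 2" by (simp add: card_cartesian_product power2_eq_square)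
  then have "product_energy N \<le> real (card ?H ^ 2)" by (simp only: of_nat_le_iff)
  then have "product_energy N \<le> real (card ?H) ^ 2" by (simp only: of_nat_power)
  also have "\<dots> \<le> (real N * (1 + ln N)) ^ 2" using card_hyperbola_le(2)[OF N] by (intro power_mono) auto
  finally show ?thesis .
qed

subsection \<open>Rectangles and random graphs\<close>

definition ordered_pairs :: "nat set \<Rightarrow> (nat \<times> nat) set" where
  "ordered_pairs D = {(a, b). a \<in> D \<and> b \<in> D \<and> a < b}"

lemma finite_ordered_pairs: "finite D \<Longrightarrow> finite (ordered_pairs D)"
  unfolding ordered_pairs_def by (rule finite_subset[of _ "D \<times> D"]) auto

lemma card_ordered_pairs:
  assumes "finite D"
  shows "2 * real (card (ordered_pairs D)) = real (card D) ^ 2 - real (card D)"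
  using assms
proof (induction D rule: finite_linorder_max_induct)
  case empty then show ?case by (simp add: ordered_pairs_def)
next
  case (insert b A)
  have "b \<notin> A" using insert by auto
  have "ordered_pairs (insert b A) = ordered_pairs A \<union> A \<times> {b}"
    using insert by (auto simp: ordered_pairs_def)
  moreover have "ordered_pairs A \<inter> A \<times> {b} = {}" using \<open>b \<notin> A\<close> by (auto simp: ordered_pairs_def)
  ultimately have "card (ordered_pairs (insert b A)) = card (ordered_pairs A) + card A"
    using insert finite_ordered_pairs by (simp add: card_Un_disjoint card_cartesian_product)
  then show ?case using insert \<open>b \<notin> A\<close> by (simp add: power2_eq_square algebra_simps)
qed

definition rectangles :: "(nat \<times> nat) set \<Rightarrow> ((nat \<times> nat) \<times> (nat \<times> nat)) set" where
  "rectangles B = {((u, u'), (v, v')). u < u' \<and> v < v' \<and> (u, v) \<in> B \<and> (u', v) \<in> B \<and> (u, v') \<in> B \<and> (u', v') \<in> B}"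

lemma finite_rectangles:
  assumes "finite B" shows "finite (rectangles B)"
proof (rule finite_subset)
  show "rectangles B \<subseteq> (fst ` B \<times> fst ` B) \<times> (snd ` B \<times> snd ` B)" by (force simp: rectangles_def)
qed (use assms in auto)

lemma sum_square_le_card_mult:
  fixes f :: "'a \<Rightarrow> real"
  shows "(\<Sum>i\<in>I. f i) ^ 2 \<le> real (card I) * (\<Sum>i\<in>I. (f i) ^ 2)"
  using Cauchy_Schwarz_ineq_sum[of "\<lambda>_. 1" f I] by simp

text \<open>\<open>Q\<close> counts paths of length two through \<open>Y\<close>, so it is also the
  sum of the codegrees \<open>card (C p)\<close> over the pairs \<open>p\<close> in
  \<open>X\<close>. Rectangles number half of the sum of squared codegrees minus \<open>Q\<close>,
  and Cauchy-Schwarz over at most \<open>card X ^ 2\<close> pairs bounds the squares; the lower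
  bound on \<open>Q\<close> absorbs the linear term.\<close>

lemma rectangles_ge:
  fixes X Y :: "nat set"
  assumes X: "finite X" and Y: "finite Y" and B: "B \<subseteq> X \<times> Y"
  defines "Q \<equiv> (\<Sum>v\<in>Y. real (card (ordered_pairs {u\<in>X. (u, v) \<in> B})))"
  assumes Q: "Q \<ge> 2 * real (card X) ^ 2"
  shows "Q ^ 2 \<le> 4 * real (card X) ^ 2 * real (card (rectangles B))"
proof -
  let ?P = "ordered_pairs X"
  define C where "C = (\<lambda>(u, u'). {v\<in>Y. (u, v) \<in> B \<and> (u', v) \<in> B})"
  have fP: "finite ?P" using X by (rule finite_ordered_pairs)
  have fC: "finite (C p)" for p using Y by (cases p) (auto simp: C_def)
  have "Sigma Y (\<lambda>v. ordered_pairs {u\<in>X. (u, v) \<in> B}) = (\<lambda>(p, v). (v, p)) ` Sigma ?P C"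
    by (force simp: ordered_pairs_def C_def)
  then have "card (Sigma Y (\<lambda>v. ordered_pairs {u\<in>X. (u, v) \<in> B})) = card (Sigma ?P C)"
    by (simp add: card_image inj_on_def)
  moreover have "card (Sigma Y (\<lambda>v. ordered_pairs {u\<in>X. (u, v) \<in> B})) = (\<Sum>v\<in>Y. card (ordered_pairs {u\<in>X. (u, v) \<in> B}))"
    using X Y by (intro card_SigmaI) (auto intro: finite_ordered_pairs)
  moreover have "card (Sigma ?P C) = (\<Sum>p\<in>?P. card (C p))"
    using fP fC by (intro card_SigmaI) auto
  ultimately have QC: "Q = (\<Sum>p\<in>?P. real (card (C p)))" by (simp add: Q_def flip: of_nat_sum)
  have "rectangles B = Sigma ?P (\<lambda>p. ordered_pairs (C p))"
    using B by (auto simp: rectangles_def ordered_pairs_def C_def)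
  then have "card (rectangles B) = (\<Sum>p\<in>?P. card (ordered_pairs (C p)))"
    using fP fC by (simp add: card_SigmaI finite_ordered_pairs)
  then have "2 * real (card (rectangles B)) = (\<Sum>p\<in>?P. 2 * real (card (ordered_pairs (C p))))"
    by (simp add: sum_distrib_left)
  also have "\<dots> = (\<Sum>p\<in>?P. real (card (C p)) ^ 2) - Q"
    unfolding QC by (simp add: card_ordered_pairs[OF fC] sum_subtractf)
  finally have r: "2 * real (card (rectangles B)) = (\<Sum>p\<in>?P. real (card (C p)) ^ 2) - Q" .
  have "2 * real (card ?P) \<le> 2 * real (card X) ^ 2"
    using card_ordered_pairs[OF X] by (simp add: power2_eq_square)
  then have cP: "real (card ?P) \<le> real (card X) ^ 2" by simp
  have "Q ^ 2 \<le> real (card ?P) * (\<Sum>p\<in>?P. real (card (C p)) ^ 2)"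
    unfolding QC by (rule sum_square_le_card_mult)
  also have "\<dots> \<le> real (card X) ^ 2 * (\<Sum>p\<in>?P. real (card (C p)) ^ 2)"
    using cP by (intro mult_right_mono sum_nonneg) auto
  finally have "Q ^ 2 \<le> real (card X) ^ 2 * (2 * real (card (rectangles B)) + Q)" using r by simp
  moreover have "Q \<ge> 0" unfolding Q_def by (intro sum_nonneg) auto
  then have "2 * real (card X) ^ 2 * Q \<le> Q * Q" using Q by (intro mult_right_mono) auto
  ultimately show ?thesis by (simp add: power2_eq_square algebra_simps)
qed

lemma card_eq_sum_fibres:
  assumes X: "finite X" and Y: "finite Y" and B: "B \<subseteq> X \<times> Y"
  shows "card B = (\<Sum>v\<in>Y. card {u\<in>X. (u, v) \<in> B})"
proof -
  have "B = (\<lambda>(v, u). (u, v)) ` Sigma Y (\<lambda>v. {u\<in>X. (u, v) \<in> B})" using B by force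
  then have "card B = card ((\<lambda>(v, u). (u, v)) ` Sigma Y (\<lambda>v. {u\<in>X. (u, v) \<in> B}))"
    by (rule arg_cong)
  also have "\<dots> = card (Sigma Y (\<lambda>v. {u\<in>X. (u, v) \<in> B}))"
    by (rule card_image) (auto simp: inj_on_def)
  also have "\<dots> = (\<Sum>v\<in>Y. card {u\<in>X. (u, v) \<in> B})" using X Y by (intro card_SigmaI) auto
  finally show ?thesis .
qed

text \<open>A fibre of size \<open>c\<close> contains at least \<open>c - 1\<close> pairs, because
  \<open>(c - 1) * (c - 2) \<ge> 0\<close> for integers. So the excess of edges over
  \<open>card Y\<close> bounds \<open>Q\<close>, even if the average degree in \<open>Y\<close> is
  only slightly above 1.\<close>

lemma rectangles_ge_excess:
  assumes X: "finite X" and Y: "finite Y" and B: "B \<subseteq> X \<times> Y"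
    and g: "real (card B) \<ge> real (card Y) + g" "g \<ge> 2 * real (card X) ^ 2"
  shows "g ^ 2 \<le> 4 * real (card X) ^ 2 * real (card (rectangles B))"
proof -
  define Q where "Q = (\<Sum>v\<in>Y. real (card (ordered_pairs {u\<in>X. (u, v) \<in> B})))"
  have "real (card B) - real (card Y) = (\<Sum>v\<in>Y. real (card {u\<in>X. (u, v) \<in> B}) - 1)"
    unfolding card_eq_sum_fibres[OF X Y B] by (simp add: sum_subtractf)
  also have "\<dots> \<le> Q" unfolding Q_def
  proof (rule sum_mono)
    fix v
    let ?c = "card {u\<in>X. (u, v) \<in> B}"
    have "(real ?c - 1) * (real ?c - 2) \<ge> 0"
    proof (cases "?c \<le> 1")
      case True then show ?thesis by (intro mult_nonpos_nonpos) auto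
    next
      case False then show ?thesis by (intro mult_nonneg_nonneg) auto
    qed
    then show "real ?c - 1 \<le> real (card (ordered_pairs {u\<in>X. (u, v) \<in> B}))"
      using card_ordered_pairs[of "{u\<in>X. (u, v) \<in> B}"] X by (simp add: power2_eq_square algebra_simps)
  qed
  finally have gQ: "g \<le> Q" using g by simp
  have "g ^ 2 \<le> Q ^ 2" using gQ g(2) by (intro power_mono) (auto intro: order_trans[rotated])
  also have "Q ^ 2 \<le> 4 * real (card X) ^ 2 * real (card (rectangles B))"
    using rectangles_ge[OF X Y B] gQ g(2) unfolding Q_def by simp
  finally show ?thesis .
qed

text \<open>A second use of Cauchy-Schwarz, over the fibres in \<open>Y\<close>, bounds
  \<open>Q\<close> from below by \<open>card B ^ 2 / (4 * card Y)\<close>. The first condition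
  absorbs the linear term; the second makes \<open>Q\<close> large enough for
  \<open>rectangles_ge\<close>.\<close>

lemma rectangles_ge_dense:
  assumes X: "finite X" and Y: "finite Y" and B: "B \<subseteq> X \<times> Y"
    and b: "real (card B) \<ge> 2 * real (card Y)" "real (card B) ^ 2 \<ge> 8 * real (card X) ^ 2 * real (card Y)"
    and y: "card Y > 0"
  shows "real (card B) ^ 4 \<le> 64 * real (card X) ^ 2 * real (card Y) ^ 2 * real (card (rectangles B))"
proof -
  define Q where "Q = (\<Sum>v\<in>Y. real (card (ordered_pairs {u\<in>X. (u, v) \<in> B})))"
  let ?d = "\<lambda>v. real (card {u\<in>X. (u, v) \<in> B})"
  have cB: "real (card B) = (\<Sum>v\<in>Y. ?d v)" using card_eq_sum_fibres[OF X Y B] by simp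
  have "2 * Q = (\<Sum>v\<in>Y. 2 * real (card (ordered_pairs {u\<in>X. (u, v) \<in> B})))"
    unfolding Q_def by (simp add: sum_distrib_left)
  also have "\<dots> = (\<Sum>v\<in>Y. ?d v ^ 2) - real (card B)"
    unfolding cB using X by (simp add: card_ordered_pairs sum_subtractf)
  finally have Q2: "2 * Q = (\<Sum>v\<in>Y. ?d v ^ 2) - real (card B)" .
  have "real (card B) ^ 2 \<le> real (card Y) * (\<Sum>v\<in>Y. ?d v ^ 2)"
    unfolding cB by (rule sum_square_le_card_mult)
  then have "real (card B) ^ 2 \<le> real (card Y) * (2 * Q + real (card B))" using Q2 by simp
  moreover have "2 * real (card Y) * real (card B) \<le> real (card B) ^ 2"
    using b(1) mult_right_mono[OF b(1), of "real (card B)"] by (simp add: power2_eq_square)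
  ultimately have bQ: "real (card B) ^ 2 \<le> 4 * real (card Y) * Q" by (simp add: algebra_simps)
  have "real (card Y) * (2 * real (card X) ^ 2) \<le> real (card Y) * Q"
    using b(2) bQ by (simp add: algebra_simps)
  then have Qx: "Q \<ge> 2 * real (card X) ^ 2" using y by simp
  have "real (card B) ^ 4 = (real (card B) ^ 2) ^ 2" by simp
  also have "\<dots> \<le> (4 * real (card Y) * Q) ^ 2" using bQ by (intro power_mono) auto
  also have "\<dots> = 16 * real (card Y) ^ 2 * Q ^ 2" by (simp add: power_mult_distrib)
  also have "\<dots> \<le> 16 * real (card Y) ^ 2 * (4 * real (card X) ^ 2 * real (card (rectangles B)))"
    using rectangles_ge[OF X Y B] Qx unfolding Q_def by (intro mult_left_mono) auto
  finally show ?thesis by (simp add: mult_ac)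
qed

section \<open>Random graphs by counting colourings\<close>

definition vertex_pairs :: "nat \<Rightarrow> nat set set" where
  "vertex_pairs n = {e. e \<subseteq> {..<n} \<and> card e = 2}"

lemma finite_vertex_pairs [simp]: "finite (vertex_pairs n)"
  unfolding vertex_pairs_def by (rule finite_subset[of _ "Pow {..<n}"]) auto

lemma vertex_pairs_iff: "{u, v} \<in> vertex_pairs n \<longleftrightarrow> u < n \<and> v < n \<and> u \<noteq> v"
  by (auto simp: vertex_pairs_def card_insert_if)

text \<open>A random graph with edge probability \<open>1 / q\<close> is modelled by counting: colour the vertex pairs
  with \<open>q\<close> colours and keep the pairs of colour \<open>0\<close>.\<close>

lemma card_colourings_avoiding:
  fixes q :: nat
  assumes P: "finite P" and R: "finite R" and q: "q \<ge> 1"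
    and e: "e1 ` R \<subseteq> P" "e2 ` R \<subseteq> P" "inj_on e1 R" "inj_on e2 R" "e1 ` R \<inter> e2 ` R = {}"
  shows "real (card {f \<in> P \<rightarrow>\<^sub>E {..<q}. \<forall>r\<in>R. \<not> (f (e1 r) = 0 \<and> f (e2 r) = 0)})
     \<le> real q ^ card P * (1 - 1 / real q ^ 2) ^ card R"
proof -
  let ?F = "{f \<in> P \<rightarrow>\<^sub>E {..<q}. \<forall>r\<in>R. \<not> (f (e1 r) = 0 \<and> f (e2 r) = 0)}"
  let ?D = "{..<q} \<times> {..<q} - {(0, 0)}"
  define P' where "P' = P - (e1 ` R \<union> e2 ` R)"
  \<comment> \<open>A colouring is encoded by its values off the diagonals and, for each
    \<open>r\<close>, by the pair of colours of its two diagonals; the forbidden pair leaves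
    \<open>q^2 - 1\<close> choices.\<close>
  let ?h = "\<lambda>f. (restrict f P', restrict (\<lambda>r. (f (e1 r), f (e2 r))) R)"
  have "card (e1 ` R \<union> e2 ` R) = 2 * card R" using R e by (simp add: card_Un_disjoint card_image)
  then have cP: "card P = card P' + 2 * card R"
    using P R e card_mono[of P "e1 ` R \<union> e2 ` R"] by (simp add: P'_def card_Diff_subset)
  have "card ?F \<le> card ((P' \<rightarrow>\<^sub>E {..<q}) \<times> (R \<rightarrow>\<^sub>E ?D))"
  proof (rule card_inj_on_le[where f = ?h])
    show "inj_on ?h ?F"
    proof (rule inj_onI)
      fix f g assume f: "f \<in> ?F" and g: "g \<in> ?F"
        and eq: "?h f = ?h g"
      show "f = g"
      proof (rule PiE_ext)
        show "f \<in> P \<rightarrow>\<^sub>E {..<q}" "g \<in> P \<rightarrow>\<^sub>E {..<q}" using f g by auto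
        fix p assume p: "p \<in> P"
        have 1: "restrict f P' p = restrict g P' p" for p using eq by simp
        have 2: "restrict (\<lambda>r. (f (e1 r), f (e2 r))) R r = restrict (\<lambda>r. (g (e1 r), g (e2 r))) R r" for r using eq by simp
        show "f p = g p"
        proof (cases "p \<in> P'")
          case True then show ?thesis using 1[of p] by simp
        next
          case False
          then obtain r where "r \<in> R" "p = e1 r \<or> p = e2 r" using p by (auto simp: P'_def)
          then show ?thesis using 2[of r] by auto
        qed
      qed
    qed
    show "?h ` ?F \<subseteq> (P' \<rightarrow>\<^sub>E {..<q}) \<times> (R \<rightarrow>\<^sub>E ?D)"
      using e by (force simp: PiE_iff P'_def)
    show "finite ((P' \<rightarrow>\<^sub>E {..<q}) \<times> (R \<rightarrow>\<^sub>E ?D))"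
      using P R by (auto intro!: finite_PiE simp: P'_def)
  qed
  also have "card ?D = q ^ 2 - 1" using q by (subst card_Diff_subset) (auto simp: power2_eq_square)
  then have "card ((P' \<rightarrow>\<^sub>E {..<q}) \<times> (R \<rightarrow>\<^sub>E ?D)) = q ^ card P' * (q ^ 2 - 1) ^ card R"
    using P R by (simp add: card_cartesian_product card_funcsetE P'_def)
  finally have "real (card ?F) \<le> real (q ^ card P' * (q ^ 2 - 1) ^ card R)" by (simp only: of_nat_le_iff)
  also have "\<dots> = real q ^ card P' * (real q ^ 2 - 1) ^ card R" using q by (simp add: of_nat_diff)
  also have "\<dots> = real q ^ card P * (1 - 1 / real q ^ 2) ^ card R"
  proof -
    have "real q ^ 2 - 1 = real q ^ 2 * (1 - 1 / real q ^ 2)" using q by (simp add: field_simps)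
    then show ?thesis unfolding cP by (simp add: power_add power_mult power_mult_distrib)
  qed
  finally show ?thesis .
qed

lemma card_colourings_zero_on:
  assumes P: "finite P" and T: "T \<subseteq> P"
  shows "card {f \<in> P \<rightarrow>\<^sub>E {..<q::nat}. \<forall>e\<in>T. f e = 0} \<le> q ^ (card P - card T)"
proof -
  let ?C = "\<lambda>e. if e \<in> T then {0} else {..<q}"
  have "card {f \<in> P \<rightarrow>\<^sub>E {..<q}. \<forall>e\<in>T. f e = 0} \<le> card (PiE P ?C)"
    using P by (intro card_mono finite_PiE) (auto simp: PiE_iff extensional_def)
  also have "\<dots> = (\<Prod>e\<in>P. if e \<in> T then 1 else q)"
    using P by (subst card_PiE) (auto intro!: prod.cong)
  also have "\<dots> = q ^ card (P - T)"
    using P by (simp add: prod.If_cases Diff_eq)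
  also have "card (P - T) = card P - card T"
    using P T by (simp add: card_Diff_subset finite_subset)
  finally show ?thesis .
qed

text \<open>A union bound over the vertex and over \<open>k\<close> of its at most \<open>n\<close>
  incident pairs, all of colour 0.\<close>

lemma card_colourings_high_degree:
  fixes q n k :: nat
  assumes q: "q \<ge> 1"
  shows "real (card {f \<in> vertex_pairs n \<rightarrow>\<^sub>E {..<q}. \<exists>v<n. card {e \<in> vertex_pairs n. f e = 0 \<and> v \<in> e} \<ge> k})
     \<le> real q ^ card (vertex_pairs n) * (real n * real (n choose k) / real q ^ k)"
proof -
  let ?P = "vertex_pairs n"
  define I where "I = (\<lambda>v. {e \<in> ?P. v \<in> e})"
  define TT where "TT = (\<lambda>v. {T. T \<subseteq> I v \<and> card T = k})"
  have fI: "finite (I v)" for v by (simp add: I_def)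
  have cI: "card (I v) \<le> n" for v
  proof -
    have "I v \<subseteq> (\<lambda>u. {v, u}) ` {..<n}"
    proof
      fix e assume e: "e \<in> I v"
      then obtain x y where "e = {x, y}" by (auto simp: I_def vertex_pairs_def card_2_iff)
      then show "e \<in> (\<lambda>u. {v, u}) ` {..<n}" using e by (auto simp: I_def vertex_pairs_def)
    qed
    then have "card (I v) \<le> card ((\<lambda>u. {v, u}) ` {..<n})" by (intro card_mono) auto
    also have "\<dots> \<le> n" using card_image_le[of "{..<n}" "\<lambda>u. {v, u}"] by simp
    finally show ?thesis .
  qed
  have fT: "finite (TT v)" for v unfolding TT_def by (rule finite_subset[of _ "Pow (I v)"]) (auto simp: fI)
  have cT: "card (TT v) \<le> n choose k" for v
    unfolding TT_def using n_subsets[OF fI, of v k] binomial_right_mono[OF cI] by simp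
  let ?Z = "\<lambda>T. {f \<in> ?P \<rightarrow>\<^sub>E {..<q}. \<forall>e\<in>T. f e = 0}"
  let ?F = "{f \<in> ?P \<rightarrow>\<^sub>E {..<q}. \<exists>v<n. card {e \<in> ?P. f e = 0 \<and> v \<in> e} \<ge> k}"
  have fin: "finite (?P \<rightarrow>\<^sub>E {..<q})" by (intro finite_PiE) auto
  have fZ: "finite (?Z T)" for T using fin by simp
  have "?F \<subseteq> (\<Union>v\<in>{..<n}. \<Union>T\<in>TT v. ?Z T)"
  proof
    fix f assume "f \<in> ?F"
    then obtain v where v: "v < n" "card {e \<in> ?P. f e = 0 \<and> v \<in> e} \<ge> k" and f: "f \<in> ?P \<rightarrow>\<^sub>E {..<q}" by auto
    obtain T where "T \<subseteq> {e \<in> ?P. f e = 0 \<and> v \<in> e}" "card T = k"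
      using obtain_subset_with_card_n[OF v(2)] by metis
    then show "f \<in> (\<Union>v\<in>{..<n}. \<Union>T\<in>TT v. ?Z T)" using v f by (auto simp: TT_def I_def intro!: bexI[of _ v] exI[of _ T])
  qed
  then have "card ?F \<le> card (\<Union>v\<in>{..<n}. \<Union>T\<in>TT v. ?Z T)"
    by (intro card_mono) (auto simp: fT fin)
  also have "\<dots> \<le> (\<Sum>v<n. card (\<Union>T\<in>TT v. ?Z T))" by (rule card_UN_le) auto
  also have "\<dots> \<le> (\<Sum>v<n. \<Sum>T\<in>TT v. card (?Z T))" by (intro sum_mono card_UN_le fT)
  finally have "real (card ?F) \<le> (\<Sum>v<n. \<Sum>T\<in>TT v. real (card (?Z T)))"
    by (simp only: of_nat_le_iff flip: of_nat_sum)
  also have "\<dots> \<le> (\<Sum>v<n. \<Sum>T\<in>TT v. real q ^ card ?P / real q ^ k)"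
  proof (intro sum_mono)
    fix v T assume T: "T \<in> TT v"
    then have T': "T \<subseteq> ?P" "card T = k" by (auto simp: TT_def I_def)
    then have k: "k \<le> card ?P" using card_mono[of ?P T] by auto
    have "real (card (?Z T)) \<le> real (q ^ (card ?P - k))"
      using card_colourings_zero_on[OF _ T'(1)] T'(2) by (simp only: of_nat_le_iff) simp
    also have "\<dots> = real q ^ card ?P / real q ^ k"
      unfolding of_nat_power using q k by (intro power_diff) auto
    finally show "real (card (?Z T)) \<le> real q ^ card ?P / real q ^ k" .
  qed
  also have "\<dots> = (\<Sum>v<n. real (card (TT v)) * (real q ^ card ?P / real q ^ k))" by simp
  also have "\<dots> \<le> (\<Sum>v<n. real (n choose k) * (real q ^ card ?P / real q ^ k))"
    using cT by (intro sum_mono mult_right_mono) auto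
  also have "\<dots> = real q ^ card ?P * (real n * real (n choose k) / real q ^ k)" by simp
  finally show ?thesis .
qed

text \<open>Both diagonals have product \<open>(u * v) * (u' * v') = (u * v') * (u' * v)\<close>.
  Since multiplication is injective on \<open>B\<close>, distinct edges belong to distinct vertices.
  The order \<open>u < u'\<close>, \<open>v < v'\<close> makes \<open>e1\<close> the increasing and
  \<open>e2\<close> the decreasing diagonal, so each recovers the rectangle and the two families
  never meet.\<close>

lemma rectangle_diagonals:
  assumes lab: "inj_on lab {..<n}"
    and B: "inj_on (\<lambda>(u, v). u * v) B" "\<And>u v. (u, v) \<in> B \<Longrightarrow> u * v \<in> lab ` {..<n::nat}"
  obtains e1 e2 where "e1 ` rectangles B \<subseteq> vertex_pairs n" "e2 ` rectangles B \<subseteq> vertex_pairs n"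
    "inj_on e1 (rectangles B)" "inj_on e2 (rectangles B)" "e1 ` rectangles B \<inter> e2 ` rectangles B = {}"
    "\<And>r. r \<in> rectangles B \<Longrightarrow> \<exists>a b c d. e1 r = {a, b} \<and> e2 r = {c, d} \<and> lab a * lab b = lab c * (lab d :: nat)"
proof -
  define \<nu> where "\<nu> = (\<lambda>p :: nat \<times> nat. inv_into {..<n} lab (fst p * snd p))"
  have \<nu>: "lab (\<nu> (u, v)) = u * v" "\<nu> (u, v) < n" if "(u, v) \<in> B" for u v
    using B(2)[OF that] inv_into_into[of "u * v" lab "{..<n}"] by (auto simp: \<nu>_def f_inv_into_f)
  have inj: "\<nu> p = \<nu> p' \<longleftrightarrow> p = p'" if "p \<in> B" "p' \<in> B" for p p'
  proof
    assume eq: "\<nu> p = \<nu> p'"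
    obtain u v u' v' where p: "p = (u, v)" "p' = (u', v')" by (metis prod.exhaust)
    have "u * v = u' * v'" using \<nu>(1) that eq unfolding p by metis
    then show "p = p'" using inj_onD[OF B(1), of p p'] that p by simp
  qed simp
  define e1 where "e1 = (\<lambda>((u, u'), (v, v')). {\<nu> (u, v), \<nu> (u', v')})"
  define e2 where "e2 = (\<lambda>((u, u'), (v, v')). {\<nu> (u, v'), \<nu> (u', v)})"
  show ?thesis
  proof (rule that[of e1 e2])
    show "e1 ` rectangles B \<subseteq> vertex_pairs n" "e2 ` rectangles B \<subseteq> vertex_pairs n"
      by (auto simp: rectangles_def e1_def e2_def vertex_pairs_iff \<nu> inj)
    show "inj_on e1 (rectangles B)"
      by (auto simp: rectangles_def e1_def inj_on_def doubleton_eq_iff inj)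
    show "inj_on e2 (rectangles B)"
      by (auto simp: rectangles_def e2_def inj_on_def doubleton_eq_iff inj)
    show "e1 ` rectangles B \<inter> e2 ` rectangles B = {}"
      by (auto simp: rectangles_def e1_def e2_def doubleton_eq_iff inj)
    fix r assume "r \<in> rectangles B"
    then obtain u u' v v' where r: "r = ((u, u'), (v, v'))" "(u, v) \<in> B" "(u', v) \<in> B" "(u, v') \<in> B" "(u', v') \<in> B"
      by (auto simp: rectangles_def)
    then show "\<exists>a b c d. e1 r = {a, b} \<and> e2 r = {c, d} \<and> lab a * lab b = lab c * lab d"
      by (intro exI[of _ "\<nu> (u, v)"] exI[of _ "\<nu> (u', v')"] exI[of _ "\<nu> (u, v')"] exI[of _ "\<nu> (u', v)"])
         (simp add: e1_def e2_def \<nu>)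
  qed
qed

subsection \<open>Conflicts in dense sets of labels\<close>

text \<open>By unique factorization the product of two prime labels determines the vertex pair,
  whatever the graph.\<close>

lemma prime_labeling:
  assumes "n \<le> prime_count N" and G: "simple_graph n E"
  shows "\<exists>lab. valid_labeling n N E lab"
proof -
  obtain lab where lab: "lab ` {..<n} \<subseteq> {p. prime p \<and> p \<le> N}" "inj_on lab {..<n}"
    using card_le_inj[of "{..<n}" "{p. prime p \<and> p \<le> N}"] assms by (auto simp: prime_count_def)
  have pr: "prime (lab v)" "lab v \<le> N" if "v < n" for v using lab(1) that by auto
  have "valid_labeling n N E lab"
    unfolding valid_labeling_def
  proof (intro conjI allI impI lab(2))
    show "lab ` {..<n} \<subseteq> {1..N}" using pr prime_ge_1_nat by force
    fix u v x y assume uv: "{u, v} \<in> E" and xy: "{x, y} \<in> E" and ne: "{u, v} \<noteq> {x, y}"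
    have h: "u < n" "v < n" "x < n" "y < n"
      using simple_graph_edgeD[OF G uv] simple_graph_edgeD[OF G xy] by auto
    show "lab u * lab v \<noteq> lab x * lab y"
    proof
      assume eq: "lab u * lab v = lab x * lab y"
      have "lab u dvd lab x * lab y" using eq by (metis dvd_triv_left)
      then have "lab u = lab x \<or> lab u = lab y"
        using pr h by (meson prime_dvd_mult_iff primes_dvd_imp_eq)
      then have "lab u = lab x \<and> lab v = lab y \<or> lab u = lab y \<and> lab v = lab x"
        using eq pr(1)[OF h(3)] pr(1)[OF h(4)] by (auto dest: prime_gt_0_nat)
      then have "u = x \<and> v = y \<or> u = y \<and> v = x"
        using h inj_onD[OF lab(2)] by (metis lessThan_iff)
      then show False using ne by (auto simp: insert_commute)
    qed
  qed
  then show ?thesis by blast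
qed

lemma P_graph_le_of_prime_count:
  assumes "simple_graph n E" "n \<le> prime_count N" "N > 0"
  shows "P_graph n E \<le> N"
  using prime_labeling P_graph_le assms by blast

lemma exists_prime_count_ge: "\<exists>N>0. n \<le> prime_count N"
proof -
  obtain T where T: "finite T" "card T = n" "T \<subseteq> {p::nat. prime p}"
    using infinite_arbitrarily_large[OF primes_infinite] by blast
  define N where "N = Suc (\<Sum>T)"
  have "T \<subseteq> {p. prime p \<and> p \<le> N}"
  proof
    fix p assume p: "p \<in> T"
    then have "p \<le> \<Sum>T" using T(1) member_le_sum[of p T "\<lambda>x. x"] by simp
    then show "p \<in> {p. prime p \<and> p \<le> N}" using p T(3) by (auto simp: N_def)
  qed
  then have "card T \<le> prime_count N" unfolding prime_count_def by (intro card_mono) auto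
  then have "n \<le> prime_count N" using T(2) by simp
  then show ?thesis by (auto simp: N_def)
qed

lemma P_graph_attained:
  assumes G: "simple_graph n E"
  shows "\<exists>lab. valid_labeling n (P_graph n E) E lab"
proof -
  let ?Q = "\<lambda>N. N > 0 \<and> (\<exists>lab. product_injective_labeling n E lab \<and> lab ` {0..<n} \<subseteq> {1..int N})"
  obtain N lab where "N > 0" "valid_labeling n N E lab"
    using exists_prime_count_ge prime_labeling[OF _ G] by blast
  then have "?Q N" using valid_labeling_int by blast
  then have "?Q (P_graph n E)" unfolding P_graph_def by (rule LeastI)
  then obtain l where l: "product_injective_labeling n E l" "l ` {0..<n} \<subseteq> {1..int (P_graph n E)}" by blast
  have l1: "1 \<le> l v" "l v \<le> int (P_graph n E)" if "v < n" for v
  proof -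
    have "l v \<in> l ` {0..<n}" using that by auto
    then have "l v \<in> {1..int (P_graph n E)}" using l(2) by blast
    then show "1 \<le> l v" "l v \<le> int (P_graph n E)" by auto
  qed
  have "valid_labeling n (P_graph n E) E (\<lambda>v. nat (l v))"
    unfolding valid_labeling_def
  proof (intro conjI allI impI)
    show "inj_on (\<lambda>v. nat (l v)) {..<n}"
    proof (rule inj_onI)
      fix u v assume h: "u \<in> {..<n}" "v \<in> {..<n}" "nat (l u) = nat (l v)"
      then have "l u = l v" using l1[of u] l1[of v] by auto
      then show "u = v" using l(1) h unfolding product_injective_labeling_def by (auto dest: inj_onD)
    qed
    show "(\<lambda>v. nat (l v)) ` {..<n} \<subseteq> {1..P_graph n E}" using l1 by (force simp: le_nat_iff)
    fix u v x y assume h: "{u, v} \<in> E" "{x, y} \<in> E" "{u, v} \<noteq> {x, y}"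
    have "l u * l v \<noteq> l x * l y" using l(1) h unfolding product_injective_labeling_def by blast
    moreover have "l u \<ge> 0" "l v \<ge> 0" "l x \<ge> 0" "l y \<ge> 0"
      using l1(1) simple_graph_edgeD[OF G h(1)] simple_graph_edgeD[OF G h(2)] by force+
    ultimately show "nat (l u) * nat (l v) \<noteq> nat (l x) * nat (l y)"
      by (simp add: nat_mult_distrib[symmetric] eq_nat_nat_iff)
  qed
  then show ?thesis by blast
qed

text \<open>The interface between the arithmetic and the random graph: \<open>B\<close> is a
  bipartite graph whose edges stand for distinct members of \<open>A\<close> via their
  product.\<close>

definition product_rectangles :: "nat set \<Rightarrow> real \<Rightarrow> bool" where
  "product_rectangles A M \<longleftrightarrow> (\<exists>B. finite B \<and> inj_on (\<lambda>(u, v). u * v) B \<and>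
     (\<forall>(u, v)\<in>B. u * v \<in> A) \<and> M \<le> real (card (rectangles B)))"

text \<open>A union bound over colourings: each of the \<open>N ^ n\<close> labelings is valid for a
  fraction at most \<open>(1 - 1 / q^2) ^ M \<le> exp (- M / q^2)\<close> of them, and the last
  summand bounds the fraction with a vertex of degree above \<open>d\<close>. If these add up to
  less than 1, some colouring escapes both.\<close>

lemma exists_hard_graph:
  fixes q n N d :: nat and M :: real
  assumes q: "q \<ge> 1"
    and B: "\<And>lab. inj_on lab {..<n} \<Longrightarrow> lab ` {..<n} \<subseteq> {1..N} \<Longrightarrow>
      product_rectangles (lab ` {..<n}) M"
    and small: "real N ^ n * exp (- M / real q ^ 2) + real n * real (n choose Suc d) / real q ^ Suc d < 1"
  obtains E where "simple_graph n E" "max_degree_le n E d" "P_graph n E > N"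
proof -
  let ?P = "vertex_pairs n"
  let ?F = "?P \<rightarrow>\<^sub>E {..<q}"
  define LL where "LL = ({..<n} \<rightarrow>\<^sub>E {1..N})"
  define Z where "Z = (\<lambda>f. {e \<in> ?P. f e = (0::nat)})"
  define bad where "bad = (\<lambda>lab. {f \<in> ?F. valid_labeling n N (Z f) lab})"
  define high where "high = {f \<in> ?F. \<exists>v<n. card {e \<in> ?P. f e = 0 \<and> v \<in> e} \<ge> Suc d}"
  have fF: "finite ?F" by (intro finite_PiE) auto
  have fL: "finite LL" unfolding LL_def by (intro finite_PiE) auto
  have q0: "real q > 0" using q by simp
  have cF: "real (card ?F) = real q ^ card ?P" by (simp add: card_funcsetE)
  have cbad: "real (card (bad lab)) \<le> real q ^ card ?P * exp (- M / real q ^ 2)" if lab: "lab \<in> LL" for lab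
  proof (cases "inj_on lab {..<n}")
    case False
    then have "bad lab = {}" by (auto simp: bad_def valid_labeling_def)
    then show ?thesis by simp
  next
    case True
    have "lab ` {..<n} \<subseteq> {1..N}" using lab by (auto simp: LL_def PiE_iff)
    from B[OF True this] obtain B where B: "finite B" "inj_on (\<lambda>(u, v). u * v) B" "\<forall>(u, v)\<in>B. u * v \<in> lab ` {..<n}"
      "M \<le> real (card (rectangles B))"
      unfolding product_rectangles_def by (elim exE conjE) (rule that; assumption)
    have Bl: "u * v \<in> lab ` {..<n}" if "(u, v) \<in> B" for u v using B(3) that by auto
    obtain e1 e2 where e: "e1 ` rectangles B \<subseteq> ?P" "e2 ` rectangles B \<subseteq> ?P"
      "inj_on e1 (rectangles B)" "inj_on e2 (rectangles B)" "e1 ` rectangles B \<inter> e2 ` rectangles B = {}"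
      "\<And>r. r \<in> rectangles B \<Longrightarrow> \<exists>a b c d. e1 r = {a, b} \<and> e2 r = {c, d} \<and> lab a * lab b = lab c * lab d"
      by (rule rectangle_diagonals[OF True B(2)], (rule Bl; assumption), (rule that; assumption))
    have "bad lab \<subseteq> {f \<in> ?F. \<forall>r\<in>rectangles B. \<not> (f (e1 r) = 0 \<and> f (e2 r) = 0)}"
    proof
      fix f assume f: "f \<in> bad lab"
      have "\<not> (f (e1 r) = 0 \<and> f (e2 r) = 0)" if r: "r \<in> rectangles B" for r
      proof
        assume 0: "f (e1 r) = 0 \<and> f (e2 r) = 0"
        obtain a b c d where abcd: "e1 r = {a, b}" "e2 r = {c, d}" "lab a * lab b = lab c * lab d" using e(6)[OF r] by blast
        have "{a, b} \<in> Z f" "{c, d} \<in> Z f" using 0 e(1,2) r abcd by (auto simp: Z_def)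
        moreover have "{a, b} \<noteq> {c, d}" using e(5) r abcd by (metis disjoint_iff imageI)
        ultimately show False using f abcd(3) unfolding bad_def valid_labeling_def by blast
      qed
      then show "f \<in> {f \<in> ?F. \<forall>r\<in>rectangles B. \<not> (f (e1 r) = 0 \<and> f (e2 r) = 0)}"
        using f by (auto simp: bad_def)
    qed
    then have "card (bad lab) \<le> card {f \<in> ?F. \<forall>r\<in>rectangles B. \<not> (f (e1 r) = 0 \<and> f (e2 r) = 0)}"
      using fF by (intro card_mono) auto
    then have "real (card (bad lab)) \<le> real q ^ card ?P * (1 - 1 / real q ^ 2) ^ card (rectangles B)"
      using card_colourings_avoiding[OF finite_vertex_pairs finite_rectangles[OF B(1)] q e(1-5)] by linarith
    also have "\<dots> \<le> real q ^ card ?P * exp (- 1 / real q ^ 2) ^ card (rectangles B)"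
    proof (intro mult_left_mono power_mono)
      show "1 - 1 / real q ^ 2 \<le> exp (- 1 / real q ^ 2)" using exp_ge_add_one_self[of "- 1 / real q ^ 2"] by simp
      show "0 \<le> 1 - 1 / real q ^ 2" using q by (simp add: divide_le_eq)
    qed auto
    also have "exp (- 1 / real q ^ 2) ^ card (rectangles B) = exp (- real (card (rectangles B)) / real q ^ 2)"
      by (simp flip: exp_of_nat_mult)
    also have "real q ^ card ?P * exp (- real (card (rectangles B)) / real q ^ 2) \<le> real q ^ card ?P * exp (- M / real q ^ 2)"
      using B(4) q0 by (intro mult_left_mono) (auto intro!: divide_right_mono)
    finally show ?thesis .
  qed
  have "card LL = N ^ n" by (simp add: LL_def card_funcsetE)
  have "\<exists>f\<in>?F. f \<notin> (\<Union>lab\<in>LL. bad lab) \<union> high"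
  proof (rule ccontr)
    assume "\<not> ?thesis"
    then have "?F \<subseteq> (\<Union>lab\<in>LL. bad lab) \<union> high" by blast
    moreover have "(\<Union>lab\<in>LL. bad lab) \<union> high \<subseteq> ?F" by (auto simp: bad_def high_def)
    then have "finite ((\<Union>lab\<in>LL. bad lab) \<union> high)" using fF by (rule finite_subset)
    ultimately have "card ?F \<le> card ((\<Union>lab\<in>LL. bad lab) \<union> high)" by (intro card_mono)
    also have "\<dots> \<le> (\<Sum>lab\<in>LL. card (bad lab)) + card high"
      using card_Un_le[of "\<Union>lab\<in>LL. bad lab" high] card_UN_le[OF fL, of bad] by linarith
    finally have "real (card ?F) \<le> (\<Sum>lab\<in>LL. real (card (bad lab))) + real (card high)"
      by (simp only: of_nat_le_iff flip: of_nat_sum of_nat_add)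
    also have "\<dots> \<le> (\<Sum>lab\<in>LL. real q ^ card ?P * exp (- M / real q ^ 2)) +
         real q ^ card ?P * (real n * real (n choose Suc d) / real q ^ Suc d)"
      using cbad card_colourings_high_degree[OF q, of n "Suc d"] unfolding high_def
      by (intro add_mono sum_mono) auto
    also have "\<dots> = real q ^ card ?P * (real N ^ n * exp (- M / real q ^ 2) + real n * real (n choose Suc d) / real q ^ Suc d)"
      using \<open>card LL = N ^ n\<close> by (simp add: algebra_simps)
    also have "\<dots> < real q ^ card ?P * 1" using small q0 by (intro mult_strict_left_mono) auto
    finally show False unfolding cF by simp
  qed
  then obtain f where f: "f \<in> ?F" "\<And>lab. lab \<in> LL \<Longrightarrow> f \<notin> bad lab" "f \<notin> high" by blast
  have G: "simple_graph n (Z f)"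
    unfolding simple_graph_def Z_def vertex_pairs_def by (force simp: card_2_iff)
  show ?thesis
  proof (rule that[OF G])
    have "card {e \<in> Z f. v \<in> e} \<le> d" if "v < n" for v
    proof -
      have "{e \<in> Z f. v \<in> e} = {e \<in> ?P. f e = 0 \<and> v \<in> e}" by (auto simp: Z_def)
      then show ?thesis using f(1,3) that by (auto simp: high_def not_less_eq_eq)
    qed
    then show "max_degree_le n (Z f) d" by (simp add: max_degree_le_def Defs.degree_def)
    show "P_graph n (Z f) > N"
    proof (rule ccontr)
      assume le: "\<not> P_graph n (Z f) > N"
      obtain lab where lab: "valid_labeling n (P_graph n (Z f)) (Z f) lab"
        using P_graph_attained[OF G] by blast
      \<comment> \<open>\<open>LL\<close> holds only extensional functions, which keeps it finite;
        restriction is harmless because edges lie inside the vertex set.\<close>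
      let ?l = "restrict lab {..<n}"
      have "lab ` {..<n} \<subseteq> {1..N}" using lab le unfolding valid_labeling_def by fastforce
      moreover from this have "?l \<in> LL" by (auto simp: LL_def)
      moreover have "\<forall>u v x y. {u, v} \<in> Z f \<longrightarrow> {x, y} \<in> Z f \<longrightarrow> {u, v} \<noteq> {x, y} \<longrightarrow> ?l u * ?l v \<noteq> ?l x * ?l y"
        using lab simple_graph_edgeD[OF G] unfolding valid_labeling_def by simp
      ultimately have "?l \<in> LL" "f \<in> bad ?l"
        using f(1) lab by (auto simp: bad_def valid_labeling_def inj_on_def)
      then show False using f(2) by blast
    qed
  qed
qed

text \<open>The least divisor \<open>u \<ge> L\<close> of \<open>a\<close> is below \<open>L\<^sup>2\<close> unless it is prime.\<close>

lemma divisor_dichotomy: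
  fixes a N L :: nat
  assumes a: "L \<le> a" "a \<le> N" and L: "2 \<le> L" "L * L * L \<le> N"
  shows "(\<exists>u. u dvd a \<and> L \<le> u \<and> u * L \<le> N) \<or> (\<exists>s p. a = s * p \<and> prime p \<and> 1 \<le> s \<and> s < L)"
proof (cases "\<exists>u. u dvd a \<and> L \<le> u \<and> u * L \<le> N")
  case no: False
  define u where "u = (LEAST u. u dvd a \<and> L \<le> u)"
  have u: "u dvd a" "L \<le> u" using LeastI[of "\<lambda>u. u dvd a \<and> L \<le> u" a] a by (auto simp: u_def)
  have least: "u \<le> w" if "w dvd a" "L \<le> w" for w using Least_le[of "\<lambda>u. u dvd a \<and> L \<le> u" w] that by (auto simp: u_def)
  \<comment> \<open>With \<open>L^3 \<le> N\<close> this gives \<open>u > L^2\<close>, so a prime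
    factor of \<open>u\<close> whose cofactor is below \<open>L\<close> must itself be at least
    \<open>L\<close>.\<close>
  have uN: "u * L > N" using no u by force
  then have "L * L < u" using L by (metis le_less_trans mult_less_cancel2)
  obtain p where p: "prime p" "p dvd u" using prime_factor_nat[of u] u L by force
  then obtain w where w: "u = p * w" by blast
  have "w > 0" using w u L by (cases w) auto
  have "w < u" using w p(1) \<open>w > 0\<close> prime_gt_1_nat[OF p(1)] by simp
  have "w dvd a" using u(1) w by (metis dvd_mult_right)
  then have "w < L" using least[of w] \<open>w < u\<close> by (meson not_le)
  have "L \<le> p"
  proof (rule ccontr)
    assume "\<not> L \<le> p"
    then have "p * w \<le> L * L" using \<open>w < L\<close> by (intro mult_le_mono) auto
    then show False using w \<open>L * L < u\<close> by simp
  qed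
  then have "u \<le> p" using least[of p] p(2) u(1) dvd_trans by blast
  obtain s where s: "a = s * p" using p(2) u(1) dvd_trans by (metis dvd_def mult.commute)
  have "s \<ge> 1" using s a L by (cases s) auto
  moreover have "s < L"
  proof (rule ccontr)
    assume "\<not> s < L"
    then have "u * L \<le> p * s" using \<open>u \<le> p\<close> by (intro mult_le_mono) auto
    then show False using s a(2) uN by (simp add: mult.commute)
  qed
  ultimately show ?thesis using s p(1) by blast
qed simp

section \<open>Rectangles in dense sets of integers\<close>

text \<open>The factorizations \<open>a = s * p\<close> form a bipartite graph between the cofactors
  below \<open>L\<close> and the primes up to \<open>N\<close>. It has at least \<open>t\<close>
  more edges than there are primes.\<close>

lemma rectangles_of_prime_multiples:
  fixes A :: "nat set" and N L :: nat and t :: real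
  assumes A: "A \<subseteq> {1..N}"
    and sp: "\<And>a. a \<in> A \<Longrightarrow> \<exists>s p. a = s * p \<and> prime p \<and> 1 \<le> s \<and> s < L"
    and t: "real (card A) \<ge> real (prime_count N) + t" "t \<ge> 2 * real L ^ 2"
  shows "product_rectangles A (t ^ 2 / (4 * real L ^ 2))"
proof -
  obtain f where f: "\<And>a. a \<in> A \<Longrightarrow> a = fst (f a) * snd (f a) \<and> prime (snd (f a)) \<and> 1 \<le> fst (f a) \<and> fst (f a) < L"
  proof -
    have "\<exists>z. a = fst z * snd z \<and> prime (snd z) \<and> 1 \<le> fst z \<and> fst z < L" if "a \<in> A" for a
      using sp[OF that] by auto
    then show ?thesis using that by metis
  qed
  let ?B = "f ` A" and ?X = "{1..<L}" and ?Y = "{p. prime p \<and> p \<le> N}"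
  have fA: "finite A" using A finite_subset by blast
  have "inj_on f A" using f by (metis inj_onI)
  then have cB: "card ?B = card A" by (rule card_image)
  have BXY: "?B \<subseteq> ?X \<times> ?Y"
  proof
    fix z assume "z \<in> ?B"
    then obtain a where a: "a \<in> A" "z = f a" by blast
    have "1 * snd (f a) \<le> fst (f a) * snd (f a)" using f[OF a(1)] by (intro mult_le_mono1) auto
    also have "\<dots> \<le> N" using f[OF a(1)] A a(1) by auto
    finally show "z \<in> ?X \<times> ?Y" using f[OF a(1)] a(2) by (auto simp: mem_Times_iff)
  qed
  have X: "real (card ?X) ^ 2 \<le> real L ^ 2" by (intro power_mono) auto
  have t0: "t \<ge> 0" using t(2) by (rule order_trans[rotated]) simp
  have t': "t \<ge> 2 * real (card ?X) ^ 2" using t(2) X by linarith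
  have c': "real (card ?B) \<ge> real (card ?Y) + t" using t(1) cB by (simp add: prime_count_def)
  have "t ^ 2 \<le> 4 * real (card ?X) ^ 2 * real (card (rectangles ?B))"
    by (rule rectangles_ge_excess[OF _ _ BXY c' t']) auto
  also have "\<dots> \<le> 4 * real L ^ 2 * real (card (rectangles ?B))" using X by (intro mult_right_mono mult_left_mono) auto
  finally have "t ^ 2 / (4 * real L ^ 2) \<le> real (card (rectangles ?B))"
    by (cases "L = 0") (auto simp: divide_le_eq mult.commute)
  moreover have "inj_on (\<lambda>(u, v). u * v) ?B" using f by (auto simp: inj_on_def case_prod_beta)
  moreover have "\<forall>(u, v)\<in>?B. u * v \<in> A" using f by (auto simp: case_prod_beta)
  ultimately show ?thesis using fA unfolding product_rectangles_def by (intro exI[of _ ?B]) auto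
qed

text \<open>Pigeonhole over \<open>K\<close> dyadic ranges of the chosen divisor. For divisors in
  \<open>[2^i, 2^(i+1))\<close> the cofactors are at most \<open>N / 2^i\<close>, so the two sides
  have sizes with product at most \<open>N\<close>. As the divisor lies between \<open>L\<close> and
  \<open>N / L\<close>, they also have size at most \<open>N / L\<close> and \<open>2 N / L\<close>,
  which is what the density conditions need.\<close>

lemma rectangles_of_medium_divisors:
  fixes A :: "nat set" and N L K :: nat and b :: real
  assumes A: "A \<subseteq> {1..N}" and L: "L \<ge> 1" and K: "N < 2 ^ K"
    and div: "\<And>a. a \<in> A \<Longrightarrow> \<exists>u. u dvd a \<and> L \<le> u \<and> u * L \<le> N"
    and b: "real (card A) \<ge> real K * b" "b \<ge> 4 * real N / real L" "b ^ 2 \<ge> 8 * real N ^ 2 / real L" "b > 0"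
    and K0: "K > 0"
  shows "product_rectangles A (b ^ 4 / (64 * real N ^ 2))"
proof -
  obtain u where u: "\<And>a. a \<in> A \<Longrightarrow> u a dvd a \<and> L \<le> u a \<and> u a * L \<le> N" using div by metis
  have "\<exists>j. 2 ^ j \<le> u a \<and> u a < 2 ^ (j + 1)" if "a \<in> A" for a
    using u[OF that] L by (intro ex_power_ivl1) auto
  then obtain j where j: "\<And>a. a \<in> A \<Longrightarrow> 2 ^ j a \<le> u a \<and> u a < 2 ^ (j a + 1)" by metis
  have fA: "finite A" using A finite_subset by blast
  have jK: "j a < K" if "a \<in> A" for a
  proof -
    have "u a * 1 \<le> u a * L" using L by (intro mult_le_mono2)
    then have "(2::nat) ^ j a < 2 ^ K" using u[OF that] j[OF that] K by linarith
    then show ?thesis by simp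
  qed
  have "\<exists>i<K. b \<le> real (card {a\<in>A. j a = i})"
  proof (rule ccontr)
    assume "\<not> ?thesis"
    then have lt: "\<And>i. i < K \<Longrightarrow> real (card {a\<in>A. j a = i}) < b" by force
    have "j ` A \<subseteq> {..<K}" using jK by auto
    then have "card A = (\<Sum>i<K. card {a\<in>A. j a = i})"
      using sum.group[OF fA, of "{..<K}" j "\<lambda>_. 1::nat"] by simp
    then have "real (card A) = (\<Sum>i<K. real (card {a\<in>A. j a = i}))" by simp
    also have "\<dots> < (\<Sum>i<K. b)" using lt K0 by (intro sum_strict_mono) auto
    finally show False using b(1) by simp
  qed
  then obtain i where i: "b \<le> real (card {a\<in>A. j a = i})" by blast
  let ?A = "{a\<in>A. j a = i}"
  define f where "f = (\<lambda>a. (u a, a div u a))"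
  let ?B = "f ` ?A" and ?X = "{2 ^ i..<2 ^ (i + 1)} :: nat set" and ?Y = "{1..N div 2 ^ i}"
  have prod: "fst (f a) * snd (f a) = a" if "a \<in> A" for a using u[OF that] by (simp add: f_def)
  have "inj_on f ?A"
  proof (rule inj_onI)
    fix a a' assume a: "a \<in> ?A" "a' \<in> ?A" and eq: "f a = f a'"
    have aA: "a \<in> A" "a' \<in> A" using a by simp_all
    show "a = a'"
      using arg_cong[OF eq, of "\<lambda>z. fst z * snd z"] by (simp only: prod[OF aA(1)] prod[OF aA(2)])
  qed
  then have cB: "card ?B = card ?A" by (rule card_image)
  have "card ?A \<noteq> 0" using i b(4) by linarith
  then have "?A \<noteq> {}" by force
  then obtain a0 where a0: "a0 \<in> A" "j a0 = i" by blast
  have a0': "2 ^ i \<le> u a0" "u a0 < 2 ^ (i + 1)" "L \<le> u a0" "u a0 * L \<le> N" using u[OF a0(1)] j[OF a0(1)] a0(2) by auto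
  have BXY: "?B \<subseteq> ?X \<times> ?Y"
  proof
    fix z assume "z \<in> ?B"
    then obtain a where a: "a \<in> A" "j a = i" "z = f a" by blast
    have "a div u a * 2 ^ i \<le> a div u a * u a" using j[OF a(1)] a(2) by (intro mult_le_mono2) auto
    also have "\<dots> \<le> a" by (rule div_times_less_eq_dividend)
    also have "a \<le> N" using A a(1) by auto
    finally have "a div u a \<le> N div 2 ^ i" by (simp add: less_eq_div_iff_mult_less_eq)
    moreover have "a div u a \<ge> 1" using prod[OF a(1)] A a(1) by (cases "a div u a") (auto simp: f_def)
    ultimately show "z \<in> ?X \<times> ?Y" using j[OF a(1)] a by (auto simp: f_def)
  qed
  define x where "x = real (card ?X)"
  define y where "y = real (card ?Y)"
  have x: "x = 2 ^ i" by (simp add: x_def)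
  have L0: "real L > 0" using L by simp
  have "2 ^ i * (N div 2 ^ i) \<le> N" by simp
  then have "real (2 ^ i * (N div 2 ^ i)) \<le> real N" by (simp only: of_nat_le_iff)
  then have xy: "x * y \<le> real N" by (simp add: x y_def)
  have xL: "x * real L \<le> real N"
  proof -
    have "2 ^ i * L \<le> N" using a0'(1,4) mult_le_mono1[of "2 ^ i" "u a0" L] by linarith
    then have "real (2 ^ i * L) \<le> real N" by (simp only: of_nat_le_iff)
    then show ?thesis by (simp add: x)
  qed
  have yL: "y * real L \<le> 2 * real N"
  proof -
    have "L \<le> 2 * 2 ^ i" using a0' by simp
    then have "real L \<le> real (2 * 2 ^ i)" by (simp only: of_nat_le_iff)
    then have "y * real L \<le> y * (2 * x)" by (intro mult_left_mono) (auto simp: x y_def)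
    also have "y * (2 * x) = 2 * (x * y)" by simp
    finally show ?thesis using xy by linarith
  qed
  have N0: "real N \<ge> 0" "x \<ge> 0" "y \<ge> 0" by (auto simp: x_def y_def)
  have "card ?Y > 0"
  proof -
    have "u a0 * 1 \<le> u a0 * L" using L by (intro mult_le_mono2)
    then have "2 ^ i \<le> N" using a0' by linarith
    then show ?thesis by (simp add: div_greater_zero_iff)
  qed
  moreover have "real (card ?B) \<ge> 2 * y"
  proof -
    have "2 * y \<le> 4 * real N / real L" using yL L0 by (simp add: field_simps)
    then show ?thesis using b(2) i cB by simp
  qed
  moreover have "8 * x ^ 2 * y \<le> real (card ?B) ^ 2"
  proof -
    have "(x * y) * (x * real L) \<le> real N * real N" using xy xL N0 L0 by (intro mult_mono) auto
    then have "8 * x ^ 2 * y \<le> 8 * real N ^ 2 / real L" using L0 by (simp add: field_simps power2_eq_square)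
    also have "\<dots> \<le> b ^ 2" by (rule b(3))
    also have "\<dots> \<le> real (card ?B) ^ 2" using i b(4) cB by (intro power_mono) auto
    finally show ?thesis .
  qed
  ultimately have "real (card ?B) ^ 4 \<le> 64 * x ^ 2 * y ^ 2 * real (card (rectangles ?B))"
    unfolding x_def y_def by (intro rectangles_ge_dense[OF _ _ BXY]) auto
  also have "\<dots> = 64 * (x * y) ^ 2 * real (card (rectangles ?B))" by (simp add: power_mult_distrib)
  also have "\<dots> \<le> 64 * real N ^ 2 * real (card (rectangles ?B))"
    using xy N0 by (intro mult_right_mono mult_left_mono power_mono) auto
  finally have "real (card ?B) ^ 4 \<le> 64 * real N ^ 2 * real (card (rectangles ?B))" .
  moreover have "b ^ 4 \<le> real (card ?B) ^ 4" using i b(4) cB by (intro power_mono) auto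
  ultimately have "b ^ 4 \<le> 64 * real N ^ 2 * real (card (rectangles ?B))" by linarith
  then have "b ^ 4 / (64 * real N ^ 2) \<le> real (card (rectangles ?B))"
    by (cases "N = 0") (auto simp: divide_le_eq mult.commute)
  moreover have "inj_on (\<lambda>(u, v). u * v) ?B" using prod by (auto simp: inj_on_def case_prod_beta)
  moreover have "\<forall>(u, v)\<in>?B. u * v \<in> A" using prod by (auto simp: case_prod_beta)
  ultimately show ?thesis using fA unfolding product_rectangles_def by (intro exI[of _ ?B]) auto
qed

lemma product_rectangles_mono:
  assumes "product_rectangles A M" "M' \<le> M" "A \<subseteq> A'"
  shows "product_rectangles A' M'"
  using assms unfolding product_rectangles_def case_prod_beta by (meson order_trans subsetD)

text \<open>Of the surplus \<open>2 * t\<close> over the primes, one \<open>t\<close> is spent on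
  the members with a medium divisor. If these number fewer than \<open>t\<close>, then after also
  dropping those below \<open>L\<close> an excess \<open>t\<close> over the primes remains.\<close>

lemma rectangles_of_dense_set:
  fixes A :: "nat set" and N L K :: nat and t M :: real
  assumes A: "A \<subseteq> {1..N}" and L: "2 \<le> L" "L * L * L \<le> N" and K: "N < 2 ^ K" "K > 0"
    and c: "real (card A) \<ge> real (prime_count N) + 2 * t + real L"
    and t: "t \<ge> 2 * real L ^ 2" "t / K \<ge> 4 * real N / real L" "(t / K) ^ 2 \<ge> 8 * real N ^ 2 / real L"
    and M: "4 * real L ^ 2 * M \<le> t ^ 2" "64 * real N ^ 2 * M \<le> (t / K) ^ 4"
  shows "product_rectangles A M"
proof -
  define A1 where "A1 = {a\<in>A. \<exists>u. u dvd a \<and> L \<le> u \<and> u * L \<le> N}"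
  have fA: "finite A" using A finite_subset by blast
  have L0: "real L > 0" using L by simp
  have "0 < 2 * real L ^ 2" using L0 by simp
  then have t0: "t > 0" using t(1) by linarith
  have "0 < L * L * L" using L by simp
  then have N0: "real N > 0" using L(2) by linarith
  show ?thesis
  proof (cases "real (card A1) \<ge> t")
    case True
    have "product_rectangles A1 ((t / K) ^ 4 / (64 * real N ^ 2))"
      using A L K t t0 True by (intro rectangles_of_medium_divisors) (auto simp: A1_def)
    moreover have "M \<le> (t / K) ^ 4 / (64 * real N ^ 2)" using M(2) N0 by (simp add: le_divide_eq mult.commute)
    ultimately show ?thesis by (rule product_rectangles_mono) (auto simp: A1_def)
  next
    case False
    define A2 where "A2 = A - A1 - {..<L}"
    have "card A \<le> card (A2 \<union> A1 \<union> {..<L})" using fA by (intro card_mono) (auto simp: A2_def A1_def)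
    also have "\<dots> \<le> card A2 + card A1 + card {..<L}"
      by (rule order_trans[OF card_Un_le]) (simp add: card_Un_le)
    finally have "real (card A) \<le> real (card A2) + real (card A1) + real L" by simp
    then have c2: "real (card A2) \<ge> real (prime_count N) + t" using False c by linarith
    have "\<exists>s p. a = s * p \<and> prime p \<and> 1 \<le> s \<and> s < L" if "a \<in> A2" for a
    proof -
      have a: "a \<in> A" "L \<le> a" "\<not> (\<exists>u. u dvd a \<and> L \<le> u \<and> u * L \<le> N)"
        using that by (auto simp: A2_def A1_def)
      have "a \<le> N" using A a(1) by auto
      from divisor_dichotomy[OF a(2) this L] a(3) show ?thesis by (elim disjE) blast+
    qed
    then have "product_rectangles A2 (t ^ 2 / (4 * real L ^ 2))"
      using A c2 t(1) by (intro rectangles_of_prime_multiples) (auto simp: A2_def)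
    moreover have "M \<le> t ^ 2 / (4 * real L ^ 2)" using M(1) L0 by (simp add: le_divide_eq mult.commute)
    ultimately show ?thesis by (rule product_rectangles_mono) (auto simp: A2_def)
  qed
qed

subsection \<open>Asymptotics\<close>

lemma finite_P_graph_values:
  "finite {P_graph n E | E. simple_graph n E \<and> max_degree_le n E d}"
proof (rule finite_subset)
  have "E \<subseteq> Pow {..<n}" if G: "simple_graph n E" for E
  proof
    fix e assume "e \<in> E"
    then obtain u v where "e = {u, v}" "u < n" "v < n" using G unfolding simple_graph_def by blast
    then show "e \<in> Pow {..<n}" by simp
  qed
  then show "{P_graph n E | E. simple_graph n E \<and> max_degree_le n E d} \<subseteq> P_graph n ` Pow (Pow {..<n})"
    by blast
qed simp

lemma P_graph_le_P_nd:
  "simple_graph n E \<Longrightarrow> max_degree_le n E d \<Longrightarrow> P_graph n E \<le> P_nd n d"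
  unfolding P_nd_def by (intro Max_ge finite_P_graph_values) auto

lemma empty_graph: "simple_graph n {}" "max_degree_le n {} d"
  by (auto simp: simple_graph_def max_degree_le_def Defs.degree_def)

lemma P_nd_le:
  assumes "\<And>E. simple_graph n E \<Longrightarrow> max_degree_le n E d \<Longrightarrow> P_graph n E \<le> N"
  shows "P_nd n d \<le> N"
  unfolding P_nd_def
proof (rule Max.boundedI[OF finite_P_graph_values])
  show "{P_graph n E | E. simple_graph n E \<and> max_degree_le n E d} \<noteq> {}"
    using empty_graph[of n] by blast
qed (use assms in auto)

lemma le_P_nd: "n \<le> P_nd n d"
proof -
  obtain lab where "valid_labeling n (P_graph n {}) {} lab"
    using P_graph_attained[OF empty_graph(1)[of n]] by blast
  then have "card {..<n} \<le> card {1..P_graph n {}}"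
    unfolding valid_labeling_def by (intro card_inj_on_le[of lab]) auto
  then have "n \<le> P_graph n {}" by simp
  then show ?thesis using P_graph_le_P_nd[OF empty_graph] le_trans by blast
qed

section \<open>The sparse range\<close>

text \<open>The exponent -2 gives \<open>d^2 \<le> n / ln^4 n\<close>. The energy costs
  \<open>n^2 ln^2 n\<close>, so the loss \<open>n * d^2 * energy / \<kappa>^3\<close> is
  \<open>O(n / ln^2 n)\<close>, below the spare \<open>e * n\<close>.\<close>

lemma P_nd_sparse_upper:
  fixes e :: real
  assumes e: "0 < e" "e \<le> 1"
  shows "eventually (\<lambda>n. \<forall>d. real d \<le> sqrt (real n) * ln (real n) powr (- 2) \<longrightarrow>
    real (P_nd n d) \<le> (1 + e) * real n) sequentially"
proof -
  have "eventually (\<lambda>x::real. e*x - 1 - 32*x*(1+ln (2*x))^2/(e^3*ln x^4) \<ge> e*x/2) at_top"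
    using e by real_asymp
  then have "eventually (\<lambda>n. e*real n - 1 - 32*real n*(1+ln (2*real n))^2/(e^3*ln (real n)^4) \<ge> e*real n/2) sequentially"
    by (rule eventually_compose_filterlim[OF _ filterlim_real_sequentially])
  then show ?thesis using eventually_ge_at_top[of 3]
  proof eventually_elim
    case (elim n)
    define x where "x = real n"
    have x: "x \<ge> 3" using elim by (simp add: x_def)
    define l where "l = ln x"
    have l: "l > 0" using x by (simp add: l_def)
    show ?case
    proof (intro allI impI)
      fix d assume d: "real d \<le> sqrt (real n) * ln (real n) powr (- 2)"
      have "real d \<le> sqrt x / l ^ 2"
        using d l by (simp add: x_def l_def powr_minus powr_numeral divide_inverse)
      then have "real d ^ 2 \<le> (sqrt x / l ^ 2) ^ 2" by (intro power_mono) auto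
      also have "\<dots> = x / l ^ 4" using x by (simp add: power_divide)
      finally have d2: "real d ^ 2 \<le> x / l ^ 4" .
      define N where "N = nat \<lfloor>(1 + e) * x\<rfloor>"
      have "(1 + e) * x \<ge> 0" using e x by simp
      then have N: "real N \<le> (1 + e) * x" "real N > (1 + e) * x - 1" unfolding N_def by linarith+
      have ex: "e * x \<le> x" "e * x > 0" using e x by auto
      have Nx: "x - 1 < real N" "real N \<le> 2 * x" using N ex by (simp_all add: algebra_simps)
      then have N1: "N \<ge> 1" using x by linarith
      have "product_energy N \<le> (real N * (1 + ln N)) ^ 2" by (rule card_product_quadruples_le[OF N1])
      also have "\<dots> \<le> (2 * x * (1 + ln (2 * x))) ^ 2"
        using N1 Nx x by (intro power_mono mult_mono add_left_mono) auto
      finally have Q: "product_energy N \<le> 4 * x ^ 2 * (1 + ln (2 * x)) ^ 2"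
        by (simp add: power_mult_distrib)
      \<comment> \<open>Half of the \<open>e * x\<close> spare labels is the guaranteed growth
        factor, the other half pays for conflicts and rounding. The 8 of \<open>\<kappa>^3\<close>
        and the 4 from \<open>N \<le> 2 * x\<close> give the 32 in the asymptotic
        inequality.\<close>
      define \<kappa> where "\<kappa> = e * x / 2"
      have \<kappa>: "\<kappa> > 0" using e x by (simp add: \<kappa>_def)
      have "x * real d ^ 2 * product_energy N \<le> x * (x / l ^ 4) * (4 * x ^ 2 * (1 + ln (2 * x)) ^ 2)"
        using d2 Q x l by (intro mult_mono) auto
      then have "x * real d ^ 2 * product_energy N / \<kappa> ^ 3 \<le> x * (x / l ^ 4) * (4 * x ^ 2 * (1 + ln (2 * x)) ^ 2) / \<kappa> ^ 3"
        using \<kappa> by (intro divide_right_mono) auto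
      also have "\<dots> = 32 * x * (1 + ln (2 * x)) ^ 2 / (e ^ 3 * l ^ 4)"
        using e x l by (simp add: \<kappa>_def field_simps power2_eq_square power3_eq_cube)
      finally have "real N - real n - real n * real d ^ 2 * product_energy N / \<kappa> ^ 3 \<ge> \<kappa>"
        using N elim(1) unfolding x_def[symmetric] l_def[symmetric] \<kappa>_def by (simp add: algebra_simps)
      from P_graph_le_of_quadruples[OF _ _ \<kappa> this] have "P_nd n d \<le> N" by (intro P_nd_le)
      then show "real (P_nd n d) \<le> (1 + e) * real n" using N by (simp add: x_def)
    qed
  qed
qed

section \<open>The dense range\<close>

lemma prime_count_bounds:
  fixes e :: real
  assumes "e > 0"
  shows "eventually (\<lambda>N. (1 - e) * (real N / ln (real N)) \<le> real (prime_count N) \<and>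
    real (prime_count N) \<le> (1 + e) * (real N / ln (real N))) sequentially"
proof -
  have "eventually (\<lambda>N. \<bar>real (prime_count N) * ln (real N) / real N - 1\<bar> < e) sequentially"
    using tendstoD[OF prime_number_theorem assms] by (simp add: dist_real_def)
  then show ?thesis using eventually_gt_at_top[of 1]
  proof eventually_elim
    case (elim N)
    define y where "y = real N / ln (real N)"
    have y: "y > 0" using elim by (simp add: y_def)
    have "real (prime_count N) * ln (real N) / real N = real (prime_count N) / y" by (simp add: y_def)
    then have "\<bar>real (prime_count N) / y - 1\<bar> < e" using elim by simp
    then show ?case using y unfolding y_def[symmetric] by (simp add: abs_less_iff field_simps)
  qed
qed

lemma filterlim_floor_n_ln_n:
  fixes c :: real
  assumes "c > 0"
  shows "filterlim (\<lambda>n. nat \<lfloor>c * (real n * ln (real n))\<rfloor>) at_top sequentially"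
proof -
  have "filterlim (\<lambda>n::nat. c * (real n * ln (real n)) - 1) at_top sequentially" using assms by real_asymp
  moreover have "eventually (\<lambda>n. c * (real n * ln (real n)) - 1 \<le> real (nat \<lfloor>c * (real n * ln (real n))\<rfloor>)) sequentially"
    by (intro always_eventually allI) linarith
  ultimately have "filterlim (\<lambda>n. real (nat \<lfloor>c * (real n * ln (real n))\<rfloor>)) at_top sequentially"
    by (rule filterlim_at_top_mono)
  then show ?thesis by (simp add: filterlim_sequentially_iff_filterlim_real)
qed

text \<open>\<open>ln N\<close> is asymptotic to \<open>ln n\<close>, so about
  \<open>(1 + e) * n\<close> primes lie below \<open>N\<close>, enough to label all \<open>n\<close>
  vertices; \<open>d\<close> is irrelevant for this bound.\<close>

lemma P_nd_dense_upper:
  fixes e :: real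
  assumes e: "0 < e" "e \<le> 1"
  shows "eventually (\<lambda>n. \<forall>d. real (P_nd n d) \<le> (1 + e) * (real n * ln (real n))) sequentially"
proof -
  define N where "N = (\<lambda>n. nat \<lfloor>(1 + e) * (real n * ln (real n))\<rfloor>)"
  have NN: "filterlim N at_top sequentially"
    unfolding N_def using e by (intro filterlim_floor_n_ln_n) auto
  have ev1: "eventually (\<lambda>n. (1 - e / 4) * (real (N n) / ln (real (N n))) \<le> real (prime_count (N n)) \<and>
    real (prime_count (N n)) \<le> (1 + e / 4) * (real (N n) / ln (real (N n)))) sequentially"
    using eventually_compose_filterlim[OF prime_count_bounds NN] e by simp
  have "((\<lambda>x::real. (((1+e)*(x * ln x) - 1)/ln ((1+e)*(x*ln x)))/x) \<longlongrightarrow> 1+e) at_top"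
    using e by real_asymp
  then have "eventually (\<lambda>x::real. (((1+e)*(x * ln x) - 1)/ln ((1+e)*(x*ln x)))/x > 1 + e / 2) at_top"
    using e by (intro order_tendstoD(1)) auto
  then have ev2: "eventually (\<lambda>n. (((1+e)*(real n * ln (real n)) - 1)/ln ((1+e)*(real n*ln (real n))))/real n > 1 + e / 2) sequentially"
    by (rule eventually_compose_filterlim[OF _ filterlim_real_sequentially])
  have ev3: "eventually (\<lambda>n. N n \<ge> 2) sequentially"
    using NN by (simp add: filterlim_at_top)
  show ?thesis using ev1 ev2 ev3 eventually_ge_at_top[of 3]
  proof eventually_elim
    case (elim n)
    define X where "X = (1 + e) * (real n * ln (real n))"
    have n: "real n > 0" using elim by simp
    have "X \<ge> 0" using e elim by (simp add: X_def)
    then have NX: "real (N n) \<le> X" "real (N n) > X - 1" unfolding N_def X_def[symmetric] by linarith+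
    have N2: "real (N n) \<ge> 2" using elim by simp
    have lnN: "ln (real (N n)) > 0" "ln (real (N n)) \<le> ln X" using N2 NX by auto
    have "(1 + e / 2) * real n < (X - 1) / ln X" using elim(2) unfolding X_def[symmetric] pos_less_divide_eq[OF n] .
    also have "\<dots> \<le> real (N n) / ln (real (N n))"
      using NX N2 lnN by (intro frac_le) auto
    finally have a: "(1 + e / 2) * real n < real (N n) / ln (real (N n))" .
    have "1 \<le> (1 - e / 4) * (1 + e / 2)"
      using e mult_left_mono[of e 1 e] by (simp add: algebra_simps)
    then have "1 * real n \<le> (1 - e / 4) * (1 + e / 2) * real n" using n by (intro mult_right_mono) auto
    also have "\<dots> \<le> (1 - e / 4) * (real (N n) / ln (real (N n)))"
      unfolding mult.assoc using a e by (intro mult_left_mono) auto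
    also have "\<dots> \<le> real (prime_count (N n))" using elim(1) by simp
    finally have pc: "n \<le> prime_count (N n)" by simp
    have "P_nd n d \<le> N n" for d
      using pc elim(3) by (intro P_nd_le P_graph_le_of_prime_count) auto
    then have "real (P_nd n d) \<le> real (N n)" for d by simp
    then show ?case using NX(1) unfolding X_def by (meson order_trans)
  qed
qed

text \<open>From \<open>n choose k \<le> n^k / k!\<close> and
  \<open>k^k / k! \<le> exp k \<le> 3^k\<close> the quotient is at most
  \<open>(3 n / (k q))^k\<close>. The factor 6 thus says that the expected degree
  \<open>n / q\<close> is at most \<open>k / 6\<close>.\<close>

lemma binomial_over_power_le:
  fixes n k q :: nat
  assumes k: "k > 0" and q: "6 * real n \<le> real k * real q"
  shows "real (n choose k) / real q ^ k \<le> (1 / 2) ^ k"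
proof (cases "q = 0")
  case True then show ?thesis using k by (simp add: power_0_left)
next
  case False
  then have q0: "real q > 0" by simp
  have "real k ^ k / fact k \<le> exp (real k)"
  proof -
    have "(\<lambda>i. real k ^ i /\<^sub>R fact i) sums exp (real k)" by (rule exp_converges)
    then have s: "(\<lambda>i. real k ^ i / fact i) sums exp (real k)" by (simp add: divide_inverse mult.commute)
    have "(\<Sum>i\<in>{k}. real k ^ i / fact i) \<le> (\<Sum>i. real k ^ i / fact i)"
      using s by (intro sum_le_suminf) (auto simp: sums_iff)
    then show ?thesis using sums_unique[OF s] by simp
  qed
  also have "\<dots> \<le> 3 ^ k"
  proof -
    have "exp (real k) = exp 1 ^ k" by (simp flip: exp_of_nat_mult)
    also have "\<dots> \<le> 3 ^ k" using exp_le by (intro power_mono) auto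
    finally show ?thesis .
  qed
  finally have f: "real k ^ k \<le> 3 ^ k * fact k" by (simp add: field_simps)
  have "real (n choose k) * fact k \<le> real n ^ k"
    using binomial_fact_pow[of n k] by (metis of_nat_fact of_nat_le_iff of_nat_mult of_nat_power)
  then have "real (n choose k) * fact k * 6 ^ k \<le> real n ^ k * 6 ^ k" by (intro mult_right_mono) auto
  also have "\<dots> = (6 * real n) ^ k" by (simp add: power_mult_distrib)
  also have "\<dots> \<le> (real k * real q) ^ k" using q by (intro power_mono) auto
  also have "\<dots> = real k ^ k * real q ^ k" by (simp add: power_mult_distrib)
  also have "\<dots> \<le> (3 ^ k * fact k) * real q ^ k" using f by (intro mult_right_mono) auto
  finally have "real (n choose k) * fact k * 6 ^ k \<le> 3 ^ k * fact k * real q ^ k" .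
  moreover have "(6::real) ^ k = 3 ^ k * 2 ^ k" by (simp flip: power_mult_distrib)
  ultimately have "fact k * 3 ^ k * (real (n choose k) * 2 ^ k) \<le> fact k * 3 ^ k * real q ^ k"
    by (simp only: mult_ac)
  then have "real (n choose k) * 2 ^ k \<le> real q ^ k" by (subst (asm) mult_le_cancel_left_pos) auto
  then show ?thesis using q0 by (simp add: field_simps)
qed

text \<open>With \<open>L \<approx> (ln n)\<^sup>5\<close> and \<open>K \<approx> 4 ln n\<close> dyadic scales there are at least
  \<open>M = n\<^sup>2 / (ln n)\<^sup>1\<^sup>1\<close> rectangles.  Since \<open>q \<le> 7 n / d\<close>, the degree bound \<open>d \<ge> sqrt n (ln n)\<^sup>7\<close> gives
  \<open>M / q\<^sup>2 \<ge> n (ln n)\<^sup>3 / 49\<close>, which beats the entropy \<open>n ln N\<close> of the labelings.\<close>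

lemma P_nd_dense_lower:
  fixes e :: real
  assumes e: "0 < e" "e < 1"
  shows "eventually (\<lambda>n. \<forall>d. d \<le> n - 1 \<longrightarrow> real d \<ge> sqrt (real n) * ln (real n) powr 7 \<longrightarrow>
     (1 - e) * (real n * ln (real n)) < real (P_nd n d)) sequentially"
proof -
  define N where "N = (\<lambda>n. nat \<lfloor>(1 - e) * (real n * ln (real n))\<rfloor>)"
  have NN: "filterlim N at_top sequentially"
    unfolding N_def using e by (intro filterlim_floor_n_ln_n) auto
  have ev0: "eventually (\<lambda>n. (1 - e / 4) * (real (N n) / ln (real (N n))) \<le> real (prime_count (N n)) \<and>
    real (prime_count (N n)) \<le> (1 + e / 4) * (real (N n) / ln (real (N n)))) sequentially"
    using eventually_compose_filterlim[OF prime_count_bounds NN] e by simp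
  \<comment> \<open>All requirements as inequalities in \<open>x = n\<close> alone.
    \<open>ln x^5 + 1\<close> and \<open>4*ln x + 1\<close> are the upper bounds for the rounded
    \<open>L\<close> and \<open>K\<close>.\<close>
  define large where "large = (\<lambda>x. 2 \<le> ln x \<and> ln x \<le> x \<and>
     4*x*ln x/ln x^5 \<le> e*x/8/(4*ln x+1) \<and>
     8*(x*ln x)^2/ln x^5 \<le> (e*x/8/(4*ln x+1))^2 \<and>
     4*(ln x^5+1)^2*(x^2/ln x^11) \<le> (e*x/8)^2 \<and>
     64*(x*ln x)^2*(x^2/ln x^11) \<le> (e*x/8/(4*ln x+1))^4 \<and>
     exp (x * ln (x * ln x) - x * ln x ^ 3 / 49) < 1/2 \<and>
     x * (1/2) powr (sqrt x) < 1/2 \<and>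
     (ln x^5+1)^3 \<le> (1-e)*(x*ln x) - 1 \<and>
     x \<le> (1-e)*(x*ln x) - 1 \<and>
     2*(ln x^5+1)^2 \<le> e*x/8 \<and>
     ln x ^ 5 + 1 \<le> e * x / 2)"
  have "eventually large at_top"
    unfolding large_def using e by (intro eventually_conj; real_asymp)
  then have ev1: "eventually (\<lambda>n. large (real n)) sequentially"
    by (rule eventually_compose_filterlim[OF _ filterlim_real_sequentially])
  show ?thesis using ev0 ev1 eventually_ge_at_top[of 3]
  proof eventually_elim
    case (elim n)
    define x where "x = real n"
    define l where "l = ln x"
    define m where "m = N n"
    define X where "X = (1 - e) * (x * l)"
    have x: "x \<ge> 3" using elim by (simp add: x_def)
    note ineqs = elim(2)[unfolded large_def, folded x_def, folded l_def, folded X_def]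
    have l: "l \<ge> 2" "l \<le> x" using ineqs by auto
    have m: "real m \<le> X" "real m > X - 1"
    proof -
      have "X \<ge> 0" using e x l by (simp add: X_def)
      then show "real m \<le> X" "real m > X - 1"
        unfolding m_def N_def X_def[symmetric] x_def[symmetric] l_def[symmetric] by linarith+
    qed
    have "(1 - e) * (x * l) \<le> 1 * (x * l)" using e x l by (intro mult_right_mono) auto
    then have mxl: "real m \<le> x * l" using m by (simp add: X_def)
    have mx: "real m \<ge> x" using m ineqs by linarith
    \<comment> \<open>The condition \<open>(t / K)^2 \<ge> 8 * m^2 / L\<close> needs
      \<open>L\<close> of order at least \<open>l^4\<close>; the fifth power absorbs the
      constants.\<close>
    define L where "L = nat \<lceil>l ^ 5\<rceil>"
    have l5: "l ^ 5 > 2"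
    proof -
      have "(2::real) ^ 5 \<le> l ^ 5" using l by (intro power_mono) auto
      then show ?thesis by simp
    qed
    have L: "real L \<ge> l ^ 5" "real L \<le> l ^ 5 + 1" unfolding L_def using l5 by linarith+
    \<comment> \<open>\<open>2 ^ K \<ge> exp (4 * l * ln 2) > exp (2 * l) = n^2\<close>, and
      \<open>n^2\<close> is at least \<open>n * ln n\<close>.\<close>
    define K where "K = nat \<lceil>4 * l\<rceil>"
    have K: "real K \<ge> 4 * l" "real K \<le> 4 * l + 1" unfolding K_def using l by linarith+
    have K0: "K > 0" "real K > 0" using K l by linarith+
    \<comment> \<open>There are at most \<open>(1 + e/4) * (1 - e) * n \<le> n - 3 e n / 4\<close>
      primes up to \<open>m\<close>. The spare \<open>3 e n / 4\<close> is split into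
      \<open>2 * t = e n / 4\<close> and room \<open>e n / 2\<close> for \<open>L\<close>.\<close>
    define t where "t = e * x / 8"
    have t: "t > 0" using e x by (simp add: t_def)
    \<comment> \<open>The case of prime multiples is the tighter one:
      \<open>4 * L^2 * M \<le> t^2\<close> allows a constant times \<open>n^2 / l^10\<close>, and
      the further \<open>l\<close> absorbs that constant.\<close>
    define M where "M = x ^ 2 / l ^ 11"
    have M: "M \<ge> 0" using l by (simp add: M_def)
    have tK: "e * x / 8 / (4 * l + 1) \<le> t / K" unfolding t_def using K K0 e x by (intro divide_left_mono) auto
    have tK0: "0 \<le> e * x / 8 / (4 * l + 1)" using e x l by simp
    have c1: "2 \<le> L" using L l5 by linarith
    have c2: "L * L * L \<le> m"
    proof -
      have "real L ^ 3 \<le> (l ^ 5 + 1) ^ 3" using L by (intro power_mono) auto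
      then have "real (L * L * L) \<le> real m" using ineqs m by (simp add: power3_eq_cube)
      then show ?thesis by (simp only: of_nat_le_iff)
    qed
    have c3: "m < 2 ^ K"
    proof -
      have el: "exp l = x" using x by (simp add: l_def)
      have "real m \<le> x * l" by (rule mxl)
      also have "\<dots> \<le> x * x" using l x by (intro mult_left_mono) auto
      also have "\<dots> = exp (2 * l)" by (simp only: mult_2 exp_add el)
      also have "\<dots> < exp (4 * l * ln 2)" using l ln2_ge_two_thirds by simp
      also have "\<dots> \<le> exp (real K * ln 2)" using K by simp
      also have "\<dots> = 2 ^ K" by (simp add: exp_of_nat_mult)
      finally have "real m < real (2 ^ K)" by simp
      then show ?thesis by (simp only: of_nat_less_iff)
    qed
    have c4: "x \<ge> real (prime_count m) + 2 * t + real L"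
    proof -
      have "l \<le> ln (real m)" unfolding l_def using mx x by simp
      then have "real m / ln (real m) \<le> X / l" using m mx x l by (intro frac_le) auto
      also have "X / l = (1 - e) * x" using l by (simp add: X_def)
      finally have "(1 + e / 4) * (real m / ln (real m)) \<le> (1 + e / 4) * ((1 - e) * x)"
        using e by (intro mult_left_mono) auto
      then have "real (prime_count m) \<le> (1 + e / 4) * ((1 - e) * x)" using elim(1) unfolding m_def by linarith
      also have "\<dots> = x - 3 * (e * x) / 4 - e * (e * x) / 4" by (simp add: field_simps)
      also have "\<dots> \<le> x - 3 * (e * x) / 4" using e x by simp
      finally show ?thesis using L ineqs unfolding t_def by linarith
    qed
    have c5: "t \<ge> 2 * real L ^ 2"
    proof -
      have "2 * real L ^ 2 \<le> 2 * (l ^ 5 + 1) ^ 2" using L by (intro mult_left_mono power_mono) auto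
      then show ?thesis using ineqs unfolding t_def by linarith
    qed
    have c6: "t / K \<ge> 4 * real m / real L"
    proof -
      have "4 * real m / real L \<le> 4 * (x * l) / l ^ 5"
        using mxl L l5 l x by (intro frac_le) auto
      also have "\<dots> \<le> e * x / 8 / (4 * l + 1)" using ineqs by (simp add: mult.assoc)
      finally show ?thesis using tK by linarith
    qed
    have c7: "(t / K) ^ 2 \<ge> 8 * real m ^ 2 / real L"
    proof -
      have "8 * real m ^ 2 / real L \<le> 8 * (x * l) ^ 2 / l ^ 5"
        using mxl L l5 l x by (intro frac_le mult_left_mono power_mono) auto
      also have "\<dots> \<le> (e * x / 8 / (4 * l + 1)) ^ 2" using ineqs by simp
      also have "\<dots> \<le> (t / K) ^ 2" using tK tK0 by (intro power_mono)
      finally show ?thesis .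
    qed
    have c8: "4 * real L ^ 2 * M \<le> t ^ 2"
    proof -
      have "4 * real L ^ 2 * M \<le> 4 * (l ^ 5 + 1) ^ 2 * M" using L M by (intro mult_right_mono mult_left_mono power_mono) auto
      then show ?thesis using ineqs unfolding M_def t_def by linarith
    qed
    have c9: "64 * real m ^ 2 * M \<le> (t / K) ^ 4"
    proof -
      have "64 * real m ^ 2 * M \<le> 64 * (x * l) ^ 2 * M" using mxl M by (intro mult_right_mono mult_left_mono power_mono) auto
      also have "\<dots> \<le> (e * x / 8 / (4 * l + 1)) ^ 4" using ineqs unfolding M_def by simp
      also have "\<dots> \<le> (t / K) ^ 4" using tK tK0 by (intro power_mono)
      finally show ?thesis .
    qed
    show ?case
    proof (intro allI impI)
      fix d assume d: "d \<le> n - 1" "real d \<ge> sqrt (real n) * ln (real n) powr 7"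
      have d7: "real d \<ge> sqrt x * l ^ 7"
        using d(2) l by (simp add: x_def[symmetric] l_def[symmetric] powr_numeral)
      define k where "k = Suc d"
      have k: "k > 0" "real k \<le> x" "real k \<ge> sqrt x * l ^ 7" using d d7 elim(3) by (auto simp: k_def x_def)
      \<comment> \<open>Edge probability about \<open>d / (6 n)\<close>, so that degrees above
        \<open>d\<close> are exponentially unlikely. As \<open>k = d + 1 \<le> n\<close>, rounding
        up adds at most \<open>x / k\<close>, whence \<open>q \<le> 7 * (x / k)\<close>.\<close>
      define q where "q = nat \<lceil>6 * x / real k\<rceil>"
      have q: "real q \<ge> 6 * x / real k" "real q \<le> 6 * x / real k + 1"
        unfolding q_def using x by (auto simp: ceiling_le_iff)
      have xk: "x / real k \<ge> 1" using k by (simp add: le_divide_eq)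
      have q7: "real q \<le> 7 * (x / real k)" using q xk by simp
      have q1: "real q \<ge> 1" using q xk by linarith
      have q6: "6 * real n \<le> real k * real q" using q(1) k(1) by (simp add: x_def field_simps)
      have B: "product_rectangles (lab ` {..<n}) M"
        if "inj_on lab {..<n}" "lab ` {..<n} \<subseteq> {1..m}" for lab
      proof (rule rectangles_of_dense_set[OF that(2) c1 c2 c3 K0(1) _ c5 c6 c7 c8 c9])
        show "real (prime_count m) + 2 * t + real L \<le> real (card (lab ` {..<n}))"
          using c4 by (simp add: card_image[OF that(1)] x_def)
      qed
      have s1: "real m ^ n * exp (- M / real q ^ 2) < 1 / 2"
      proof -
        have "sqrt x * l ^ 7 \<ge> 0" using x l by simp
        then have "(sqrt x * l ^ 7) ^ 2 \<le> real k ^ 2" using k(3) by (intro power_mono)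
        then have k2: "x * l ^ 14 \<le> real k ^ 2" using x by (simp add: power_mult_distrib flip: power_mult)
        have "real q ^ 2 \<le> (7 * (x / real k)) ^ 2" using q7 by (intro power_mono) auto
        moreover have "0 < 7 * (x / real k)" "0 < real q" using xk q1 by linarith+
        then have "0 < (7 * (x / real k)) ^ 2 * real q ^ 2" by (rule mult_pos_pos[OF zero_less_power zero_less_power])
        ultimately have "M / (7 * (x / real k)) ^ 2 \<le> M / real q ^ 2"
          using M by (intro divide_left_mono)
        moreover have "M / (7 * (x / real k)) ^ 2 = real k ^ 2 / (49 * l ^ 11)"
          using x k(1) l by (simp add: M_def field_simps power2_eq_square)
        moreover have "x * l ^ 14 / (49 * l ^ 11) \<le> real k ^ 2 / (49 * l ^ 11)"
          using k2 l by (intro divide_right_mono) auto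
        moreover have "x * l ^ 14 / (49 * l ^ 11) = x * l ^ 3 / 49"
        proof -
          have e: "l ^ 14 = l ^ 3 * l ^ 11" by (simp flip: power_add)
          have gen: "x * (a * c) / (49 * c) = x * a / 49" if "c \<noteq> 0" for a c :: real using that by simp
          have "l ^ 11 \<noteq> 0" using l by simp
          from gen[OF this] show ?thesis unfolding e .
        qed
        ultimately have Mq: "x * l ^ 3 / 49 \<le> M / real q ^ 2" by linarith
        have "real m ^ n \<le> (x * l) ^ n" using mxl by (intro power_mono) auto
        also have "\<dots> = exp (x * ln (x * l))"
          using x l by (simp add: x_def exp_of_nat_mult)
        finally have "real m ^ n * exp (- M / real q ^ 2) \<le> exp (x * ln (x * l)) * exp (- (x * l ^ 3 / 49))"
          using Mq by (intro mult_mono) auto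
        also have "\<dots> = exp (x * ln (x * l) - x * l ^ 3 / 49)" by (simp add: mult_exp_exp)
        also have "\<dots> < 1 / 2" using ineqs by blast
        finally show ?thesis .
      qed
      have s2: "real n * real (n choose Suc d) / real q ^ Suc d < 1 / 2"
      proof -
        have "real (n choose k) / real q ^ k \<le> (1 / 2) ^ k" by (rule binomial_over_power_le[OF k(1) q6])
        also have "\<dots> = (1 / 2) powr (real k)" by (simp add: powr_realpow)
        also have "\<dots> \<le> (1 / 2) powr (sqrt x)"
        proof -
          have "sqrt x * 1 \<le> sqrt x * l ^ 7" using l x by (intro mult_left_mono one_le_power) auto
          then have "sqrt x \<le> real k" using k(3) by simp
          then show ?thesis by (intro powr_mono') auto
        qed
        finally have "x * (real (n choose k) / real q ^ k) \<le> x * (1 / 2) powr (sqrt x)"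
          using x by (intro mult_left_mono) auto
        also have "\<dots> < 1 / 2" using ineqs by blast
        finally show ?thesis by (simp add: k_def x_def)
      qed
      have "1 \<le> q" using q1 by simp
      moreover have "real m ^ n * exp (- M / real q ^ 2) + real n * real (n choose Suc d) / real q ^ Suc d < 1"
        using s1 s2 by linarith
      ultimately obtain E where E: "simple_graph n E" "max_degree_le n E d" "P_graph n E > m"
        using exists_hard_graph[of q n m M d] B by blast
      have "m < P_nd n d" using E(3) P_graph_le_P_nd[OF E(1,2)] by linarith
      then have "real m + 1 \<le> real (P_nd n d)" by linarith
      then show "(1 - e) * (real n * ln (real n)) < real (P_nd n d)"
        using m(2) unfolding X_def x_def l_def by linarith
    qed
  qed
qed

theorem theorem1:
  "\<exists>a b :: real. a > 0 \<and> b > 0 \<and>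
    (\<forall>d :: nat \<Rightarrow> nat. (\<forall>n. d n \<le> n - 1) \<longrightarrow>
       (eventually (\<lambda>n. real (d n) \<le> sqrt (real n) * (ln (real n)) powr (- a)) sequentially
          \<longrightarrow> (\<lambda>n. real (P_nd n (d n)) / real n) \<longlonglongrightarrow> 1) \<and>
       (eventually (\<lambda>n. real (d n) \<ge> sqrt (real n) * (ln (real n)) powr b) sequentially
          \<longrightarrow> (\<lambda>n. real (P_nd n (d n)) / (real n * ln (real n))) \<longlonglongrightarrow> 1))"
proof (rule exI[of _ 2], rule exI[of _ 7], intro conjI allI impI)
  fix d :: "nat \<Rightarrow> nat"
  assume d: "\<forall>n. d n \<le> n - 1"
  show "(\<lambda>n. real (P_nd n (d n)) / real n) \<longlonglongrightarrow> 1"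
    if ev: "eventually (\<lambda>n. real (d n) \<le> sqrt (real n) * (ln (real n)) powr (- 2)) sequentially"
  proof (rule tendstoI)
    fix r :: real assume r: "r > 0"
    define e where "e = min (r / 2) 1"
    have e: "0 < e" "e \<le> 1" "e < r" using r by (auto simp: e_def)
    show "eventually (\<lambda>n. dist (real (P_nd n (d n)) / real n) 1 < r) sequentially"
      using ev P_nd_sparse_upper[OF e(1,2)] eventually_gt_at_top[of 0]
    proof eventually_elim
      case (elim n)
      have "real (P_nd n (d n)) \<le> (1 + e) * real n" using elim by blast
      moreover have "real n \<le> real (P_nd n (d n))" using le_P_nd by simp
      ultimately have "1 \<le> real (P_nd n (d n)) / real n" "real (P_nd n (d n)) / real n \<le> 1 + e"
        using elim by (auto simp: le_divide_eq divide_le_eq)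
      then show ?case using e by (simp add: dist_real_def)
    qed
  qed
  show "(\<lambda>n. real (P_nd n (d n)) / (real n * ln (real n))) \<longlonglongrightarrow> 1"
    if ev: "eventually (\<lambda>n. real (d n) \<ge> sqrt (real n) * (ln (real n)) powr 7) sequentially"
  proof (rule tendstoI)
    fix r :: real assume r: "r > 0"
    define e where "e = min (r / 2) (1 / 2)"
    have e: "0 < e" "e \<le> 1" "e < 1" "e < r" using r by (auto simp: e_def)
    show "eventually (\<lambda>n. dist (real (P_nd n (d n)) / (real n * ln (real n))) 1 < r) sequentially"
      using ev P_nd_dense_upper[OF e(1,2)] P_nd_dense_lower[OF e(1,3)] eventually_gt_at_top[of 1]
    proof eventually_elim
      case (elim n)
      define y where "y = real n * ln (real n)"
      have y: "y > 0" using elim by (simp add: y_def)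
      have "real (P_nd n (d n)) \<le> (1 + e) * y" "(1 - e) * y < real (P_nd n (d n))"
        using elim d unfolding y_def by blast+
      then have "real (P_nd n (d n)) / y \<le> 1 + e" "1 - e < real (P_nd n (d n)) / y"
        using y by (auto simp: less_divide_eq divide_le_eq)
      then show ?case using e unfolding y_def[symmetric] by (simp add: dist_real_def abs_less_iff)
    qed
  qed
qed auto

end
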